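(* Let $I,J\in\operatorname{Irr}(\mathcal C)$ and let $Y$ be an object of $\mathcal C$. Identify $\operatorname{Hom}_{\mathcal C}(IJ,Y)$ with the dual space $F_{IJ}(Y)^*$ of $F_{IJ}(Y)=\operatorname{Hom}_{\mathcal C}(Y,IJ)$ by the (perfect) trace pairing $\langle j,k\rangle=\operatorname{tr}(k\circ j)$ for $j\in \operatorname{Hom}_{\mathcal C}(IJ,Y)$, $k\in\operatorname{Hom}_{\mathcal C}(Y,IJ)$. Then $\lambda_Y^{IJ}$ is an opposite of $\mu_Y^{IJ}$; that is, for all $j\in\operatorname{Hom}_{\mathcal C}(IJ,Y)$ and $k\in\operatorname{Hom}_{\mathcal C}(Y,IJ)$, $$\mu_Y^{IJ}(k)\circ\lambda_Y^{IJ}(j)=\operatorname{tr}(k\circ j)\,\operatorname{id}_{F_{IJ}}$$ as natural transformations $F_{IJ}\to F_{IJ}$.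
   Context: $\mathbb K$ is an algebraically closed field and $\mathcal C$ is a modular tensor category over $\mathbb K$ (semisimple $\mathbb K$-linear ribbon category with finite-dimensional Hom spaces, finitely many isomorphism classes of simple objects, simple tensor unit $\mathbf 1$, and invertible $S$-matrix). Tensor product is written by juxtaposition or $\otimes$; associativity and unit isomorphisms are suppressed. $\operatorname{Irr}(\mathcal C)$ is a complete set of representatives of simple objects; sums over an unspecified object range over $\operatorname{Irr}(\mathcal C)$. $c_{X,Y}:X\otimes Y\to Y\otimes X$ is the braiding. Left and right duals are identified by the pivotal structure and written $X^\vee$, with maps $\mathrm{ev}_X:X^\vee X\to\mathbf 1$, $\mathrm{coev}_X:\mathbf 1\to XX^\vee$, $\widetilde{\mathrm{ev}}_X:XX^\vee\to\mathbf 1$, $\widetilde{\mathrm{coev}}_X:\mathbf 1\to X^\vee X$. For $f\in\operatorname{End}_{\mathcal C}(X)$, $\operatorname{tr}(f)=\widetilde{\mathrm{ev}}_X\circ(f\otimes\operatorname{id}_{X^\vee})\circ\mathrm{coev}_X\in\operatorname{End}_{\mathcal C}(\mathbf 1)=\mathbb K$; $d(X)=\operatorname{tr}(\operatorname{id}_X)$; $d(\mathcal C)=\sum_S d(S)^2\neq 0$. Tube category $\mathcal{TC}$: same objects as $\mathcal C$; $\operatorname{Hom}_{\mathcal{TC}}(X,Y)=\bigoplus_{R}\operatorname{Hom}_{\mathcal C}(RX,YR)$; for $f=(f_R)\in\operatorname{Hom}_{\mathcal{TC}}(X,Y)$ and $g=(g_S)\in\operatorname{Hom}_{\mathcal{TC}}(Y,Z)$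 the $T$-component of $g\circ f$ is $\sum_{S,R,b}(\operatorname{id}_Z\otimes b^* )\circ(g_S\otimes\operatorname{id}_R)\circ(\operatorname{id}_S\otimes f_R)\circ(b\otimes\operatorname{id}_X)$, where $b$ ranges over a basis of $\operatorname{Hom}_{\mathcal C}(T,SR)$ and $\{b^*\}$ is the dual basis of $\operatorname{Hom}_{\mathcal C}(SR,T)$ with respect to the perfect pairing $f\otimes g\mapsto g\circ f\in\operatorname{End}_{\mathcal C}(T)=\mathbb K$. The identity of $X$ has $\mathbf 1$-component $\operatorname{id}_X$ and all other components $0$. $\mathcal{RTC}$ is the category of $\mathbb K$-linear functors $\mathcal{TC}^{\mathrm{op}}\to\underline{\mathrm{Vect}}$ (finite-dimensional vector spaces), and $X^\sharp=\operatorname{Hom}_{\mathcal{TC}}(-,X)$. For $I,J\in\operatorname{Irr}(\mathcal C)$, $F_{IJ}\in\mathcal{RTC}$ is given by $F_{IJ}(X)=\operatorname{Hom}_{\mathcal C}(X,IJ)$ and, for $f=(f_S)\in\operatorname{Hom}_{\mathcal{TC}}(Z,Y)$ and $g\in\operatorname{Hom}_{\mathcal C}(Y,IJ)$, $F_{IJ}(f)(g)\in\operatorname{Hom}_{\mathcal C}(Z,IJ)$ is $$\sum_S(\operatorname{id}_{IJ}\otimes\mathrm{ev}_S)\circ(\operatorname{id}_I\otimes c_{J,S^\vee}^{-1}\otimes\operatorname{id}_S)\circ(c_{S^\vee,I}\otimes\operatorname{id}_{JS})\circ(\operatorname{id}_{S^\vee}\otimes g\otimes\operatorname{id}_S)\circ(\operatorname{id}_{S^\vee}\otimes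 f_S)\circ(\widetilde{\mathrm{coev}}_S\otimes\operatorname{id}_Z).$$ For $i\in\operatorname{Hom}_{\mathcal C}(X,IJ)$ and $j\in\operatorname{Hom}_{\mathcal C}(IJ,Y)$, $\lambda_{YX}^{IJ}(j\otimes i)\in\operatorname{Hom}_{\mathcal{TC}}(X,Y)$ is the morphism with $S$-component $$\frac{d(I)d(J)}{d(\mathcal C)}\,d(S)\,(j\otimes\operatorname{id}_S)\circ(\operatorname{id}_I\otimes c_{J,S}^{-1})\circ(c_{S,I}\otimes\operatorname{id}_J)\circ(\operatorname{id}_S\otimes i)\in\operatorname{Hom}_{\mathcal C}(SX,YS).$$ $\lambda_Y^{IJ}:\operatorname{Hom}_{\mathcal C}(IJ,Y)\to\operatorname{Hom}_{\mathcal{RTC}}(F_{IJ},Y^\sharp)$ sends $j$ to the natural transformation with components $\lambda_Y^{IJ}(j)_X(i)=\lambda_{YX}^{IJ}(j\otimes i)$. $\mu_Y^{IJ}:F_{IJ}(Y)\to\operatorname{Hom}_{\mathcal{RTC}}(Y^\sharp,F_{IJ})$ is the Yoneda isomorphism, $\mu_Y^{IJ}(k)_Z(\eta)=F_{IJ}(\eta)(k)$ for $\eta\in\operatorname{Hom}_{\mathcal{TC}}(Z,Y)$. In general, for a functor $F$ and the Yoneda map $\mu_Y:F(Y)\to\operatorname{Hom}(Y^\sharp,F)$, a linear map $\lambda_Y:F(Y)^*\to\operatorname{Hom}(F,Y^\sharp)$ is called an opposite of $\mu_Y$ if $\mu_Y(\alpha)\circ\lambda_Y(\beta)=\beta(\alpha)\operatorname{id}_F$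 for all $\alpha\in F(Y)$, $\beta\in F(Y)^*$. *)

theory Defs
  imports
    "HOL-Computational_Algebra.Polynomial"
    "HOL-Library.Function_Algebras"
begin

section \<open>Linear categories\<close>

text \<open>
  The objects of a category form the type \<open>'o\<close>.  The Hom spaces are subspaces of one ambient
  \<open>'k\<close>-vector space \<open>'m\<close>; for any small linear category one can take the direct sum of all its Hom
  spaces.  Hom spaces may overlap (they all contain the zero vector), so source and target are not
  functions of a morphism, and the composition and the tensor product are only constrained on
  elements of the appropriate Hom spaces.

  The record has the data of a category with a strict tensor product, a braiding and two-sided
  duals.  Objects are multiplied with \<open>\<bullet>\<close>, morphisms with \<open>\<otimes>\<close>; \<open>g \<cdot> f\<close> is ``first \<open>f\<close>, then \<open>g\<close>''.
\<close>

record ('o, 'm, 'k) tensor_data =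
  Hom :: "'o \<Rightarrow> 'o \<Rightarrow> 'm set" ("Hom\<index>")
  smul :: "'k \<Rightarrow> 'm \<Rightarrow> 'm" (infixr "\<star>\<index>" 75)
  cmp :: "'m \<Rightarrow> 'm \<Rightarrow> 'm" (infixl "\<cdot>\<index>" 60)
  Ident :: "'o \<Rightarrow> 'm" ("Ident\<index>")
  tens_ob :: "'o \<Rightarrow> 'o \<Rightarrow> 'o" (infixl "\<bullet>\<index>" 80)
  unit_ob :: "'o" ("\<one>\<index>")
  tens :: "'m \<Rightarrow> 'm \<Rightarrow> 'm" (infixl "\<otimes>\<index>" 70)
  braid :: "'o \<Rightarrow> 'o \<Rightarrow> 'm" ("braid\<index>")
  dual :: "'o \<Rightarrow> 'o" ("dual\<index>")
  ev :: "'o \<Rightarrow> 'm" ("ev\<index>")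
  coev :: "'o \<Rightarrow> 'm" ("coev\<index>")
  evt :: "'o \<Rightarrow> 'm" ("evt\<index>")
  coevt :: "'o \<Rightarrow> 'm" ("coevt\<index>")

definition finite_dim_subspace :: "('k::field \<Rightarrow> 'v::ab_group_add \<Rightarrow> 'v) \<Rightarrow> 'v set \<Rightarrow> bool" where
  "finite_dim_subspace s V \<longleftrightarrow> (\<exists>B. finite B \<and> V = module.span s B)"

definition linear_map_on ::
    "('k \<Rightarrow> 'v::ab_group_add \<Rightarrow> 'v) \<Rightarrow> ('k \<Rightarrow> 'w::ab_group_add \<Rightarrow> 'w) \<Rightarrow> 'v set \<Rightarrow> 'w set \<Rightarrow> ('v \<Rightarrow> 'w) \<Rightarrow> bool" where
  "linear_map_on s t V W f \<longleftrightarrow>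
     (\<forall>x\<in>V. f x \<in> W) \<and> (\<forall>x\<in>V. \<forall>y\<in>V. f (x + y) = f x + f y) \<and> (\<forall>a. \<forall>x\<in>V. f (s a x) = t a (f x))"

locale linear_category =
  fixes C :: "('o, 'm::ab_group_add, 'k::field, 'z) tensor_data_scheme" (structure)
  assumes vector_space: "vector_space (smul C)"
    and Hom_finite_dim: "finite_dim_subspace (smul C) (Hom X Y)"
    and Ident_in: "Ident X \<in> Hom X X"
    and cmp_in: "\<lbrakk>f \<in> Hom X Y; g \<in> Hom Y Z\<rbrakk> \<Longrightarrow> g \<cdot> f \<in> Hom X Z"
    and cmp_Ident: "f \<in> Hom X Y \<Longrightarrow> f \<cdot> Ident X = f"
    and Ident_cmp: "f \<in> Hom X Y \<Longrightarrow> Ident Y \<cdot> f = f"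
    and cmp_assoc: "\<lbrakk>f \<in> Hom W X; g \<in> Hom X Y; h \<in> Hom Y Z\<rbrakk> \<Longrightarrow> h \<cdot> (g \<cdot> f) = (h \<cdot> g) \<cdot> f"
    and cmp_linear_right: "g \<in> Hom Y Z \<Longrightarrow>
          linear_map_on (smul C) (smul C) (Hom X Y) (Hom X Z) (\<lambda>f. g \<cdot> f)"
    and cmp_linear_left: "f \<in> Hom X Y \<Longrightarrow>
          linear_map_on (smul C) (smul C) (Hom Y Z) (Hom X Z) (\<lambda>g. g \<cdot> f)"

definition is_iso :: "('o, 'm, 'k, 'z) tensor_data_scheme \<Rightarrow> 'o \<Rightarrow> 'o \<Rightarrow> 'm \<Rightarrow> bool" where
  "is_iso C X Y f \<longleftrightarrow> f \<in> Hom X Y \<and> (\<exists>g\<in>Hom Y X. g \<cdot> f = Ident X \<and> f \<cdot> g = Ident Y)" for C (structure)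

definition iso_inv :: "('o, 'm, 'k, 'z) tensor_data_scheme \<Rightarrow> 'o \<Rightarrow> 'o \<Rightarrow> 'm \<Rightarrow> 'm" where
  "iso_inv C X Y f = (THE g. g \<in> Hom Y X \<and> g \<cdot> f = Ident X \<and> f \<cdot> g = Ident Y)" for C (structure)

definition isomorphic :: "('o, 'm, 'k, 'z) tensor_data_scheme \<Rightarrow> 'o \<Rightarrow> 'o \<Rightarrow> bool" where
  "isomorphic C X Y \<longleftrightarrow> (\<exists>f. is_iso C X Y f)"

definition is_mono :: "('o, 'm, 'k, 'z) tensor_data_scheme \<Rightarrow> 'o \<Rightarrow> 'o \<Rightarrow> 'm \<Rightarrow> bool" where
  "is_mono C X Y f \<longleftrightarrow> f \<in> Hom X Y \<and>
     (\<forall>W. \<forall>g\<in>Hom W X. \<forall>h\<in>Hom W X. f \<cdot> g = f \<cdot> h \<longrightarrow> g = h)" for C (structure)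

definition is_epi :: "('o, 'm, 'k, 'z) tensor_data_scheme \<Rightarrow> 'o \<Rightarrow> 'o \<Rightarrow> 'm \<Rightarrow> bool" where
  "is_epi C X Y f \<longleftrightarrow> f \<in> Hom X Y \<and>
     (\<forall>Z. \<forall>g\<in>Hom Y Z. \<forall>h\<in>Hom Y Z. g \<cdot> f = h \<cdot> f \<longrightarrow> g = h)" for C (structure)

definition is_zero_ob :: "('o, 'm::zero, 'k, 'z) tensor_data_scheme \<Rightarrow> 'o \<Rightarrow> bool" where
  "is_zero_ob C Z \<longleftrightarrow> (\<forall>X. Hom X Z = {0} \<and> Hom Z X = {0})" for C (structure)

text \<open>\<open>k : K \<rightarrow> X\<close> is a kernel of \<open>f : X \<rightarrow> Y\<close>, and \<open>q : Y \<rightarrow> Q\<close> is a cokernel of \<open>f : X \<rightarrow> Y\<close>.\<close>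

definition is_kernel ::
    "('o, 'm::zero, 'k, 'z) tensor_data_scheme \<Rightarrow> 'o \<Rightarrow> 'o \<Rightarrow> 'm \<Rightarrow> 'o \<Rightarrow> 'm \<Rightarrow> bool" where
  "is_kernel C X Y f K k \<longleftrightarrow> k \<in> Hom K X \<and> f \<cdot> k = 0 \<and>
     (\<forall>W. \<forall>g\<in>Hom W X. f \<cdot> g = 0 \<longrightarrow> (\<exists>!h. h \<in> Hom W K \<and> k \<cdot> h = g))" for C (structure)

definition is_cokernel ::
    "('o, 'm::zero, 'k, 'z) tensor_data_scheme \<Rightarrow> 'o \<Rightarrow> 'o \<Rightarrow> 'm \<Rightarrow> 'o \<Rightarrow> 'm \<Rightarrow> bool" where
  "is_cokernel C X Y f Q q \<longleftrightarrow> q \<in> Hom Y Q \<and> q \<cdot> f = 0 \<and>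
     (\<forall>Z. \<forall>g\<in>Hom Y Z. g \<cdot> f = 0 \<longrightarrow> (\<exists>!h. h \<in> Hom Q Z \<and> h \<cdot> q = g))" for C (structure)

text \<open>\<open>X\<close> is the direct sum of \<open>S 0, \<dots>, S (n - 1)\<close>, with inclusions \<open>i\<close> and projections \<open>p\<close>.\<close>

definition is_direct_sum ::
    "('o, 'm::ab_group_add, 'k, 'z) tensor_data_scheme \<Rightarrow> 'o \<Rightarrow> nat \<Rightarrow> (nat \<Rightarrow> 'o) \<Rightarrow> (nat \<Rightarrow> 'm) \<Rightarrow> (nat \<Rightarrow> 'm) \<Rightarrow> bool" where
  "is_direct_sum C X n S i p \<longleftrightarrow>
     (\<forall>a<n. i a \<in> Hom (S a) X \<and> p a \<in> Hom X (S a)) \<and>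
     (\<forall>a<n. \<forall>b<n. p a \<cdot> i b = (if a = b then Ident (S a) else 0)) \<and>
     (\<Sum>a<n. i a \<cdot> p a) = Ident X" for C (structure)

definition is_simple :: "('o, 'm::zero, 'k, 'z) tensor_data_scheme \<Rightarrow> 'o \<Rightarrow> bool" where
  "is_simple C X \<longleftrightarrow> \<not> is_zero_ob C X \<and>
     (\<forall>Y m. is_mono C Y X m \<longrightarrow> is_zero_ob C Y \<or> is_iso C Y X m)"

locale abelian_linear_category = linear_category +
  assumes direct_sums: "\<exists>X i p. is_direct_sum C X n S i p"
    and kernels: "f \<in> Hom X Y \<Longrightarrow> \<exists>K k. is_kernel C X Y f K k"
    and cokernels: "f \<in> Hom X Y \<Longrightarrow> \<exists>Q q. is_cokernel C X Y f Q q"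
    and mono_is_kernel: "is_mono C K X k \<Longrightarrow> \<exists>Y f. f \<in> Hom X Y \<and> is_kernel C X Y f K k"
    and epi_is_cokernel: "is_epi C Y Q q \<Longrightarrow> \<exists>X f. f \<in> Hom X Y \<and> is_cokernel C X Y f Q q"

locale semisimple_linear_category = abelian_linear_category +
  assumes semisimple: "\<exists>n S i p. is_direct_sum C X n S i p \<and> (\<forall>a<n. is_simple C (S a))"


section \<open>Ribbon categories\<close>

text \<open>
  The tensor product is strict, and is bilinear on morphisms.
\<close>

locale monoidal_linear_category = linear_category +
  assumes tens_ob_assoc: "(X \<bullet> Y) \<bullet> Z = X \<bullet> (Y \<bullet> Z)"
    and unit_tens_ob: "\<one> \<bullet> X = X"
    and tens_ob_unit: "X \<bullet> \<one> = X"
    and tens_in: "\<lbrakk>f \<in> Hom X X'; g \<in> Hom Y Y'\<rbrakk> \<Longrightarrow> f \<otimes> g \<in> Hom (X \<bullet> Y) (X' \<bullet> Y')"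
    and tens_assoc: "\<lbrakk>f \<in> Hom X X'; g \<in> Hom Y Y'; h \<in> Hom Z Z'\<rbrakk> \<Longrightarrow> (f \<otimes> g) \<otimes> h = f \<otimes> (g \<otimes> h)"
    and unit_tens: "f \<in> Hom X X' \<Longrightarrow> Ident \<one> \<otimes> f = f"
    and tens_unit: "f \<in> Hom X X' \<Longrightarrow> f \<otimes> Ident \<one> = f"
    and tens_Ident: "Ident X \<otimes> Ident Y = Ident (X \<bullet> Y)"
    and tens_cmp: "\<lbrakk>f \<in> Hom X X'; f' \<in> Hom X' X''; g \<in> Hom Y Y'; g' \<in> Hom Y' Y''\<rbrakk> \<Longrightarrow>
          (f' \<cdot> f) \<otimes> (g' \<cdot> g) = (f' \<otimes> g') \<cdot> (f \<otimes> g)"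
    and tens_linear_right: "f \<in> Hom X X' \<Longrightarrow>
          linear_map_on (smul C) (smul C) (Hom Y Y') (Hom (X \<bullet> Y) (X' \<bullet> Y')) (\<lambda>g. f \<otimes> g)"
    and tens_linear_left: "g \<in> Hom Y Y' \<Longrightarrow>
          linear_map_on (smul C) (smul C) (Hom X X') (Hom (X \<bullet> Y) (X' \<bullet> Y')) (\<lambda>f. f \<otimes> g)"

locale braided_linear_category = monoidal_linear_category +
  assumes braid_iso: "is_iso C (X \<bullet> Y) (Y \<bullet> X) (braid X Y)"
    and braid_natural: "\<lbrakk>f \<in> Hom X X'; g \<in> Hom Y Y'\<rbrakk> \<Longrightarrow>
          braid X' Y' \<cdot> (f \<otimes> g) = (g \<otimes> f) \<cdot> braid X Y"
    and braid_tens_right: "braid X (Y \<bullet> Z) = (Ident Y \<otimes> braid X Z) \<cdot> (braid X Y \<otimes> Ident Z)"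
    and braid_tens_left: "braid (X \<bullet> Y) Z = (braid X Z \<otimes> Ident Y) \<cdot> (Ident X \<otimes> braid Y Z)"

definition left_dual_mor :: "('o, 'm, 'k, 'z) tensor_data_scheme \<Rightarrow> 'o \<Rightarrow> 'o \<Rightarrow> 'm \<Rightarrow> 'm" where
  "left_dual_mor C X Y f =
     (ev Y \<otimes> Ident (dual X)) \<cdot> (Ident (dual Y) \<otimes> f \<otimes> Ident (dual X)) \<cdot> (Ident (dual Y) \<otimes> coev X)" for C (structure)

definition right_dual_mor :: "('o, 'm, 'k, 'z) tensor_data_scheme \<Rightarrow> 'o \<Rightarrow> 'o \<Rightarrow> 'm \<Rightarrow> 'm" where
  "right_dual_mor C X Y f =
     (Ident (dual X) \<otimes> evt Y) \<cdot> (Ident (dual X) \<otimes> f \<otimes> Ident (dual Y)) \<cdot> (coevt X \<otimes> Ident (dual Y))" for C (structure)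

text \<open>The comparison maps \<open>dual Y \<bullet> dual X \<rightarrow> dual (X \<bullet> Y)\<close> of the left and right dual functors.\<close>

definition left_dual_tens :: "('o, 'm, 'k, 'z) tensor_data_scheme \<Rightarrow> 'o \<Rightarrow> 'o \<Rightarrow> 'm" where
  "left_dual_tens C X Y =
     (ev Y \<otimes> Ident (dual (X \<bullet> Y))) \<cdot>
     (Ident (dual Y) \<otimes> ev X \<otimes> Ident (Y \<bullet> dual (X \<bullet> Y))) \<cdot>
     (Ident (dual Y \<bullet> dual X) \<otimes> coev (X \<bullet> Y))" for C (structure)

definition right_dual_tens :: "('o, 'm, 'k, 'z) tensor_data_scheme \<Rightarrow> 'o \<Rightarrow> 'o \<Rightarrow> 'm" where
  "right_dual_tens C X Y =
     (Ident (dual (X \<bullet> Y)) \<otimes> evt X) \<cdot>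
     (Ident (dual (X \<bullet> Y) \<bullet> X) \<otimes> evt Y \<otimes> Ident (dual X)) \<cdot>
     (coevt (X \<bullet> Y) \<otimes> Ident (dual Y \<bullet> dual X))" for C (structure)

text \<open>
  A pivotal structure is given as a choice, for each object, of one object that is both its left
  and its right dual, in such a way that the left and right dual functors agree as monoidal
  functors.
\<close>

locale pivotal_linear_category = monoidal_linear_category +
  assumes ev_in: "ev X \<in> Hom (dual X \<bullet> X) \<one>"
    and coev_in: "coev X \<in> Hom \<one> (X \<bullet> dual X)"
    and evt_in: "evt X \<in> Hom (X \<bullet> dual X) \<one>"
    and coevt_in: "coevt X \<in> Hom \<one> (dual X \<bullet> X)"
    and zigzag: "(Ident X \<otimes> ev X) \<cdot> (coev X \<otimes> Ident X) = Ident X"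
    and zigzag_dual: "(ev X \<otimes> Ident (dual X)) \<cdot> (Ident (dual X) \<otimes> coev X) = Ident (dual X)"
    and zigzag_t: "(evt X \<otimes> Ident X) \<cdot> (Ident X \<otimes> coevt X) = Ident X"
    and zigzag_t_dual: "(Ident (dual X) \<otimes> evt X) \<cdot> (coevt X \<otimes> Ident (dual X)) = Ident (dual X)"
    and dual_mor_eq: "f \<in> Hom X Y \<Longrightarrow> left_dual_mor C X Y f = right_dual_mor C X Y f"
    and dual_tens_eq: "left_dual_tens C X Y = right_dual_tens C X Y"
    and dual_unit_eq: "coev \<one> = coevt \<one>"

definition left_twist :: "('o, 'm, 'k, 'z) tensor_data_scheme \<Rightarrow> 'o \<Rightarrow> 'm" where
  "left_twist C X = (Ident X \<otimes> evt X) \<cdot> (braid X X \<otimes> Ident (dual X)) \<cdot> (Ident X \<otimes> coev X)" for C (structure)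

definition right_twist :: "('o, 'm, 'k, 'z) tensor_data_scheme \<Rightarrow> 'o \<Rightarrow> 'm" where
  "right_twist C X = (ev X \<otimes> Ident X) \<cdot> (Ident (dual X) \<otimes> braid X X) \<cdot> (coevt X \<otimes> Ident X)" for C (structure)

locale ribbon_linear_category = braided_linear_category + pivotal_linear_category +
  assumes twist_eq: "left_twist C X = right_twist C X"


section \<open>Modular tensor categories\<close>

text \<open>\<open>End(\<one>)\<close> is identified with the field by \<open>a \<mapsto> a \<star> Ident \<one>\<close>.\<close>

definition tr :: "('o, 'm, 'k, 'z) tensor_data_scheme \<Rightarrow> 'o \<Rightarrow> 'm \<Rightarrow> 'k" where
  "tr C X f = (THE a. evt X \<cdot> (f \<otimes> Ident (dual X)) \<cdot> coev X = a \<star> Ident \<one>)" for C (structure)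

definition dm :: "('o, 'm, 'k, 'z) tensor_data_scheme \<Rightarrow> 'o \<Rightarrow> 'k" where
  "dm C X = tr C X (Ident X)" for C (structure)

definition global_dim :: "('o, 'm, 'k::field, 'z) tensor_data_scheme \<Rightarrow> 'o set \<Rightarrow> 'k" where
  "global_dim C Irr = (\<Sum>S\<in>Irr. (dm C S)\<^sup>2)"

definition S_matrix :: "('o, 'm, 'k, 'z) tensor_data_scheme \<Rightarrow> 'o \<Rightarrow> 'o \<Rightarrow> 'k" where
  "S_matrix C I J = tr C (I \<bullet> J) (braid J I \<cdot> braid I J)" for C (structure)

text \<open>
  \<open>Irr\<close> is the chosen complete set of representatives of the simple objects.  The simple object \<open>\<one>\<close>
  represents its own class, so that \<open>\<one>\<close>-components of tube morphisms make sense.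
\<close>

locale modular_tensor_category = semisimple_linear_category C + ribbon_linear_category C
  for C :: "('o, 'm::ab_group_add, 'k::alg_closed_field, 'z) tensor_data_scheme" (structure) +
  fixes Irr :: "'o set"
  assumes unit_simple: "is_simple C \<one>"
    and finite_Irr: "finite Irr"
    and Irr_simple: "S \<in> Irr \<Longrightarrow> is_simple C S"
    and Irr_complete: "is_simple C X \<Longrightarrow> \<exists>!S. S \<in> Irr \<and> isomorphic C X S"
    and unit_in_Irr: "\<one> \<in> Irr"
    and S_matrix_invertible:
      "\<exists>M :: 'o \<Rightarrow> 'o \<Rightarrow> 'k. \<forall>I\<in>Irr. \<forall>J\<in>Irr.
         (\<Sum>K\<in>Irr. S_matrix C I K * M K J) = (if I = J then 1 else 0) \<and>
         (\<Sum>K\<in>Irr. M I K * S_matrix C K J) = (if I = J then 1 else 0)"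


section \<open>The tube category and its representations\<close>

text \<open>
  A tube morphism is its family of components, extended by \<open>0\<close> outside \<open>Irr\<close>.  Since \<open>Irr\<close> is finite,
  all such families belong to the direct sum.
\<close>

definition tube_Hom :: "('o, 'm::zero, 'k, 'z) tensor_data_scheme \<Rightarrow> 'o set \<Rightarrow> 'o \<Rightarrow> 'o \<Rightarrow> ('o \<Rightarrow> 'm) set" where
  "tube_Hom C Irr X Y =
     {f. (\<forall>R\<in>Irr. f R \<in> Hom (R \<bullet> X) (Y \<bullet> R)) \<and> (\<forall>R. R \<notin> Irr \<longrightarrow> f R = 0)}" for C (structure)

definition tube_smul :: "('o, 'm, 'k, 'z) tensor_data_scheme \<Rightarrow> 'k \<Rightarrow> ('o \<Rightarrow> 'm) \<Rightarrow> 'o \<Rightarrow> 'm" where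
  "tube_smul C a f = (\<lambda>R. a \<star> f R)" for C (structure)

definition is_basis :: "('k::field \<Rightarrow> 'v::ab_group_add \<Rightarrow> 'v) \<Rightarrow> 'v set \<Rightarrow> 'v set \<Rightarrow> bool" where
  "is_basis s V B \<longleftrightarrow> finite B \<and> \<not> module.dependent s B \<and> module.span s B = V"

text \<open>
  \<open>B\<close> is a basis of \<open>Hom T X\<close> and \<open>st ` B\<close> is the dual basis of \<open>Hom X T\<close> for the pairing
  \<open>(b, b') \<mapsto> b' \<cdot> b \<in> End(T)\<close>, where \<open>End(T)\<close> is the field since \<open>T\<close> is simple.
\<close>

definition is_dual_bases ::
    "('o, 'm::ab_group_add, 'k::field, 'z) tensor_data_scheme \<Rightarrow> 'o \<Rightarrow> 'o \<Rightarrow> 'm set \<times> ('m \<Rightarrow> 'm) \<Rightarrow> bool" where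
  "is_dual_bases C T X = (\<lambda>(B, st).
     is_basis (smul C) (Hom T X) B \<and> is_basis (smul C) (Hom X T) (st ` B) \<and>
     (\<forall>b\<in>B. \<forall>b'\<in>B. st b' \<cdot> b = (if b = b' then Ident T else 0)))" for C (structure)

text \<open>The sum in the composition does not depend on the choice of the dual bases made here.\<close>

definition dual_bases ::
    "('o, 'm::ab_group_add, 'k::field, 'z) tensor_data_scheme \<Rightarrow> 'o \<Rightarrow> 'o \<Rightarrow> 'm set \<times> ('m \<Rightarrow> 'm)" where
  "dual_bases C T X = (SOME p. is_dual_bases C T X p)"

text \<open>\<open>tube_cmp C Irr X Z g f\<close> is the composite \<open>X \<rightarrow> Y \<rightarrow> Z\<close>, first \<open>f\<close>, then \<open>g\<close>.\<close>

definition tube_cmp ::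
    "('o, 'm::ab_group_add, 'k::field, 'z) tensor_data_scheme \<Rightarrow> 'o set \<Rightarrow> 'o \<Rightarrow> 'o \<Rightarrow> ('o \<Rightarrow> 'm) \<Rightarrow> ('o \<Rightarrow> 'm) \<Rightarrow> 'o \<Rightarrow> 'm" where
  "tube_cmp C Irr X Z g f = (\<lambda>T. if T \<in> Irr then
     (\<Sum>S\<in>Irr. \<Sum>R\<in>Irr. case dual_bases C T (S \<bullet> R) of (B, st) \<Rightarrow>
        (\<Sum>b\<in>B. (Ident Z \<otimes> st b) \<cdot> (g S \<otimes> Ident R) \<cdot> (Ident S \<otimes> f R) \<cdot> (b \<otimes> Ident X))) else 0)" for C (structure)

definition tube_Ident :: "('o, 'm::zero, 'k, 'z) tensor_data_scheme \<Rightarrow> 'o \<Rightarrow> 'o \<Rightarrow> 'm" where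
  "tube_Ident C X = (\<lambda>R. if R = \<one> then Ident X else 0)" for C (structure)

text \<open>
  A contravariant functor from the tube category to finite-dimensional vector spaces.  All values
  \<open>ob F X\<close> are subspaces of one ambient vector space \<open>'v\<close>, and \<open>ac F Z Y f : ob F Y \<rightarrow> ob F Z\<close> is the
  action of \<open>f : Z \<rightarrow> Y\<close>.
\<close>

record ('o, 'm, 'k, 'v) presheaf =
  ob :: "'o \<Rightarrow> 'v set"
  ac :: "'o \<Rightarrow> 'o \<Rightarrow> ('o \<Rightarrow> 'm) \<Rightarrow> 'v \<Rightarrow> 'v"
  sc :: "'k \<Rightarrow> 'v \<Rightarrow> 'v"

definition is_tube_rep ::
    "('o, 'm::ab_group_add, 'k::field, 'z) tensor_data_scheme \<Rightarrow> 'o set \<Rightarrow>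
     ('o, 'm, 'k, 'v::ab_group_add) presheaf \<Rightarrow> bool" where
  "is_tube_rep C Irr F \<longleftrightarrow>
     vector_space (sc F) \<and>
     (\<forall>X. finite_dim_subspace (sc F) (ob F X)) \<and>
     (\<forall>Z Y. \<forall>f\<in>tube_Hom C Irr Z Y. linear_map_on (sc F) (sc F) (ob F Y) (ob F Z) (ac F Z Y f)) \<and>
     (\<forall>Z Y. \<forall>v\<in>ob F Y. linear_map_on (tube_smul C) (sc F) (tube_Hom C Irr Z Y) (ob F Z) (\<lambda>f. ac F Z Y f v)) \<and>
     (\<forall>X. \<forall>v\<in>ob F X. ac F X X (tube_Ident C X) v = v) \<and>
     (\<forall>X Y Z. \<forall>f\<in>tube_Hom C Irr X Y. \<forall>g\<in>tube_Hom C Irr Y Z. \<forall>v\<in>ob F Z.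
        ac F X Z (tube_cmp C Irr X Z g f) v = ac F X Y f (ac F Y Z g v))"

text \<open>
  Natural transformations, as families of linear maps extended by \<open>0\<close> outside the values of the
  functor, so that equality of natural transformations is equality of functions.
\<close>

definition Nat_trans ::
    "('o, 'm::ab_group_add, 'k::field, 'z) tensor_data_scheme \<Rightarrow> 'o set \<Rightarrow>
     ('o, 'm, 'k, 'v::ab_group_add) presheaf \<Rightarrow> ('o, 'm, 'k, 'w::ab_group_add) presheaf \<Rightarrow> ('o \<Rightarrow> 'v \<Rightarrow> 'w) set" where
  "Nat_trans C Irr F G = {\<eta>.
     (\<forall>X. linear_map_on (sc F) (sc G) (ob F X) (ob G X) (\<eta> X)) \<and>
     (\<forall>X v. v \<notin> ob F X \<longrightarrow> \<eta> X v = 0) \<and>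
     (\<forall>Z Y. \<forall>f\<in>tube_Hom C Irr Z Y. \<forall>v\<in>ob F Y. \<eta> Z (ac F Z Y f v) = ac G Z Y f (\<eta> Y v))}"

definition nat_cmp :: "('o \<Rightarrow> 'v \<Rightarrow> 'w) \<Rightarrow> ('o \<Rightarrow> 'u \<Rightarrow> 'v) \<Rightarrow> 'o \<Rightarrow> 'u \<Rightarrow> 'w" where
  "nat_cmp \<theta> \<eta> = (\<lambda>X v. \<theta> X (\<eta> X v))"

definition nat_Ident :: "('o, 'm, 'k, 'v::zero) presheaf \<Rightarrow> 'o \<Rightarrow> 'v \<Rightarrow> 'v" where
  "nat_Ident F = (\<lambda>X v. if v \<in> ob F X then v else 0)"

definition nat_smul :: "('o, 'm, 'k, 'w) presheaf \<Rightarrow> 'k \<Rightarrow> ('o \<Rightarrow> 'v \<Rightarrow> 'w) \<Rightarrow> 'o \<Rightarrow> 'v \<Rightarrow> 'w" where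
  "nat_smul G a \<eta> = (\<lambda>X v. sc G a (\<eta> X v))"

definition sharp ::
    "('o, 'm::ab_group_add, 'k::field, 'z) tensor_data_scheme \<Rightarrow> 'o set \<Rightarrow> 'o \<Rightarrow> ('o, 'm, 'k, 'o \<Rightarrow> 'm) presheaf" where
  "sharp C Irr Y = \<lparr>
     ob = (\<lambda>X. tube_Hom C Irr X Y),
     ac = (\<lambda>Z X f h. tube_cmp C Irr Z Y h f),
     sc = tube_smul C\<rparr>"

definition yoneda ::
    "('o, 'm::ab_group_add, 'k::field, 'z) tensor_data_scheme \<Rightarrow> 'o set \<Rightarrow>
     ('o, 'm, 'k, 'v::ab_group_add) presheaf \<Rightarrow> 'o \<Rightarrow> 'v \<Rightarrow> 'o \<Rightarrow> ('o \<Rightarrow> 'm) \<Rightarrow> 'v" where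
  "yoneda C Irr F Y \<alpha> = (\<lambda>Z \<eta>. if \<eta> \<in> tube_Hom C Irr Z Y then ac F Z Y \<eta> \<alpha> else 0)"

text \<open>The dual of a subspace \<open>V\<close>: linear functionals on \<open>V\<close>, extended by \<open>0\<close> outside \<open>V\<close>.\<close>

definition dual_space :: "('k::field \<Rightarrow> 'v::ab_group_add \<Rightarrow> 'v) \<Rightarrow> 'v set \<Rightarrow> ('v \<Rightarrow> 'k) set" where
  "dual_space s V = {\<beta>. linear_map_on s (*) V UNIV \<beta> \<and> (\<forall>v. v \<notin> V \<longrightarrow> \<beta> v = 0)}"

definition functional_smul :: "'k::field \<Rightarrow> ('v \<Rightarrow> 'k) \<Rightarrow> 'v \<Rightarrow> 'k" where
  "functional_smul a \<beta> = (\<lambda>v. a * \<beta> v)"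

definition is_opposite ::
    "('o, 'm::ab_group_add, 'k::field, 'z) tensor_data_scheme \<Rightarrow> 'o set \<Rightarrow>
     ('o, 'm, 'k, 'v::ab_group_add) presheaf \<Rightarrow> 'o \<Rightarrow>
     ('v \<Rightarrow> 'o \<Rightarrow> ('o \<Rightarrow> 'm) \<Rightarrow> 'v) \<Rightarrow> (('v \<Rightarrow> 'k) \<Rightarrow> 'o \<Rightarrow> 'v \<Rightarrow> ('o \<Rightarrow> 'm)) \<Rightarrow> bool" where
  "is_opposite C Irr F Y M L \<longleftrightarrow>
     linear_map_on functional_smul (nat_smul (sharp C Irr Y))
       (dual_space (sc F) (ob F Y)) (Nat_trans C Irr F (sharp C Irr Y)) L \<and>
     (\<forall>\<alpha>\<in>ob F Y. \<forall>\<beta>\<in>dual_space (sc F) (ob F Y).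
        nat_cmp (M \<alpha>) (L \<beta>) = nat_smul F (\<beta> \<alpha>) (nat_Ident F))"


section \<open>The functors \<open>F_IJ\<close>\<close>

definition inv_braid :: "('o, 'm, 'k, 'z) tensor_data_scheme \<Rightarrow> 'o \<Rightarrow> 'o \<Rightarrow> 'm" where
  "inv_braid C X Y = iso_inv C (X \<bullet> Y) (Y \<bullet> X) (braid X Y)" for C (structure)

definition FIJ ::
    "('o, 'm::ab_group_add, 'k::field, 'z) tensor_data_scheme \<Rightarrow> 'o set \<Rightarrow> 'o \<Rightarrow> 'o \<Rightarrow> ('o, 'm, 'k, 'm) presheaf" where
  "FIJ C Irr I J = \<lparr>
     ob = (\<lambda>X. Hom X (I \<bullet> J)),
     ac = (\<lambda>Z Y f g. \<Sum>S\<in>Irr.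
       (Ident (I \<bullet> J) \<otimes> ev S) \<cdot>
       (Ident I \<otimes> inv_braid C J (dual S) \<otimes> Ident S) \<cdot>
       (braid (dual S) I \<otimes> Ident (J \<bullet> S)) \<cdot>
       (Ident (dual S) \<otimes> g \<otimes> Ident S) \<cdot>
       (Ident (dual S) \<otimes> f S) \<cdot>
       (coevt S \<otimes> Ident Z)),
     sc = smul C\<rparr>" for C (structure)

definition lambda_mor ::
    "('o, 'm::ab_group_add, 'k::field, 'z) tensor_data_scheme \<Rightarrow> 'o set \<Rightarrow> 'o \<Rightarrow> 'o \<Rightarrow> 'm \<Rightarrow> 'm \<Rightarrow> 'o \<Rightarrow> 'm" where
  "lambda_mor C Irr I J j i = (\<lambda>S. if S \<in> Irr then
     (dm C I * dm C J / global_dim C Irr * dm C S) \<star>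
       ((j \<otimes> Ident S) \<cdot> (Ident I \<otimes> inv_braid C J S) \<cdot> (braid S I \<otimes> Ident J) \<cdot> (Ident S \<otimes> i)) else 0)" for C (structure)

definition lambda_nat ::
    "('o, 'm::ab_group_add, 'k::field, 'z) tensor_data_scheme \<Rightarrow> 'o set \<Rightarrow> 'o \<Rightarrow> 'o \<Rightarrow> 'm \<Rightarrow> 'o \<Rightarrow> 'm \<Rightarrow> 'o \<Rightarrow> 'm" where
  "lambda_nat C Irr I J j = (\<lambda>X i. if i \<in> Hom X (I \<bullet> J) then lambda_mor C Irr I J j i else 0)" for C (structure)

text \<open>\<open>j \<in> Hom(IJ, Y)\<close> as a functional on \<open>F\<^sub>I\<^sub>J(Y) = Hom(Y, IJ)\<close>, by the trace pairing.\<close>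

definition trace_functional ::
    "('o, 'm, 'k::field, 'z) tensor_data_scheme \<Rightarrow> 'o \<Rightarrow> 'o \<Rightarrow> 'o \<Rightarrow> 'm \<Rightarrow> 'm \<Rightarrow> 'k" where
  "trace_functional C I J Y j = (\<lambda>k. if k \<in> Hom Y (I \<bullet> J) then tr C (I \<bullet> J) (k \<cdot> j) else 0)" for C (structure)

end

theory Submission
  imports Defs
begin

text \<open>The crossings of a strand \<open>S\<close> with \<open>I\<close> and \<open>J\<close> that occur in \<open>F\<^sub>I\<^sub>J\<close> and in \<open>\<lambda>\<close> form one half-braiding
\<open>e\<close> on \<open>Z = I \<bullet> J\<close>: the strand passes \<open>I\<close> by the braiding and \<open>J\<close> by the inverse braiding.  Moving the
crossing from one end of a cap to the other gives \<open>F\<^sub>I\<^sub>J(f)(g)\<close> the form of a sum over \<open>S\<close> of the left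
partial traces over \<open>S\<close> of \<open>e\<^sub>S\<inverse> \<cdot> (g \<otimes> S) \<cdot> f\<^sub>S\<close> (\<open>FIJ_ac\<close>).  In this form
functoriality and naturality hold for every half-braiding.

\<^item> The action is functorial (\<open>hb_act_cmp\<close>).  The sum over dual bases in the composition of the tube category
  resolves the identity of \<open>S \<bullet> R\<close>, so that a closed strand labelled by the composite becomes two parallel
  closed strands, one inside the other.

\<^item> \<open>\<lambda>\<close> is natural (\<open>hb_lift_natural\<close>), because the sum over all \<open>S\<close> with weights \<open>d(S)\<close> is invariant under
  sliding another strand over \<open>S\<close> (\<open>handle_slide\<close>).

\<^item> The composite of \<open>\<mu>(k)\<close> and \<open>\<lambda>(j)\<close> is composition with the average of \<open>k \<cdot> j\<close> over all closed strands \<open>S\<close>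
  with weights \<open>d(S)\<close> (\<open>hb_act_hb_lift\<close>).

It remains to see that the average of an endomorphism \<open>\<phi>\<close> of \<open>I \<bullet> J\<close> is a scalar (\<open>sum_ptr_hb_term_IJ\<close>), and
here modularity enters.  By naturality of the braiding the crossings of \<open>S\<close> with \<open>J\<close> can be pulled through \<open>\<phi>\<close>,
which leaves double braidings of \<open>S\<close> with the strand \<open>I\<close> below and above \<open>\<phi>\<close>.  They amount to a loop around
\<open>dual I \<bullet> I\<close>.  The weighted sum of all loops around a simple object \<open>T\<close> is \<open>d(\<C>)\<close> if \<open>T = \<one>\<close>, and it
vanishes otherwise (\<open>loop_sum_nonunit\<close>): it absorbs every further loop, so a nonzero value would make column \<open>T\<close>
of the \<open>S\<close>-matrix proportional to column \<open>\<one>\<close>.  Hence the weighted sum of loops projects \<open>dual I \<bullet> I\<close> to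
its unit summand.  This cuts the strand \<open>I\<close> and closes off the \<open>I\<close> strand of \<open>\<phi>\<close>, and what is left of \<open>\<phi>\<close> is
an endomorphism of the simple object \<open>J\<close>, a scalar that the trace of \<open>\<phi>\<close> determines.  The invertible
\<open>S\<close>-matrix also forces \<open>d(\<C>) \<noteq> 0\<close> (\<open>global_dim_nonzero\<close>).

The trace pairing is perfect because every morphism is a sum of morphisms through simple objects, whose
dimensions do not vanish (\<open>trace_expansion\<close>, \<open>dm_nonzero\<close>).\<close>

section \<open>Linear categories\<close>

sublocale linear_category \<subseteq> vs: vector_space "smul C"
  by (rule vector_space)

context linear_category
begin

lemma subspace_Hom: "vs.subspace (Hom X Y)"
  using Hom_finite_dim[of X Y] unfolding finite_dim_subspace_def by auto

lemma Hom_zero [simp]: "0 \<in> Hom X Y"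
  by (rule vs.subspace_0[OF subspace_Hom])

lemma Hom_add: "f \<in> Hom X Y \<Longrightarrow> g \<in> Hom X Y \<Longrightarrow> f + g \<in> Hom X Y"
  by (rule vs.subspace_add[OF subspace_Hom])

lemma Hom_diff: "f \<in> Hom X Y \<Longrightarrow> g \<in> Hom X Y \<Longrightarrow> f - g \<in> Hom X Y"
  by (rule vs.subspace_diff[OF subspace_Hom])

lemma Hom_smul: "f \<in> Hom X Y \<Longrightarrow> a \<star> f \<in> Hom X Y"
  by (rule vs.subspace_scale[OF subspace_Hom])

lemma Hom_sum: "(\<And>a. a \<in> A \<Longrightarrow> f a \<in> Hom X Y) \<Longrightarrow> sum f A \<in> Hom X Y"
  by (rule vs.subspace_sum[OF subspace_Hom])

lemma linear_map_on_sum: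
  assumes F: "linear_map_on (smul C) t (Hom X Y) W F"
    and f: "\<And>a. a \<in> A \<Longrightarrow> f a \<in> Hom X Y"
  shows "F (sum f A) = (\<Sum>a\<in>A. F (f a))"
proof -
  have add: "F (g + h) = F g + F h" if "g \<in> Hom X Y" "h \<in> Hom X Y" for g h
    using F that by (simp add: linear_map_on_def)
  have zero: "F 0 = 0"
    using add[of 0 0] by simp
  show ?thesis
  proof (cases "finite A")
    case True
    then show ?thesis
      using f by (induction A rule: finite_induct) (simp_all add: zero add Hom_sum)
  qed (simp add: zero)
qed

lemma cmp_add_right: "g \<in> Hom Y Z \<Longrightarrow> f \<in> Hom X Y \<Longrightarrow> f' \<in> Hom X Y \<Longrightarrow> g \<cdot> (f + f') = (g \<cdot> f) + (g \<cdot> f')"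
  using cmp_linear_right unfolding linear_map_on_def by blast

lemma cmp_add_left: "f \<in> Hom X Y \<Longrightarrow> g \<in> Hom Y Z \<Longrightarrow> g' \<in> Hom Y Z \<Longrightarrow> (g + g') \<cdot> f = (g \<cdot> f) + (g' \<cdot> f)"
  using cmp_linear_left unfolding linear_map_on_def by blast

lemma cmp_smul_right: "g \<in> Hom Y Z \<Longrightarrow> f \<in> Hom X Y \<Longrightarrow> g \<cdot> (a \<star> f) = a \<star> (g \<cdot> f)"
  using cmp_linear_right unfolding linear_map_on_def by blast

lemma cmp_smul_left: "f \<in> Hom X Y \<Longrightarrow> g \<in> Hom Y Z \<Longrightarrow> (a \<star> g) \<cdot> f = a \<star> (g \<cdot> f)"
  using cmp_linear_left unfolding linear_map_on_def by blast

lemma cmp_sum_right: "g \<in> Hom Y Z \<Longrightarrow> (\<And>a. a \<in> A \<Longrightarrow> f a \<in> Hom X Y) \<Longrightarrow> g \<cdot> sum f A = (\<Sum>a\<in>A. g \<cdot> f a)"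
  by (rule linear_map_on_sum[OF cmp_linear_right])

lemma cmp_sum_left: "f \<in> Hom X Y \<Longrightarrow> (\<And>a. a \<in> A \<Longrightarrow> g a \<in> Hom Y Z) \<Longrightarrow> sum g A \<cdot> f = (\<Sum>a\<in>A. g a \<cdot> f)"
  by (rule linear_map_on_sum[OF cmp_linear_left])

lemma cmp_zero_right: "g \<in> Hom Y Z \<Longrightarrow> g \<cdot> 0 = 0"
  using cmp_smul_right[of g Y Z 0 Y 0] by simp

lemma cmp_zero_left: "f \<in> Hom X Y \<Longrightarrow> 0 \<cdot> f = 0"
  using cmp_smul_left[of f X Y 0 Y 0] by simp

lemma cmp_diff_right:
  assumes "g \<in> Hom Y Z" "f \<in> Hom X Y" "f' \<in> Hom X Y"
  shows "g \<cdot> (f - f') = (g \<cdot> f) - (g \<cdot> f')"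
  using cmp_add_right[OF assms(1) Hom_diff[OF assms(2,3)] assms(3)] by simp

lemma smul_Ident_in: "a \<star> Ident X \<in> Hom X X"
  by (rule Hom_smul[OF Ident_in])

lemma smul_Ident_cmp: "f \<in> Hom X Y \<Longrightarrow> (a \<star> Ident Y) \<cdot> f = a \<star> f"
  by (simp add: cmp_smul_left[OF _ Ident_in] Ident_cmp)

lemma cmp_smul_Ident: "f \<in> Hom X Y \<Longrightarrow> f \<cdot> (a \<star> Ident X) = a \<star> f"
  by (simp add: cmp_smul_right[OF _ Ident_in] cmp_Ident)

lemma iso_inv_eq:
  assumes f: "f \<in> Hom X Y" and g: "g \<in> Hom Y X" "g \<cdot> f = Ident X" "f \<cdot> g = Ident Y"
  shows "iso_inv C X Y f = g"
  unfolding iso_inv_def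
proof (rule the_equality)
  fix g' assume g': "g' \<in> Hom Y X \<and> g' \<cdot> f = Ident X \<and> f \<cdot> g' = Ident Y"
  then have "g' = g' \<cdot> (f \<cdot> g)" using g(3) cmp_Ident[of g' Y X] by simp
  also have "\<dots> = g" using cmp_assoc[OF g(1) f, of g' X] g' Ident_cmp[OF g(1)] by simp
  finally show "g' = g" .
qed (use g in simp)

lemma iso_inv_props:
  assumes "is_iso C X Y f"
  shows "iso_inv C X Y f \<in> Hom Y X" "iso_inv C X Y f \<cdot> f = Ident X" "f \<cdot> iso_inv C X Y f = Ident Y"
proof -
  obtain g where "f \<in> Hom X Y" "g \<in> Hom Y X" "g \<cdot> f = Ident X" "f \<cdot> g = Ident Y"
    using assms unfolding is_iso_def by blast
  moreover from this have "iso_inv C X Y f = g" by (rule iso_inv_eq)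
  ultimately show "iso_inv C X Y f \<in> Hom Y X" "iso_inv C X Y f \<cdot> f = Ident X" "f \<cdot> iso_inv C X Y f = Ident Y"
    by simp_all
qed

lemma is_iso_inv: "is_iso C X Y f \<Longrightarrow> is_iso C Y X (iso_inv C X Y f)"
  using iso_inv_props[of X Y f] unfolding is_iso_def by blast

lemma iso_Ident: "is_iso C X X (Ident X)"
  unfolding is_iso_def using Ident_in cmp_Ident by blast

lemma iso_cmp:
  assumes f: "is_iso C X Y f" and g: "is_iso C Y Z g"
  shows "is_iso C X Z (g \<cdot> f)"
proof -
  obtain f' g' where f': "f \<in> Hom X Y" "f' \<in> Hom Y X" "f' \<cdot> f = Ident X" "f \<cdot> f' = Ident Y"
    and g': "g \<in> Hom Y Z" "g' \<in> Hom Z Y" "g' \<cdot> g = Ident Y" "g \<cdot> g' = Ident Z"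
    using f g unfolding is_iso_def by blast
  have gf: "g \<cdot> f \<in> Hom X Z" "f' \<cdot> g' \<in> Hom Z X" using f' g' cmp_in by blast+
  moreover have "(f' \<cdot> g') \<cdot> (g \<cdot> f) = f' \<cdot> (g' \<cdot> g \<cdot> f)"
    using cmp_assoc[OF gf(1) g'(2) f'(2)] cmp_assoc[OF f'(1) g'(1,2)] by simp
  moreover have "(g \<cdot> f) \<cdot> (f' \<cdot> g') = g \<cdot> (f \<cdot> f' \<cdot> g')"
    using cmp_assoc[OF gf(2) f'(1) g'(1)] cmp_assoc[OF g'(2) f'(2,1)] by simp
  ultimately show ?thesis using f' g' unfolding is_iso_def
    using Ident_cmp[OF f'(1)] Ident_cmp[OF g'(2)] by (intro conjI bexI[of _ "f' \<cdot> g'"]) simp_all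
qed

lemma zero_ob_right: "is_zero_ob C Z \<Longrightarrow> f \<in> Hom X Z \<Longrightarrow> f = 0"
  unfolding is_zero_ob_def by blast

lemma Ident_simple_nonzero:
  assumes "is_simple C S"
  shows "Ident S \<noteq> 0"
proof
  assume eq: "Ident S = 0"
  have "f = 0" if "f \<in> Hom X S" for f X
    using Ident_cmp[OF that] cmp_zero_left[OF that] eq by simp
  moreover have "f = 0" if "f \<in> Hom S X" for f X
    using cmp_Ident[OF that] cmp_zero_right[OF that] eq by simp
  ultimately have "is_zero_ob C S"
    unfolding is_zero_ob_def using Hom_zero by blast
  with assms show False by (simp add: is_simple_def)
qed

lemma smul_Ident_inject: "is_simple C S \<Longrightarrow> a \<star> Ident S = b \<star> Ident S \<longleftrightarrow> a = b"
  using Ident_simple_nonzero vs.scale_cancel_right by metis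

lemma kernel_is_mono:
  assumes f: "f \<in> Hom X Y" and k: "is_kernel C X Y f K k"
  shows "is_mono C K X k"
  unfolding is_mono_def
proof (intro conjI allI ballI impI)
  show kK: "k \<in> Hom K X" using k by (simp add: is_kernel_def)
  fix W g h assume gh: "g \<in> Hom W K" "h \<in> Hom W K" and eq: "k \<cdot> g = k \<cdot> h"
  have "f \<cdot> (k \<cdot> g) = 0"
    using cmp_assoc[OF gh(1) kK f] k cmp_zero_left[OF gh(1)] by (simp add: is_kernel_def)
  with k gh kK have "\<exists>!l. l \<in> Hom W K \<and> k \<cdot> l = k \<cdot> g"
    unfolding is_kernel_def using cmp_in by blast
  with gh eq show "g = h" by metis
qed

end

context abelian_linear_category
begin

lemma simple_source_mono:
  assumes S: "is_simple C S" and f: "f \<in> Hom S Y" "f \<noteq> 0"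
  shows "is_mono C S Y f"
proof -
  obtain K k where k: "is_kernel C S Y f K k" using kernels[OF f(1)] by blast
  have kK: "k \<in> Hom K S" and fk: "f \<cdot> k = 0" using k by (simp_all add: is_kernel_def)
  have "\<not> is_iso C K S k"
  proof
    assume "is_iso C K S k"
    then obtain l where l: "l \<in> Hom S K" "k \<cdot> l = Ident S" unfolding is_iso_def by blast
    have "f = f \<cdot> (k \<cdot> l)" using l f by (simp add: cmp_Ident)
    also have "\<dots> = 0" using cmp_assoc[OF l(1) kK f(1)] fk cmp_zero_left[OF l(1)] by simp
    finally show False using f by simp
  qed
  with S kernel_is_mono[OF f(1) k] have K: "is_zero_ob C K"
    unfolding is_simple_def by blast
  show ?thesis unfolding is_mono_def
  proof (intro conjI allI ballI impI)
    fix W g h assume gh: "g \<in> Hom W S" "h \<in> Hom W S" and eq: "f \<cdot> g = f \<cdot> h"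
    have "f \<cdot> (g - h) = 0" using cmp_diff_right[OF f(1) gh] eq by simp
    then obtain l where l: "l \<in> Hom W K" "k \<cdot> l = g - h"
      using k Hom_diff[OF gh] unfolding is_kernel_def by blast
    have "l = 0" using zero_ob_right[OF K l(1)] .
    with l cmp_zero_right[OF kK] show "g = h" by simp
  qed (rule f)
qed

text \<open>Schur's lemma: a nonzero morphism between simple objects has a zero kernel, hence is a
  monomorphism into a simple object.\<close>

lemma simple_nonzero_iso:
  assumes "is_simple C S" "is_simple C T" "f \<in> Hom S T" "f \<noteq> 0"
  shows "is_iso C S T f"
  using simple_source_mono[OF assms(1,3,4)] assms(1,2) unfolding is_simple_def by blast

end

definition poly_end :: "('o, 'm::ab_group_add, 'k::field, 'z) tensor_data_scheme \<Rightarrow> 'o \<Rightarrow> 'm \<Rightarrow> 'k poly \<Rightarrow> 'm" where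
  "poly_end C S f p = fold_coeffs (\<lambda>a x. a \<star> Ident S + (f \<cdot> x)) p 0" for C (structure)

context linear_category
begin

lemma poly_end_0 [simp]: "poly_end C S f 0 = 0"
  by (simp add: poly_end_def)

lemma poly_end_pCons:
  assumes "f \<in> Hom S S"
  shows "poly_end C S f (pCons a p) = a \<star> Ident S + (f \<cdot> poly_end C S f p)"
  using cmp_zero_right[OF assms]
  by (cases "p = 0"; cases "a = 0") (simp_all add: poly_end_def)

lemma poly_end_in:
  assumes "f \<in> Hom S S"
  shows "poly_end C S f p \<in> Hom S S"
  by (induction p) (simp_all add: poly_end_pCons assms Hom_add smul_Ident_in cmp_in[OF _ assms])

lemma poly_end_add:
  assumes f: "f \<in> Hom S S"
  shows "poly_end C S f (p + q) = poly_end C S f p + poly_end C S f q"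
proof (induction p arbitrary: q)
  case (pCons a p)
  show ?case
    using pCons by (cases q)
      (simp add: poly_end_pCons[OF f] vs.scale_left_distrib cmp_add_right[OF f poly_end_in[OF f] poly_end_in[OF f]] algebra_simps)
qed simp

lemma poly_end_smult:
  assumes f: "f \<in> Hom S S"
  shows "poly_end C S f (smult c p) = c \<star> poly_end C S f p"
  by (induction p)
    (simp_all add: poly_end_pCons[OF f] vs.scale_right_distrib cmp_smul_right[OF f poly_end_in[OF f]])

lemma poly_end_sum:
  assumes f: "f \<in> Hom S S"
  shows "poly_end C S f (sum p A) = (\<Sum>a\<in>A. poly_end C S f (p a))"
  by (induction A rule: infinite_finite_induct) (simp_all add: poly_end_add[OF f])

text \<open>If no polynomial vanished at \<open>f\<close>, the powers of \<open>f\<close> would be infinitely many independent vectors of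
the finite-dimensional space \<open>End(S)\<close>.\<close>

lemma endomorphism_algebraic:
  assumes f: "f \<in> Hom S S"
  shows "\<exists>p. p \<noteq> 0 \<and> poly_end C S f p = 0"
proof (rule ccontr)
  assume "\<not> ?thesis"
  then have inj: "p = 0" if "poly_end C S f p = 0" for p using that by blast
  define w where "w i = poly_end C S f (monom 1 i)" for i
  have comb: "(\<Sum>i\<in>A. c i \<star> w i) = poly_end C S f (\<Sum>i\<in>A. monom (c i) i)" for c A
    by (simp add: w_def poly_end_sum[OF f] poly_end_smult[OF f, symmetric] smult_monom)
  have w_inj: "inj w"
  proof (rule injI)
    fix i j assume "w i = w j"
    then have "poly_end C S f (monom 1 i + smult (-1) (monom 1 j)) = 0"
      by (simp only: poly_end_add[OF f] poly_end_smult[OF f]) (simp add: w_def)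
    then have "monom (1::'k) i = monom 1 j" using inj by fastforce
    then have "degree (monom (1::'k) i) = degree (monom (1::'k) j)" by simp
    then show "i = j" by (simp add: degree_monom_eq)
  qed
  have indep: "\<not> vs.dependent (range w)"
    unfolding vs.independent_explicit_finite_subsets
  proof (intro allI impI ballI)
    fix A u v assume A: "A \<subseteq> range w" "finite A" and u: "(\<Sum>v\<in>A. u v \<star> v) = 0" and v: "v \<in> A"
    define N where "N = w -` A"
    have N: "finite N" unfolding N_def using A w_inj by (simp add: finite_vimageI)
    have AN: "A = w ` N" using A by (auto simp: N_def)
    have "(\<Sum>i\<in>N. u (w i) \<star> w i) = 0"
      using u unfolding AN by (subst (asm) sum.reindex) (use w_inj in \<open>auto simp: inj_on_def\<close>)
    then have "(\<Sum>i\<in>N. monom (u (w i)) i) = 0" using inj comb by metis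
    moreover obtain k where k: "k \<in> N" "v = w k" using v AN by blast
    moreover have "coeff (\<Sum>i\<in>N. monom (u (w i)) i) k = u (w k)"
      using N k by (simp add: coeff_sum if_distrib sum.delta cong: if_cong)
    ultimately show "u v = 0" by simp
  qed
  obtain B where B: "finite B" "Hom S S = vs.span B"
    using Hom_finite_dim[of S S] unfolding finite_dim_subspace_def by blast
  have "range w \<subseteq> vs.span B" using poly_end_in[OF f] B by (auto simp: w_def)
  then have "finite (range w)" using vs.independent_span_bound[OF B(1) indep] by blast
  then show False using finite_imageD[OF _ w_inj] infinite_UNIV_nat by blast
qed

end

text \<open>The endomorphism algebra of a simple object is a finite-dimensional division algebra over an
  algebraically closed field.  If \<open>f\<close> is not a scalar then every \<open>f - a\<close> is invertible, and dividing a
  polynomial relation of \<open>f\<close> by the factors \<open>f - a\<close> of its roots lowers the degree to \<open>0\<close>.\<close>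

lemma schur_scalar:
  fixes C :: "('o, 'm::ab_group_add, 'k::alg_closed_field, 'z) tensor_data_scheme" (structure)
  assumes C: "abelian_linear_category C" and S: "is_simple C S" and f: "f \<in> Hom S S"
  shows "\<exists>a. f = a \<star> Ident S"
proof (rule ccontr)
  interpret abelian_linear_category C by (rule C)
  assume nonscalar: "\<not> ?thesis"
  have "p = 0" if "poly_end C S f p = 0" for p
    using that
  proof (induction "degree p" arbitrary: p rule: less_induct)
    case less
    show ?case
    proof (cases "degree p = 0")
      case True
      then obtain a where "p = [:a:]" by (metis degree_eq_zeroE)
      then show ?thesis
        using less.prems Ident_simple_nonzero[OF S] cmp_zero_right[OF f] by (simp add: poly_end_pCons[OF f])
    next
      case False
      then obtain a where "poly p a = 0" using alg_closed_imp_poly_has_root by blast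
      then obtain q where pq: "p = [:- a, 1:] * q" by (auto simp: poly_eq_0_iff_dvd)
      then have q0: "q \<noteq> 0" using False by auto
      let ?q = "poly_end C S f q" and ?g = "f - a \<star> Ident S"
      have qin: "?q \<in> Hom S S" by (rule poly_end_in[OF f])
      have g: "?g \<in> Hom S S" using Hom_diff[OF f smul_Ident_in] .
      have "0 = poly_end C S f (pCons 0 q + smult (- a) q)" using less.prems pq by simp
      also have "\<dots> = (f \<cdot> ?q) - a \<star> ?q"
        by (simp only: poly_end_add[OF f] poly_end_smult[OF f] poly_end_pCons[OF f]) simp
      also have "\<dots> = ?g \<cdot> ?q"
        using cmp_add_left[OF qin g smul_Ident_in[of a]] by (simp add: smul_Ident_cmp[OF qin])
      finally have gq: "?g \<cdot> ?q = 0" by simp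
      have "?g \<noteq> 0" using nonscalar by auto
      from simple_source_mono[OF S g this] have "?q = 0"
        unfolding is_mono_def using gq cmp_zero_right[OF g] qin Hom_zero by metis
      moreover have "degree q < degree p" using q0 pq degree_mult_eq[of "[:- a, 1:]" q] by simp
      ultimately show ?thesis using less.hyps q0 by blast
    qed
  qed
  with endomorphism_algebraic[OF f] show False by blast
qed

context modular_tensor_category
begin

lemmas Irr_nonzero = Ident_simple_nonzero[OF Irr_simple]

lemma End_scalar: "S \<in> Irr \<Longrightarrow> f \<in> Hom S S \<Longrightarrow> \<exists>a. f = a \<star> Ident S"
  by (rule schur_scalar[OF abelian_linear_category_axioms Irr_simple])

lemma Hom_Irr_zero:
  assumes "S \<in> Irr" "T \<in> Irr" "S \<noteq> T" "f \<in> Hom S T"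
  shows "f = 0"
proof (rule ccontr)
  assume "f \<noteq> 0"
  then have "isomorphic C S T"
    unfolding isomorphic_def using simple_nonzero_iso[OF Irr_simple Irr_simple] assms by blast
  moreover have "isomorphic C S S" unfolding isomorphic_def using iso_Ident by blast
  ultimately show False using Irr_complete[OF Irr_simple[OF assms(1)]] assms by blast
qed

lemma Irr_decomposition: "\<exists>n S i p. is_direct_sum C X n S i p \<and> (\<forall>a<n. S a \<in> Irr)"
proof -
  obtain n S i p where ds: "is_direct_sum C X n S i p" and S: "\<forall>a<n. is_simple C (S a)"
    using semisimple by blast
  have "\<exists>T f. T \<in> Irr \<and> is_iso C (S a) T f" if "a < n" for a
    using Irr_complete S that unfolding isomorphic_def by blast
  then obtain T f where Tf: "\<And>a. a < n \<Longrightarrow> T a \<in> Irr" "\<And>a. a < n \<Longrightarrow> is_iso C (S a) (T a) (f a)"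
    by metis
  define g where "g a = iso_inv C (S a) (T a) (f a)" for a
  have f: "f a \<in> Hom (S a) (T a)" and g: "g a \<in> Hom (T a) (S a)"
    and gf: "g a \<cdot> f a = Ident (S a)" and fg: "f a \<cdot> g a = Ident (T a)" if "a < n" for a
    using iso_inv_props[OF Tf(2)[OF that]] Tf(2)[OF that] by (auto simp: is_iso_def g_def)
  have i: "i a \<in> Hom (S a) X" and p: "p a \<in> Hom X (S a)" if "a < n" for a
    using ds that by (auto simp: is_direct_sum_def)
  have pi: "p a \<cdot> i b = (if a = b then Ident (S a) else 0)" if "a < n" "b < n" for a b
    using ds that by (auto simp: is_direct_sum_def)
  have "(f a \<cdot> p a) \<cdot> (i b \<cdot> g b) = (if a = b then Ident (T a) else 0)" if ab: "a < n" "b < n" for a b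
  proof -
    have "(f a \<cdot> p a) \<cdot> (i b \<cdot> g b) = f a \<cdot> (p a \<cdot> i b) \<cdot> g b"
      using cmp_assoc[OF g[OF ab(2)] i[OF ab(2)] cmp_in[OF p[OF ab(1)] f[OF ab(1)]]]
        cmp_assoc[OF i[OF ab(2)] p[OF ab(1)] f[OF ab(1)]] by simp
    also have "\<dots> = (if a = b then Ident (T a) else 0)"
    proof (cases "a = b")
      case True
      then show ?thesis using ab pi[OF ab] cmp_Ident[OF f] fg by simp
    next
      case False
      then show ?thesis using ab pi[OF ab] cmp_zero_right[OF f] cmp_zero_left[OF g] by simp
    qed
    finally show ?thesis .
  qed
  moreover have "(i a \<cdot> g a) \<cdot> (f a \<cdot> p a) = i a \<cdot> p a" if a: "a < n" for a
    using cmp_assoc[OF p[OF a] f[OF a] cmp_in[OF g[OF a] i[OF a]]]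
      cmp_assoc[OF f[OF a] g[OF a] i[OF a]] gf[OF a] cmp_Ident[OF i[OF a]] by simp
  then have "(\<Sum>a<n. (i a \<cdot> g a) \<cdot> (f a \<cdot> p a)) = Ident X"
    using ds by (simp add: is_direct_sum_def)
  ultimately have "is_direct_sum C X n T (\<lambda>a. i a \<cdot> g a) (\<lambda>a. f a \<cdot> p a)"
    unfolding is_direct_sum_def using cmp_in[OF g i] cmp_in[OF p f] by simp
  then show ?thesis using Tf by blast
qed

text \<open>The identity of \<open>X\<close> factors through simple objects.\<close>

lemma Irr_separating:
  assumes f: "f \<in> Hom X Y" "g \<in> Hom X Y"
    and eq: "\<And>S i. S \<in> Irr \<Longrightarrow> i \<in> Hom S X \<Longrightarrow> f \<cdot> i = g \<cdot> i"
  shows "f = g"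
proof -
  obtain n S i p where ds: "is_direct_sum C X n S i p" and S: "\<forall>a<n. S a \<in> Irr"
    using Irr_decomposition by blast
  have i: "i a \<in> Hom (S a) X" and p: "p a \<in> Hom X (S a)" if "a < n" for a
    using ds that by (auto simp: is_direct_sum_def)
  have id: "(\<Sum>a<n. i a \<cdot> p a) = Ident X" using ds by (simp add: is_direct_sum_def)
  have exp: "h = (\<Sum>a<n. h \<cdot> i a \<cdot> p a)" if h: "h \<in> Hom X Y" for h
  proof -
    have "h = h \<cdot> (\<Sum>a<n. i a \<cdot> p a)" using id h by (simp add: cmp_Ident)
    also have "\<dots> = (\<Sum>a<n. h \<cdot> (i a \<cdot> p a))"
      by (rule cmp_sum_right[OF h, where X=X]) (use cmp_in[OF p i] in simp)
    also have "\<dots> = (\<Sum>a<n. h \<cdot> i a \<cdot> p a)"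
      by (rule sum.cong) (use cmp_assoc[OF p i h] in simp_all)
    finally show ?thesis .
  qed
  have "(\<Sum>a<n. f \<cdot> i a \<cdot> p a) = (\<Sum>a<n. g \<cdot> i a \<cdot> p a)"
    by (rule sum.cong) (use eq S i in auto)
  then show ?thesis using exp[OF f(1)] exp[OF f(2)] by simp
qed

definition basis :: "'o \<Rightarrow> 'o \<Rightarrow> 'm set" where
  "basis T X = fst (dual_bases C T X)"

definition cobasis :: "'o \<Rightarrow> 'o \<Rightarrow> 'm \<Rightarrow> 'm" where
  "cobasis T X = snd (dual_bases C T X)"

lemma dual_bases_eq: "dual_bases C T X = (basis T X, cobasis T X)"
  by (simp add: basis_def cobasis_def)

text \<open>The inclusions of the summands \<open>T\<close> in a decomposition of \<open>X\<close> form a basis of \<open>Hom T X\<close>, and the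
projections to them form the dual basis.\<close>

lemma is_dual_bases_dual_bases:
  assumes T: "T \<in> Irr"
  shows "is_dual_bases C T X (dual_bases C T X)"
proof -
  obtain n S i p where ds: "is_direct_sum C X n S i p" and S: "\<forall>a<n. S a \<in> Irr"
    using Irr_decomposition by blast
  have i: "i a \<in> Hom (S a) X" and p: "p a \<in> Hom X (S a)" if "a < n" for a
    using ds that by (auto simp: is_direct_sum_def)
  have pi: "p a \<cdot> i b = (if a = b then Ident (S a) else 0)" if "a < n" "b < n" for a b
    using ds that by (auto simp: is_direct_sum_def)
  have id: "(\<Sum>a<n. i a \<cdot> p a) = Ident X" using ds by (simp add: is_direct_sum_def)
  define A where "A = {a. a < n \<and> S a = T}"
  have A: "finite A" by (simp add: A_def)
  have iA: "i a \<in> Hom T X" and pA: "p a \<in> Hom X T" if "a \<in> A" for a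
    using i[of a] p[of a] that by (auto simp: A_def)
  have piA: "p a \<cdot> i b = (if a = b then Ident T else 0)" if "a \<in> A" "b \<in> A" for a b
    using pi[of a b] that by (auto simp: A_def)
  have inj: "inj_on i A" "inj_on p A"
    unfolding inj_on_def using piA Irr_nonzero[OF T] by metis+
  have span_i: "g \<in> vs.span (i ` A)" if g: "g \<in> Hom T X" for g
  proof -
    have "g = (\<Sum>a<n. i a \<cdot> p a) \<cdot> g" using id g by (simp add: Ident_cmp)
    also have "\<dots> = (\<Sum>a<n. i a \<cdot> (p a \<cdot> g))"
      by (subst cmp_sum_left[OF g, where Z=X]) (use cmp_in[OF p i] cmp_assoc[OF g p i] in simp_all)
    finally have *: "g = (\<Sum>a<n. i a \<cdot> (p a \<cdot> g))" .
    have "i a \<cdot> (p a \<cdot> g) \<in> vs.span (i ` A)" if a: "a < n" for a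
    proof (cases "S a = T")
      case True
      then obtain c where "p a \<cdot> g = c \<star> Ident T"
        using End_scalar[OF T] cmp_in[OF g p[OF a]] by auto
      then show ?thesis
        using cmp_smul_Ident[OF i[OF a]] vs.span_scale[OF vs.span_base, of "i a" "i ` A" c] True a
        by (simp add: A_def)
    next
      case False
      then have "p a \<cdot> g = 0" using Hom_Irr_zero[OF T] cmp_in[OF g p[OF a]] S a by auto
      then show ?thesis using cmp_zero_right[OF i[OF a]] by (simp add: vs.span_zero)
    qed
    then show ?thesis by (subst *) (auto intro: vs.span_sum)
  qed
  have span_p: "g \<in> vs.span (p ` A)" if g: "g \<in> Hom X T" for g
  proof -
    have "g = g \<cdot> (\<Sum>a<n. i a \<cdot> p a)" using id g by (simp add: cmp_Ident)
    also have "\<dots> = (\<Sum>a<n. (g \<cdot> i a) \<cdot> p a)"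
      by (subst cmp_sum_right[OF g, where X=X]) (use cmp_in[OF p i] cmp_assoc[OF p i g] in simp_all)
    finally have *: "g = (\<Sum>a<n. (g \<cdot> i a) \<cdot> p a)" .
    have "(g \<cdot> i a) \<cdot> p a \<in> vs.span (p ` A)" if a: "a < n" for a
    proof (cases "S a = T")
      case True
      then obtain c where "g \<cdot> i a = c \<star> Ident T"
        using End_scalar[OF T] cmp_in[OF i[OF a] g] by auto
      then show ?thesis
        using smul_Ident_cmp[OF p[OF a]] vs.span_scale[OF vs.span_base, of "p a" "p ` A" c] True a
        by (simp add: A_def)
    next
      case False
      then have "g \<cdot> i a = 0" using Hom_Irr_zero[OF _ T] cmp_in[OF i[OF a] g] S a by auto
      then show ?thesis using cmp_zero_left[OF p[OF a]] by (simp add: vs.span_zero)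
    qed
    then show ?thesis by (subst *) (auto intro: vs.span_sum)
  qed
  have "\<not> vs.dependent (i ` A)"
  proof (rule vs.independent_if_scalars_zero)
    fix u x assume u: "(\<Sum>x\<in>i ` A. u x \<star> x) = 0" and "x \<in> i ` A"
    then obtain a where a: "a \<in> A" "x = i a" by blast
    have "0 = p a \<cdot> (\<Sum>b\<in>A. u (i b) \<star> i b)"
      using u cmp_zero_right[OF pA[OF a(1)]] by (simp add: sum.reindex[OF inj(1)])
    also have "\<dots> = (\<Sum>b\<in>A. u (i b) \<star> (p a \<cdot> i b))"
      by (subst cmp_sum_right[OF pA[OF a(1)], where X=T])
        (use Hom_smul[OF iA] cmp_smul_right[OF pA[OF a(1)] iA] in simp_all)
    also have "\<dots> = (\<Sum>b\<in>A. if a = b then u (i b) \<star> Ident T else 0)"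
      using piA[OF a(1)] by (intro sum.cong) simp_all
    also have "\<dots> = u x \<star> Ident T" using a A by simp
    finally show "u x = 0" using Irr_nonzero[OF T] by simp
  qed (use A in simp)
  moreover have "\<not> vs.dependent (p ` A)"
  proof (rule vs.independent_if_scalars_zero)
    fix u x assume u: "(\<Sum>x\<in>p ` A. u x \<star> x) = 0" and "x \<in> p ` A"
    then obtain a where a: "a \<in> A" "x = p a" by blast
    have "0 = (\<Sum>b\<in>A. u (p b) \<star> p b) \<cdot> i a"
      using u cmp_zero_left[OF iA[OF a(1)]] by (simp add: sum.reindex[OF inj(2)])
    also have "\<dots> = (\<Sum>b\<in>A. u (p b) \<star> (p b \<cdot> i a))"
      by (subst cmp_sum_left[OF iA[OF a(1)], where Z=T])
        (use Hom_smul[OF pA] cmp_smul_left[OF iA[OF a(1)] pA] in simp_all)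
    also have "\<dots> = (\<Sum>b\<in>A. if b = a then u (p b) \<star> Ident T else 0)"
      using piA[OF _ a(1)] by (intro sum.cong) simp_all
    also have "\<dots> = u x \<star> Ident T" using a A by simp
    finally show "u x = 0" using Irr_nonzero[OF T] by simp
  qed (use A in simp)
  moreover have "vs.span (i ` A) = Hom T X"
    using span_i vs.span_minimal[OF _ subspace_Hom] iA by blast
  moreover have "vs.span (p ` A) = Hom X T"
    using span_p vs.span_minimal[OF _ subspace_Hom] pA by blast
  moreover define st where "st = (\<lambda>b. p (the_inv_into A i b))"
  have st: "st (i a) = p a" if "a \<in> A" for a
    using the_inv_into_f_f[OF inj(1) that] by (simp add: st_def)
  then have img: "st ` i ` A = p ` A" by (auto simp: image_comp intro!: image_cong)
  moreover have "st b' \<cdot> b = (if b = b' then Ident T else 0)" if b: "b \<in> i ` A" "b' \<in> i ` A" for b b'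
  proof -
    obtain a a' where "a \<in> A" "a' \<in> A" "b = i a" "b' = i a'" using b by blast
    then show ?thesis using st[of a'] piA[of a' a] inj_on_eq_iff[OF inj(1)] by auto
  qed
  ultimately have "is_dual_bases C T X (i ` A, st)"
    unfolding is_dual_bases_def is_basis_def prod.case img
    by (intro conjI ballI finite_imageI A)
  then show ?thesis unfolding dual_bases_def by (rule someI[of "is_dual_bases C T X"])
qed

lemma finite_basis: "T \<in> Irr \<Longrightarrow> finite (basis T X)"
  and basis_in: "T \<in> Irr \<Longrightarrow> b \<in> basis T X \<Longrightarrow> b \<in> Hom T X"
  and cobasis_in: "T \<in> Irr \<Longrightarrow> b \<in> basis T X \<Longrightarrow> cobasis T X b \<in> Hom X T"
  and cobasis_basis: "T \<in> Irr \<Longrightarrow> b \<in> basis T X \<Longrightarrow> b' \<in> basis T X \<Longrightarrow>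
    cobasis T X b' \<cdot> b = (if b = b' then Ident T else 0)"
  and span_basis: "T \<in> Irr \<Longrightarrow> vs.span (basis T X) = Hom T X"
  and span_cobasis: "T \<in> Irr \<Longrightarrow> vs.span (cobasis T X ` basis T X) = Hom X T"
proof -
  assume "T \<in> Irr"
  then have *: "finite (basis T X)" "vs.span (basis T X) = Hom T X" "vs.span (cobasis T X ` basis T X) = Hom X T"
    "\<forall>b\<in>basis T X. \<forall>b'\<in>basis T X. cobasis T X b' \<cdot> b = (if b = b' then Ident T else 0)"
    using is_dual_bases_dual_bases[of T X]
    by (simp_all add: is_dual_bases_def dual_bases_eq is_basis_def)
  then show "finite (basis T X)" "vs.span (basis T X) = Hom T X" "vs.span (cobasis T X ` basis T X) = Hom X T"
    by simp_all
  show "b \<in> Hom T X" if "b \<in> basis T X" using vs.span_base[OF that] *(2) by simp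
  show "cobasis T X b \<in> Hom X T" if "b \<in> basis T X" using vs.span_base[OF imageI[OF that]] *(3) by blast
  show "cobasis T X b' \<cdot> b = (if b = b' then Ident T else 0)" if "b \<in> basis T X" "b' \<in> basis T X"
    using *(4) that by blast
qed

text \<open>Both sides act as the identity on the chosen basis vectors of every \<open>Hom T X\<close>.\<close>

lemma basis_complete: "(\<Sum>T\<in>Irr. \<Sum>b\<in>basis T X. b \<cdot> cobasis T X b) = Ident X"
proof (rule Irr_separating)
  have in1: "b \<cdot> cobasis T X b \<in> Hom X X" if "T \<in> Irr" "b \<in> basis T X" for T b
    using cmp_in[OF cobasis_in[OF that] basis_in[OF that]] .
  have in2: "(\<Sum>b\<in>basis T X. b \<cdot> cobasis T X b) \<in> Hom X X" if "T \<in> Irr" for T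
    by (rule Hom_sum) (rule in1[OF that])
  show "(\<Sum>T\<in>Irr. \<Sum>b\<in>basis T X. b \<cdot> cobasis T X b) \<in> Hom X X"
    by (rule Hom_sum) (rule in2)
  fix S i assume S: "S \<in> Irr" and i: "i \<in> Hom S X"
  have "(\<Sum>T\<in>Irr. \<Sum>b\<in>basis T X. b \<cdot> cobasis T X b) \<cdot> i = (\<Sum>T\<in>Irr. \<Sum>b\<in>basis T X. b \<cdot> (cobasis T X b \<cdot> i))"
  proof -
    have "(\<Sum>T\<in>Irr. \<Sum>b\<in>basis T X. b \<cdot> cobasis T X b) \<cdot> i = (\<Sum>T\<in>Irr. \<Sum>b\<in>basis T X. b \<cdot> cobasis T X b \<cdot> i)"
      using in1 in2 by (simp add: cmp_sum_left[OF i, where Z=X])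
    also have "\<dots> = (\<Sum>T\<in>Irr. \<Sum>b\<in>basis T X. b \<cdot> (cobasis T X b \<cdot> i))"
      by (intro sum.cong refl) (simp add: cmp_assoc[OF i cobasis_in basis_in])
    finally show ?thesis .
  qed
  also have "\<dots> = (\<Sum>T\<in>Irr. if T = S then \<Sum>b\<in>basis T X. b \<cdot> (cobasis T X b \<cdot> i) else 0)"
  proof (rule sum.cong[OF refl], clarsimp)
    fix T assume T: "T \<in> Irr" "T \<noteq> S"
    then have "b \<cdot> (cobasis T X b \<cdot> i) = 0" if "b \<in> basis T X" for b
      using Hom_Irr_zero[OF S T(1)] cmp_in[OF i cobasis_in[OF T(1) that]] cmp_zero_right[OF basis_in[OF T(1) that]] by metis
    then show "(\<Sum>b\<in>basis T X. b \<cdot> (cobasis T X b \<cdot> i)) = 0" by simp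
  qed
  also have "\<dots> = (\<Sum>b\<in>basis S X. b \<cdot> (cobasis S X b \<cdot> i))" using S finite_Irr by simp
  also have "\<dots> = i"
  proof -
    have "i \<in> range (\<lambda>u. \<Sum>b\<in>basis S X. u b \<star> b)"
      using i by (simp only: vs.span_finite[OF finite_basis[OF S], symmetric] span_basis[OF S])
    then obtain u where u: "i = (\<Sum>b\<in>basis S X. u b \<star> b)" by blast
    have "b \<cdot> (cobasis S X b \<cdot> i) = u b \<star> b" if b: "b \<in> basis S X" for b
    proof -
      have "cobasis S X b \<cdot> i = (\<Sum>b'\<in>basis S X. u b' \<star> (cobasis S X b \<cdot> b'))"
        unfolding u by (subst cmp_sum_right[OF cobasis_in[OF S b], where X=S])
          (use Hom_smul[OF basis_in[OF S]] cmp_smul_right[OF cobasis_in[OF S b] basis_in[OF S]] in simp_all)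
      also have "\<dots> = (\<Sum>b'\<in>basis S X. if b' = b then u b' \<star> Ident S else 0)"
        by (rule sum.cong) (use cobasis_basis[OF S _ b] in simp_all)
      also have "\<dots> = u b \<star> Ident S" using b finite_basis[OF S] by simp
      finally show ?thesis using cmp_smul_Ident[OF basis_in[OF S b]] by simp
    qed
    then show ?thesis using u by simp
  qed
  finally show "(\<Sum>T\<in>Irr. \<Sum>b\<in>basis T X. b \<cdot> cobasis T X b) \<cdot> i = Ident X \<cdot> i"
    using i by (simp add: Ident_cmp)
qed (rule Ident_in)

lemma linear_map_on_Ident:
  assumes K: "linear_map_on (smul C) t (Hom X X) W K"
  shows "K (Ident X) = (\<Sum>T\<in>Irr. \<Sum>b\<in>basis T X. K (b \<cdot> cobasis T X b))"
proof -
  have i1: "b \<cdot> cobasis T X b \<in> Hom X X" if "T \<in> Irr" "b \<in> basis T X" for T b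
    using cmp_in[OF cobasis_in[OF that] basis_in[OF that]] .
  have i2: "(\<Sum>b\<in>basis T X. b \<cdot> cobasis T X b) \<in> Hom X X" if "T \<in> Irr" for T
    by (rule Hom_sum) (rule i1[OF that])
  show ?thesis
    unfolding basis_complete[of X, symmetric]
    by (subst linear_map_on_sum[OF K i2], assumption, rule sum.cong[OF refl], rule linear_map_on_sum[OF K i1])
qed

end

section \<open>String diagrams\<close>

context monoidal_linear_category
begin

text \<open>A string diagram with source \<open>A\<close> is represented by the word of its outgoing strands together with a
morphism from \<open>A\<close> to the product of that word.  Diagrams grow upwards: \<open>layer n u f v\<close> attaches a box
\<open>f : u \<rightarrow> v\<close> to the strands that follow the first \<open>n\<close> strands.  The surrounding strands are thus recorded by
the single number \<open>n\<close>, an equation between boxes becomes a rewriting rule that can be used at any height and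
any position, and associativity, units and the bookkeeping of identities are left to computations with words.\<close>

definition obj :: "'a list \<Rightarrow> 'a" where
  "obj w = foldr (tens_ob C) w \<one>"

lemma obj_simps [simp]: "obj [] = \<one>" "obj (X # w) = X \<bullet> obj w"
  by (simp_all add: obj_def)

lemma obj_append [simp]: "obj (u @ v) = obj u \<bullet> obj v"
  by (induction u) (simp_all add: unit_tens_ob tens_ob_assoc)

lemmas obj_norm = tens_ob_assoc unit_tens_ob tens_ob_unit

definition whisker :: "'a list \<Rightarrow> 'b \<Rightarrow> 'a list \<Rightarrow> 'b" where
  "whisker p f q = Ident (obj p) \<otimes> f \<otimes> Ident (obj q)"

lemma whisker_in:
  "f \<in> Hom (obj u) (obj v) \<Longrightarrow> whisker p f q \<in> Hom (obj (p @ u @ q)) (obj (p @ v @ q))"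
  using tens_in[OF tens_in[OF Ident_in] Ident_in, of f "obj u" "obj v" "obj p" "obj q"]
  by (simp add: whisker_def tens_ob_assoc)

lemma whisker_cmp:
  assumes "f \<in> Hom (obj u) (obj v)" "g \<in> Hom (obj v) (obj w)"
  shows "whisker p (g \<cdot> f) q = whisker p g q \<cdot> whisker p f q"
proof -
  have "Ident (obj p) \<otimes> (g \<cdot> f) = (Ident (obj p) \<otimes> g) \<cdot> (Ident (obj p) \<otimes> f)"
    using tens_cmp[OF Ident_in Ident_in assms, of "obj p"] cmp_Ident[OF Ident_in] by simp
  then show ?thesis
    using tens_cmp[OF tens_in[OF Ident_in assms(1)] tens_in[OF Ident_in assms(2)] Ident_in Ident_in]
      cmp_Ident[OF Ident_in] by (simp add: whisker_def)
qed

lemma whisker_whisker: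
  assumes f: "f \<in> Hom (obj u) (obj v)"
  shows "whisker p (whisker p' f q') q = whisker (p @ p') f (q' @ q)"
proof -
  have "whisker p (whisker p' f q') q = Ident (obj p) \<otimes> (Ident (obj p') \<otimes> f \<otimes> Ident (obj q') \<otimes> Ident (obj q))"
    unfolding whisker_def by (rule tens_assoc[OF Ident_in tens_in[OF tens_in[OF Ident_in f] Ident_in] Ident_in])
  also have "\<dots> = Ident (obj p) \<otimes> ((Ident (obj p') \<otimes> f) \<otimes> Ident (obj (q' @ q)))"
    by (simp add: tens_assoc[OF tens_in[OF Ident_in f] Ident_in Ident_in] tens_Ident)
  also have "\<dots> = (Ident (obj p) \<otimes> (Ident (obj p') \<otimes> f)) \<otimes> Ident (obj (q' @ q))"
    by (rule tens_assoc[OF Ident_in tens_in[OF Ident_in f] Ident_in, symmetric])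
  also have "Ident (obj p) \<otimes> (Ident (obj p') \<otimes> f) = Ident (obj (p @ p')) \<otimes> f"
    using tens_assoc[OF Ident_in Ident_in f] by (simp add: tens_Ident)
  finally show ?thesis by (simp add: whisker_def)
qed

lemma whisker_Ident: "whisker p (Ident (obj u)) q = Ident (obj (p @ u @ q))"
  by (simp add: whisker_def tens_Ident tens_ob_assoc)

lemma whisker_Nil: "f \<in> Hom (obj u) (obj v) \<Longrightarrow> whisker [] f [] = f"
  by (simp add: whisker_def unit_tens tens_unit)

lemma whisker_interchange:
  assumes f: "f \<in> Hom (obj u) (obj v)" and g: "g \<in> Hom (obj u') (obj v')"
  shows "whisker p f (r @ v' @ q) \<cdot> whisker (p @ u @ r) g q = whisker (p @ v @ r) g q \<cdot> whisker p f (r @ u' @ q)"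
proof -
  let ?F = "Ident (obj p) \<otimes> f" and ?G = "whisker r g q"
  have F: "?F \<in> Hom (obj (p @ u)) (obj (p @ v))" using tens_in[OF Ident_in f] by simp
  have G: "?G \<in> Hom (obj (r @ u' @ q)) (obj (r @ v' @ q))" by (rule whisker_in[OF g])
  have eq: "whisker (p @ x @ r) g q = Ident (obj (p @ x)) \<otimes> ?G" for x
    using whisker_whisker[OF g, of "p @ x" r q "[]"] tens_unit[OF tens_in[OF Ident_in G], of "obj (p @ x)"]
    by (simp add: whisker_def)
  have "whisker p f (r @ v' @ q) \<cdot> whisker (p @ u @ r) g q = (?F \<cdot> Ident (obj (p @ u))) \<otimes> (Ident (obj (r @ v' @ q)) \<cdot> ?G)"
    unfolding eq using tens_cmp[OF Ident_in F G Ident_in] by (simp add: whisker_def)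
  also have "\<dots> = (Ident (obj (p @ v)) \<cdot> ?F) \<otimes> (?G \<cdot> Ident (obj (r @ u' @ q)))"
    by (simp only: cmp_Ident[OF F] Ident_cmp[OF F] cmp_Ident[OF G] Ident_cmp[OF G])
  also have "\<dots> = whisker (p @ v @ r) g q \<cdot> whisker p f (r @ u' @ q)"
    unfolding eq using tens_cmp[OF F Ident_in Ident_in G] by (simp add: whisker_def)
  finally show ?thesis .
qed

definition fits :: "nat \<Rightarrow> 'a list \<Rightarrow> 'a list \<Rightarrow> bool" where
  "fits n u w \<longleftrightarrow> n \<le> length w \<and> take (length u) (drop n w) = u"

definition layer :: "nat \<Rightarrow> 'a list \<Rightarrow> 'b \<Rightarrow> 'a list \<Rightarrow> 'a list \<times> 'b \<Rightarrow> 'a list \<times> 'b" where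
  "layer n u f v s = (take n (fst s) @ v @ drop (n + length u) (fst s),
     whisker (take n (fst s)) f (drop (n + length u) (fst s)) \<cdot> snd s)"

definition diagram :: "'a list \<times> 'b \<Rightarrow> bool" where
  "diagram s \<longleftrightarrow> (\<exists>A. snd s \<in> Hom A (obj (fst s)))"

lemma fst_layer [simp]: "fst (layer n u f v s) = take n (fst s) @ v @ drop (n + length u) (fst s)"
  by (simp add: layer_def)

lemma fits_split: "fits n u w \<longleftrightarrow> (\<exists>p q. w = p @ u @ q \<and> length p = n)"
proof
  assume *: "fits n u w"
  then have "w = take n w @ u @ drop (length u) (drop n w)"
    unfolding fits_def by (metis append_take_drop_id)
  with * show "\<exists>p q. w = p @ u @ q \<and> length p = n"
    unfolding fits_def by (metis length_take min_absorb2)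
qed (auto simp: fits_def)

lemma layer_split: "fst s = p @ u @ q \<Longrightarrow> length p = n \<Longrightarrow>
    layer n u f v s = (p @ v @ q, whisker p f q \<cdot> snd s)"
  by (simp add: layer_def)

lemma diagram_layer:
  assumes "fits n u (fst s)" "f \<in> Hom (obj u) (obj v)" "diagram s"
  shows "diagram (layer n u f v s)"
proof -
  obtain p q where s: "fst s = p @ u @ q" "length p = n" using assms(1) by (auto simp: fits_split)
  show ?thesis
    using assms(3) cmp_in[OF _ whisker_in[OF assms(2), of p q]]
    by (auto simp: layer_split[OF s] diagram_def s)
qed

text \<open>Boxes on disjoint strands can be attached in either order.  The position of the right box shifts by the
change of width of the left one.  The two orientations of this rule normalise diagrams to ``left box first'' and
``right box first''.\<close>

lemma layer_interchange:
  assumes le: "n + length u \<le> m" and fits: "fits n u (fst s)" "fits m u' (fst s)"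
    and f: "f \<in> Hom (obj u) (obj v)" and g: "g \<in> Hom (obj u') (obj v')" and s: "diagram s"
  shows "layer n u f v (layer m u' g v' s) = layer (m + length v - length u) u' g v' (layer n u f v s)"
proof -
  obtain p t where p: "fst s = p @ u @ t" "length p = n" using fits(1) by (auto simp: fits_split)
  obtain p' q where q: "fst s = p' @ u' @ q" "length p' = m" using fits(2) by (auto simp: fits_split)
  define r where "r = drop (n + length u) p'"
  have "take (n + length u) (fst s) = p @ u" using p by simp
  moreover have "take (n + length u) (fst s) = take (n + length u) p'" using q le by simp
  ultimately have p': "p' = (p @ u) @ r" by (metis append_take_drop_id r_def)
  then have w: "fst s = p @ u @ r @ u' @ q" using q by simp
  have m: "m = length (p @ u @ r)" using q p' by simp
  obtain A where A: "snd s \<in> Hom A (obj (p @ u @ r @ u' @ q))" using s w by (auto simp: diagram_def)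
  note in1 = whisker_in[OF f, of p "r @ u' @ q"] and in2 = whisker_in[OF g, of "p @ v @ r" q]
    and in3 = whisker_in[OF g, of "p @ u @ r" q] and in4 = whisker_in[OF f, of p "r @ v' @ q"]
  have "layer n u f v (layer m u' g v' s) = (p @ v @ r @ v' @ q, whisker p f (r @ v' @ q) \<cdot> (whisker (p @ u @ r) g q \<cdot> snd s))"
    using w m p(2) by (simp add: layer_def)
  also have "whisker p f (r @ v' @ q) \<cdot> (whisker (p @ u @ r) g q \<cdot> snd s)
      = whisker p f (r @ v' @ q) \<cdot> whisker (p @ u @ r) g q \<cdot> snd s"
    by (rule cmp_assoc[where X="obj (p @ u @ r @ u' @ q)"]) (use A in3 in4 in \<open>simp_all add: obj_norm\<close>)
  also have "\<dots> = whisker (p @ v @ r) g q \<cdot> whisker p f (r @ u' @ q) \<cdot> snd s"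
    by (simp only: whisker_interchange[OF f g])
  also have "\<dots> = whisker (p @ v @ r) g q \<cdot> (whisker p f (r @ u' @ q) \<cdot> snd s)"
    by (rule cmp_assoc[symmetric, where X="obj (p @ u @ r @ u' @ q)"]) (use A in1 in2 in \<open>simp_all add: obj_norm\<close>)
  finally show ?thesis
    using w m p(2) by (simp add: layer_def)
qed

lemma layer_interchange':
  assumes le: "n + length v \<le> m"
    and "fits n u (fst s)" "fits (m + length u - length v) u' (fst s)"
    and "f \<in> Hom (obj u) (obj v)" "g \<in> Hom (obj u') (obj v')" "diagram s"
  shows "layer m u' g v' (layer n u f v s) = layer n u f v (layer (m + length u - length v) u' g v' s)"
  using layer_interchange[OF _ assms(2-6)] le by simp

text \<open>\<open>den E w v F\<close> says that \<open>E\<close> denotes \<open>F\<close>: attaching \<open>E\<close> as a single box has the effect of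
\<open>F\<close>.  The rules below find \<open>F\<close> by recursion on the expression \<open>E\<close>; composites become composites of layers, and identities disappear.\<close>

definition den :: "'b \<Rightarrow> 'a list \<Rightarrow> 'a list \<Rightarrow> (nat \<Rightarrow> 'a list \<times> 'b \<Rightarrow> 'a list \<times> 'b) \<Rightarrow> bool" where
  "den E w v F \<longleftrightarrow> E \<in> Hom (obj w) (obj v) \<and>
     (\<forall>n s. diagram s \<longrightarrow> fits n w (fst s) \<longrightarrow> F n s = layer n w E v s)"

abbreviation box :: "'b \<Rightarrow> 'a list \<Rightarrow> 'a list \<Rightarrow> bool" where
  "box f u v \<equiv> den f u v (\<lambda>n. layer n u f v)"

lemma den_in: "den E w v F \<Longrightarrow> E \<in> Hom (obj w) (obj v)"
  by (simp add: den_def)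

lemma den_layer: "den E w v F \<Longrightarrow> diagram s \<Longrightarrow> fits n w (fst s) \<Longrightarrow> F n s = layer n w E v s"
  unfolding den_def by blast

lemma den_box: "f \<in> Hom (obj w) (obj v) \<Longrightarrow> den f w v (\<lambda>n. layer n w f v)"
  by (simp add: den_def)

lemma den_Ident:
  assumes "X = obj w"
  shows "den (Ident X) w w (\<lambda>n s. s)"
proof -
  have "s = layer n w (Ident (obj w)) w s" if d: "diagram s" and ft: "fits n w (fst s)" for n s
  proof -
    obtain p q where s: "fst s = p @ w @ q" "length p = n" using ft by (auto simp: fits_split)
    obtain A where A: "snd s \<in> Hom A (obj (p @ w @ q))" using d s(1) by (auto simp: diagram_def)
    show ?thesis
      using s(1) Ident_cmp[OF A] by (auto simp: layer_split[OF s] whisker_Ident prod_eq_iff)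
  qed
  then show ?thesis using assms by (auto simp: den_def Ident_in)
qed

lemma den_cmp:
  assumes F: "den f w u F" and G: "den g u' v G" and u: "u = u'"
  shows "den (g \<cdot> f) w v (\<lambda>n s. G n (F n s))"
proof -
  have f: "f \<in> Hom (obj w) (obj u)" and g: "g \<in> Hom (obj u) (obj v)"
    using F G u by (simp_all add: den_def)
  have "G n (F n s) = layer n w (g \<cdot> f) v s" if s: "diagram s" "fits n w (fst s)" for n s
  proof -
    obtain p q where p: "fst s = p @ w @ q" "length p = n" using s(2) by (auto simp: fits_split)
    obtain A where A: "snd s \<in> Hom A (obj (p @ w @ q))" using s(1) p(1) by (auto simp: diagram_def)
    have d: "diagram (layer n w f u s)" by (rule diagram_layer[OF s(2) f s(1)])
    have p': "fst (layer n w f u s) = p @ u @ q" using p by simp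
    have "G n (F n s) = layer n u g v (layer n w f u s)"
      using den_layer[OF F s] den_layer[OF G d] p' p(2) u by (auto simp: fits_split)
    also have "\<dots> = (p @ v @ q, whisker p g q \<cdot> (whisker p f q \<cdot> snd s))"
      by (simp add: layer_split[OF p'  p(2)]) (simp add: layer_split[OF p])
    also have "\<dots> = layer n w (g \<cdot> f) v s"
      using cmp_assoc[OF A whisker_in[OF f] whisker_in[OF g]] by (simp add: layer_split[OF p] whisker_cmp[OF f g])
    finally show ?thesis .
  qed
  then show ?thesis using cmp_in[OF f g] by (simp add: den_def)
qed

lemma den_tens:
  assumes F: "den f u v F" and G: "den g u' v' G" and w: "w = u @ u'" "w' = v @ v'" and N: "N = length u"
  shows "den (f \<otimes> g) w w' (\<lambda>n s. F n (G (n + N) s))"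
proof -
  have f: "f \<in> Hom (obj u) (obj v)" and g: "g \<in> Hom (obj u') (obj v')"
    using F G by (simp_all add: den_def)
  have "F n (G (n + N) s) = layer n w (f \<otimes> g) w' s" if s: "diagram s" "fits n w (fst s)" for n s
  proof -
    obtain p q where p: "fst s = p @ u @ u' @ q" "length p = n" using s(2) by (auto simp: fits_split w)
    obtain A where A: "snd s \<in> Hom A (obj (p @ u @ u' @ q))" using s(1) p(1) by (auto simp: diagram_def)
    have ft: "fits (n + N) u' (fst s)"
      unfolding fits_split using p N by (intro exI[of _ "p @ u"] exI[of _ q]) simp
    have d: "diagram (layer (n + N) u' g v' s)"
      by (rule diagram_layer[OF ft g s(1)])
    have l: "layer (n + N) u' g v' s = (p @ u @ v' @ q, whisker (p @ u) g q \<cdot> snd s)"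
      using layer_split[of s "p @ u" u' q "n + N" g v'] p N by simp
    have fu: "fits n u (fst (layer (n + N) u' g v' s))"
      using p(2) unfolding l fits_split by auto
    have "F n (G (n + N) s) = layer n u f v (layer (n + N) u' g v' s)"
      using den_layer[OF G s(1) ft] den_layer[OF F d fu] by simp
    also have "\<dots> = (p @ v @ v' @ q, whisker p f (v' @ q) \<cdot> (whisker (p @ u) g q \<cdot> snd s))"
      unfolding l by (subst layer_split[OF _ p(2)]) simp_all
    also have "whisker p f (v' @ q) \<cdot> (whisker (p @ u) g q \<cdot> snd s) = whisker p f (v' @ q) \<cdot> whisker (p @ u) g q \<cdot> snd s"
      by (rule cmp_assoc[where X="obj (p @ u @ u' @ q)" and Y="obj (p @ u @ v' @ q)"])
        (use A whisker_in[OF g, of "p @ u" q] whisker_in[OF f, of p "v' @ q"] in \<open>simp_all add: obj_norm\<close>)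
    also have "whisker p f (v' @ q) \<cdot> whisker (p @ u) g q = whisker p (f \<otimes> g) q"
    proof -
      have fg: "f \<otimes> g = whisker [] f v' \<cdot> whisker u g []"
        using tens_cmp[OF Ident_in f g Ident_in] cmp_Ident[OF f] Ident_cmp[OF g]
          unit_tens[OF f] tens_unit[OF tens_in[OF Ident_in g]]
        by (simp add: whisker_def)
      have "whisker u g [] \<in> Hom (obj (u @ u')) (obj (u @ v'))" "whisker [] f v' \<in> Hom (obj (u @ v')) (obj (v @ v'))"
        using whisker_in[OF g, of u "[]"] whisker_in[OF f, of "[]" v'] by simp_all
      from whisker_cmp[OF this] show ?thesis
        by (simp add: fg whisker_whisker[OF f] whisker_whisker[OF g])
    qed
    also have "(p @ v @ v' @ q, whisker p (f \<otimes> g) q \<cdot> snd s) = layer n w (f \<otimes> g) w' s"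
      using p by (simp add: layer_def w)
    finally show ?thesis .
  qed
  then show ?thesis using tens_in[OF f g] by (simp add: den_def w)
qed

text \<open>The identity of the word \<open>w\<close> is a diagram on which \<open>E\<close> and \<open>E'\<close> have effects \<open>E\<close> and \<open>E'\<close>.\<close>

lemma den_eqI:
  assumes E: "den E w v F" and E': "den E' w v F'"
    and eq: "\<And>s. diagram s \<Longrightarrow> fst s = w \<Longrightarrow> F 0 s = F' 0 s"
  shows "E = E'"
proof -
  let ?s = "(w, Ident (obj w))"
  have *: "layer 0 w f v ?s = (v, f)" if "f \<in> Hom (obj w) (obj v)" for f
    using cmp_Ident[OF that] by (simp add: layer_def whisker_Nil[OF that])
  have d: "diagram ?s" using Ident_in by (auto simp: diagram_def)
  have "layer 0 w E v ?s = layer 0 w E' v ?s"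
    using den_layer[OF E d] den_layer[OF E' d] eq[OF d] by (simp add: fits_def)
  then show ?thesis using *[OF den_in[OF E]] *[OF den_in[OF E']] by simp
qed

text \<open>This turns an equation of morphisms into a rewriting rule for layers.  With object quantifiers the
functions \<open>F\<close> and \<open>F'\<close> are applied to bound variables, so that they are found by pattern unification.\<close>

lemma den_eqD:
  assumes "E = E'" "den E w v F" "den E' w v F'"
  shows "\<forall>n s. fits n w (fst s) \<longrightarrow> diagram s \<longrightarrow> F n s = F' n s"
  using den_layer[OF assms(2)] den_layer[OF assms(3)] assms(1) by simp

end

section \<open>Partial traces\<close>

context monoidal_linear_category
begin

declare obj_norm [simp]

lemma den_cong: "den E w v F \<Longrightarrow> (\<And>n s. F n s = F' n s) \<Longrightarrow> den E w v F'"
  by (simp add: den_def)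

lemma den_Ident_unit: "den (Ident \<one>) [] [] (\<lambda>n s. s)"
  by (rule den_Ident) simp

lemma den_Ident_atom: "den (Ident X) [X] [X] (\<lambda>n s. s)"
  by (rule den_Ident) simp

text \<open>The identity of a product is read as two strands; of \<open>den_intros\<close> the splitting rule has to be tried
before \<open>den_Ident_atom\<close>.\<close>

lemma den_Ident_tens:
  assumes "den (Ident X) u u (\<lambda>n s. s)" "den (Ident Y) v v (\<lambda>n s. s)" "w = u @ v"
  shows "den (Ident (X \<bullet> Y)) w w (\<lambda>n s. s)"
  using den_tens[OF assms(1,2) assms(3) assms(3) refl] by (simp add: tens_Ident)

lemmas den_intros = den_cmp den_tens den_Ident_unit den_Ident_tens den_Ident_atom

lemmas diagram_simps = diagram_layer fits_def

end

context pivotal_linear_category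
begin

declare ev_in [simp] coev_in [simp] evt_in [simp] coevt_in [simp]

abbreviation "ev_at n X \<equiv> layer n [dual X, X] (ev X) []"
abbreviation "coev_at n X \<equiv> layer n [] (coev X) [X, dual X]"
abbreviation "evt_at n X \<equiv> layer n [X, dual X] (evt X) []"
abbreviation "coevt_at n X \<equiv> layer n [] (coevt X) [dual X, X]"

lemma den_ev: "box (ev X) [dual X, X] []"
  and den_coev: "box (coev X) [] [X, dual X]"
  and den_evt: "box (evt X) [X, dual X] []"
  and den_coevt: "box (coevt X) [] [dual X, X]"
  by (rule den_box; simp)+

lemmas den_duals = den_ev den_coev den_evt den_coevt

lemma layer_zigzag [rule_format]:
  "\<forall>n s. fits n [X] (fst s) \<longrightarrow> diagram s \<longrightarrow>
    ev_at (Suc n) X (coev_at n X s) = s"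
  by (rule den_eqD[OF zigzag[of X]]; rule den_cong, (rule den_intros den_duals | simp)+)

lemma layer_zigzag_dual [rule_format]:
  "\<forall>n s. fits n [dual X] (fst s) \<longrightarrow> diagram s \<longrightarrow>
    ev_at n X (coev_at (Suc n) X s) = s"
  by (rule den_eqD[OF zigzag_dual[of X]]; rule den_cong, (rule den_intros den_duals | simp)+)

lemma layer_zigzag_t [rule_format]:
  "\<forall>n s. fits n [X] (fst s) \<longrightarrow> diagram s \<longrightarrow>
    evt_at n X (coevt_at (Suc n) X s) = s"
  by (rule den_eqD[OF zigzag_t[of X]]; rule den_cong, (rule den_intros den_duals | simp)+)

lemma layer_zigzag_t_dual [rule_format]:
  "\<forall>n s. fits n [dual X] (fst s) \<longrightarrow> diagram s \<longrightarrow>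
    evt_at (Suc n) X (coevt_at n X s) = s"
  by (rule den_eqD[OF zigzag_t_dual[of X]]; rule den_cong, (rule den_intros den_duals | simp)+)

lemmas layer_zigzags = layer_zigzag layer_zigzag_dual layer_zigzag_t layer_zigzag_t_dual

text \<open>The left partial trace, which closes the strand \<open>S\<close> of \<open>h\<close>.  Source and target are arguments because they
cannot be recovered from \<open>S \<bullet> X\<close> and \<open>S \<bullet> Z\<close>.\<close>

definition ptr :: "'a \<Rightarrow> 'a \<Rightarrow> 'a \<Rightarrow> 'b \<Rightarrow> 'b" where
  "ptr S X Z h = (ev S \<otimes> Ident Z) \<cdot> (Ident (dual S) \<otimes> h) \<cdot> (coevt S \<otimes> Ident X)"

lemma den_ptr:
  assumes h: "den h (S # w) (S # v) H" and X: "X = obj w" "Z = obj v"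
  shows "den (ptr S X Z h) w v (\<lambda>n s. ev_at n S (H (Suc n) (coevt_at n S s)))"
  unfolding ptr_def
  by (rule den_cong, (rule den_intros den_duals h den_Ident[OF X(1)] den_Ident[OF X(2)] | simp)+)

lemma ptr_in:
  assumes h: "h \<in> Hom (S \<bullet> X) (S \<bullet> Z)"
  shows "ptr S X Z h \<in> Hom X Z"
proof -
  have "box h [S, X] [S, Z]" by (rule den_box) (simp add: h)
  from den_in[OF den_ptr[OF this]] show ?thesis by simp
qed

lemma ptr_linear: "linear_map_on (smul C) (smul C) (Hom (S \<bullet> X) (S \<bullet> Z)) (Hom X Z) (ptr S X Z)"
proof -
  have t: "Ident (dual S) \<otimes> h \<in> Hom (dual S \<bullet> (S \<bullet> X)) (dual S \<bullet> (S \<bullet> Z))" if "h \<in> Hom (S \<bullet> X) (S \<bullet> Z)" for h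
    by (rule tens_in[OF Ident_in that])
  have e: "ev S \<otimes> Ident Z \<in> Hom (dual S \<bullet> (S \<bullet> Z)) Z" using tens_in[OF ev_in Ident_in, of S Z] by simp
  have c: "coevt S \<otimes> Ident X \<in> Hom X (dual S \<bullet> (S \<bullet> X))" using tens_in[OF coevt_in Ident_in, of S X] by simp
  note l = tens_linear_right[OF Ident_in[of "dual S"], of "S \<bullet> X" "S \<bullet> Z"]
  show ?thesis
    unfolding linear_map_on_def
  proof (intro conjI ballI allI)
    fix g h assume gh: "g \<in> Hom (S \<bullet> X) (S \<bullet> Z)" "h \<in> Hom (S \<bullet> X) (S \<bullet> Z)"
    have "Ident (dual S) \<otimes> (g + h) = (Ident (dual S) \<otimes> g) + (Ident (dual S) \<otimes> h)"
      using l gh unfolding linear_map_on_def by blast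
    then show "ptr S X Z (g + h) = ptr S X Z g + ptr S X Z h"
      unfolding ptr_def
      by (simp add: cmp_add_right[OF e t[OF gh(1)] t[OF gh(2)]]
        cmp_add_left[OF c cmp_in[OF t[OF gh(1)] e] cmp_in[OF t[OF gh(2)] e]])
  next
    fix a h assume h: "h \<in> Hom (S \<bullet> X) (S \<bullet> Z)"
    have "Ident (dual S) \<otimes> (a \<star> h) = a \<star> (Ident (dual S) \<otimes> h)"
      using l h unfolding linear_map_on_def by blast
    then show "ptr S X Z (a \<star> h) = a \<star> ptr S X Z h"
      unfolding ptr_def
      by (simp add: cmp_smul_right[OF e t[OF h]] cmp_smul_left[OF c cmp_in[OF t[OF h] e]])
  qed (rule ptr_in)
qed

lemma ptr_sum: "(\<And>a. a \<in> A \<Longrightarrow> h a \<in> Hom (S \<bullet> X) (S \<bullet> Z)) \<Longrightarrow> ptr S X Z (sum h A) = (\<Sum>a\<in>A. ptr S X Z (h a))"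
  by (rule linear_map_on_sum[OF ptr_linear])

lemma ptr_smul: "h \<in> Hom (S \<bullet> X) (S \<bullet> Z) \<Longrightarrow> ptr S X Z (a \<star> h) = a \<star> ptr S X Z h"
  using ptr_linear unfolding linear_map_on_def by blast

lemma ptr_natural:
  assumes h: "h \<in> Hom (S \<bullet> X) (S \<bullet> Z)" and u: "u \<in> Hom Z Z'" and v: "v \<in> Hom X' X"
  shows "ptr S X' Z' ((Ident S \<otimes> u) \<cdot> h \<cdot> (Ident S \<otimes> v)) = u \<cdot> ptr S X Z h \<cdot> v"
proof -
  have dh: "box h [S, X] [S, Z]" by (rule den_box) (simp add: h)
  have du: "box u [Z] [Z']" by (rule den_box) (simp add: u)
  have dv: "box v [X'] [X]" by (rule den_box) (simp add: v)
  show ?thesis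
    by (rule den_eqI[where w="[X']" and v="[Z']"], (rule den_ptr den_intros den_duals dh du dv | simp)+)
      (simp add: diagram_simps layer_interchange' h u v)
qed

lemma ptr_tens_Ident:
  assumes h: "h \<in> Hom (S \<bullet> X) (S \<bullet> Z)"
  shows "ptr S (X \<bullet> R) (Z \<bullet> R) (h \<otimes> Ident R) = ptr S X Z h \<otimes> Ident R"
proof -
  have dh: "box h [S, X] [S, Z]" by (rule den_box) (simp add: h)
  show ?thesis
    by (rule den_eqI[where w="[X, R]" and v="[Z, R]"], (rule den_ptr den_intros den_duals dh | simp)+)
qed

text \<open>The morphism \<open>a\<close> travels around the closed strand as its dual: passing the cap \<open>ev\<close> turns it into its left
dual, passing the cup \<open>coevt\<close> turns the right dual back into \<open>a\<close>, and the two duals agree.\<close>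

lemma ptr_cyclic:
  assumes a: "a \<in> Hom U T" and h: "h \<in> Hom (T \<bullet> X) (U \<bullet> Z)"
  shows "ptr T X Z ((a \<otimes> Ident Z) \<cdot> h) = ptr U X Z (h \<cdot> (a \<otimes> Ident X))"
proof -
  have dh: "box h [T, X] [U, Z]" by (rule den_box) (simp add: h)
  have da: "box a [U] [T]" by (rule den_box) (simp add: a)
  define a' where "a' = left_dual_mor C U T a"
  have a'r: "a' = right_dual_mor C U T a" using dual_mor_eq[OF a] by (simp add: a'_def)
  have dl: "den (left_dual_mor C U T a) [dual T] [dual U] (\<lambda>n s. ev_at n T (layer (Suc n) [U] a [T] (coev_at (Suc n) U s)))"
    unfolding left_dual_mor_def by (rule den_cong, (rule den_intros den_duals da | simp)+)
  have dr: "den (right_dual_mor C U T a) [dual T] [dual U] (\<lambda>n s. evt_at (Suc n) T (layer (Suc n) [U] a [T] (coevt_at n U s)))"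
    unfolding right_dual_mor_def by (rule den_cong, (rule den_intros den_duals da | simp)+)
  have a'in: "a' \<in> Hom (dual T) (dual U)" using den_in[OF dl] by (simp add: a'_def)
  have da': "box a' [dual T] [dual U]" by (rule den_box) (simp add: a'in)
  have 1: "ev T \<cdot> (Ident (dual T) \<otimes> a) = ev U \<cdot> (a' \<otimes> Ident U)"
    unfolding a'_def
    by (rule den_eqI[where w="[dual T, U]" and v="[]"], (rule dl den_intros den_duals da | simp)+)
      (simp add: diagram_simps layer_interchange' layer_zigzags a)
  have 2: "(Ident (dual U) \<otimes> a) \<cdot> coevt U = (a' \<otimes> Ident T) \<cdot> coevt T"
    unfolding a'r
    by (rule den_eqI[where w="[]" and v="[dual U, T]"], (rule dr den_intros den_duals da | simp)+)
      (simp add: diagram_simps layer_interchange layer_zigzags a)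
  have 1 [rule_format]: "\<forall>n s. fits n [dual T, U] (fst s) \<longrightarrow> diagram s \<longrightarrow>
      ev_at n T (layer (Suc n) [U] a [T] s) = ev_at n U (layer n [dual T] a' [dual U] s)"
    by (rule den_eqD[OF 1]; rule den_cong, (rule den_intros den_duals da da' | simp)+)
  have 2 [rule_format]: "\<forall>n s. fits n [] (fst s) \<longrightarrow> diagram s \<longrightarrow>
      layer (Suc n) [U] a [T] (coevt_at n U s) = layer n [dual T] a' [dual U] (coevt_at n T s)"
    by (rule den_eqD[OF 2]; rule den_cong, (rule den_intros den_duals da da' | simp)+)
  show ?thesis
    by (rule den_eqI[where w="[X]" and v="[Z]"], (rule den_ptr den_intros den_duals da dh | simp)+)
      (simp add: diagram_simps layer_interchange' 1 2 a a'in h)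
qed

text \<open>Closing off \<open>S \<bullet> R\<close> amounts to closing off \<open>S\<close> and then \<open>R\<close>.  The dual of \<open>S \<bullet> R\<close> is not
\<open>dual R \<bullet> dual S\<close>, but the comparison map between the two turns the nested evaluations into the evaluation of
\<open>S \<bullet> R\<close> because it comes from the left duals, and the nested coevaluations into the coevaluation because it
also comes from the right duals.\<close>

lemma ptr_tens:
  assumes h: "h \<in> Hom (S \<bullet> R \<bullet> X) (S \<bullet> R \<bullet> Z)"
  shows "ptr (S \<bullet> R) X Z h = ptr R X Z (ptr S (R \<bullet> X) (R \<bullet> Z) h)"
proof -
  let ?D = "dual (S \<bullet> R)"
  have dh: "box h [S, R, X] [S, R, Z]"
    by (rule den_box) (use h in simp)
  have e: "ev (S \<bullet> R) \<in> Hom (?D \<bullet> (S \<bullet> R)) \<one>" "coev (S \<bullet> R) \<in> Hom \<one> (S \<bullet> (R \<bullet> ?D))"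
      "evt (S \<bullet> R) \<in> Hom (S \<bullet> (R \<bullet> ?D)) \<one>" "coevt (S \<bullet> R) \<in> Hom \<one> (?D \<bullet> (S \<bullet> R))"
    using ev_in[of "S \<bullet> R"] coev_in[of "S \<bullet> R"] evt_in[of "S \<bullet> R"] coevt_in[of "S \<bullet> R"] by simp_all
  have dSR: "box (ev (S \<bullet> R)) [?D, S, R] []"
    "box (coev (S \<bullet> R)) [] [S, R, ?D]"
    "box (coevt (S \<bullet> R)) [] [?D, S, R]"
    by (rule den_box; use e in simp)+
  have zig [rule_format]: "\<forall>n s. fits n [S, R] (fst s) \<longrightarrow> diagram s \<longrightarrow>
      layer (Suc (Suc n)) [?D, S, R] (ev (S \<bullet> R)) [] (layer n [] (coev (S \<bullet> R)) [S, R, ?D] s) = s"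
    by (rule den_eqD[OF zigzag[of "S \<bullet> R"]]; rule den_cong, (rule dSR den_intros | simp)+)
  define g where "g = left_dual_tens C S R"
  have g_right: "g = right_dual_tens C S R" using dual_tens_eq[of S R] by (simp add: g_def)
  have dl: "den (left_dual_tens C S R) [dual R, dual S] [?D] (\<lambda>n s. ev_at n R
      (ev_at (Suc n) S (layer (Suc (Suc n)) [] (coev (S \<bullet> R)) [S, R, ?D] s)))"
    unfolding left_dual_tens_def by (rule den_cong, (rule dSR den_intros den_duals | simp)+)
  have dr: "den (right_dual_tens C S R) [dual R, dual S] [?D] (\<lambda>n s. evt_at (Suc n) S
      (evt_at (Suc (Suc n)) R (layer n [] (coevt (S \<bullet> R)) [?D, S, R] s)))"
    unfolding right_dual_tens_def by (rule den_cong, (rule dSR den_intros den_duals | simp)+)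
  have g: "g \<in> Hom (dual R \<bullet> dual S) ?D" using den_in[OF dl] by (simp add: g_def)
  have dg: "box g [dual R, dual S] [?D]" by (rule den_box) (simp add: g)
  have 1: "ev (S \<bullet> R) \<cdot> (g \<otimes> Ident (S \<bullet> R)) = ev R \<cdot> (Ident (dual R) \<otimes> ev S \<otimes> Ident R)"
    unfolding g_def
    by (rule den_eqI[where w="[dual R, dual S, S, R]" and v="[]"], (rule dl dSR den_intros den_duals | simp)+)
      (simp add: diagram_simps layer_interchange' zig e)
  have 2: "coevt (S \<bullet> R) = (g \<otimes> Ident (S \<bullet> R)) \<cdot> (Ident (dual R) \<otimes> coevt S \<otimes> Ident R) \<cdot> coevt R"
    unfolding g_right
    by (rule den_eqI[where w="[]" and v="[?D, S, R]"], (rule dr dSR den_intros den_duals | simp)+)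
      (simp add: diagram_simps layer_interchange layer_zigzags e)
  have 1 [rule_format]: "\<forall>n s. fits n [dual R, dual S, S, R] (fst s) \<longrightarrow> diagram s \<longrightarrow>
      layer n [?D, S, R] (ev (S \<bullet> R)) [] (layer n [dual R, dual S] g [?D] s)
      = ev_at n R (ev_at (Suc n) S s)"
    by (rule den_eqD[OF 1]; rule den_cong, (rule dSR dg den_intros den_duals | simp)+)
  have 2 [rule_format]: "\<forall>n s. fits n [] (fst s) \<longrightarrow> diagram s \<longrightarrow>
      layer n [] (coevt (S \<bullet> R)) [?D, S, R] s = layer n [dual R, dual S] g [?D]
      (coevt_at (Suc n) S (coevt_at n R s))"
    by (rule den_eqD[OF 2]; rule den_cong, (rule dSR dg den_intros den_duals | simp)+)
  have dptr: "den (ptr S (R \<bullet> X) (R \<bullet> Z) h) [R, X] [R, Z]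
      (\<lambda>n s. ev_at n S (layer (Suc n) [S, R, X] h [S, R, Z] (coevt_at n S s)))"
    by (rule den_ptr[OF dh]) simp_all
  have "den (ptr (S \<bullet> R) X Z h) [X] [Z] (\<lambda>n s. layer n [?D, S, R] (ev (S \<bullet> R)) []
      (layer (Suc n) [S, R, X] h [S, R, Z] (layer n [] (coevt (S \<bullet> R)) [?D, S, R] s)))"
    unfolding ptr_def by (rule den_cong, (rule dSR dh den_intros | simp)+)
  moreover have "den (ptr R X Z (ptr S (R \<bullet> X) (R \<bullet> Z) h)) [X] [Z] (\<lambda>n s. ev_at n R
      (ev_at (Suc n) S (layer (Suc (Suc n)) [S, R, X] h [S, R, Z]
        (coevt_at (Suc n) S (coevt_at n R s)))))"
    by (rule den_ptr[OF dptr]) simp_all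
  ultimately show ?thesis
  proof (rule den_eqI)
    fix s assume s: "diagram s" "fst s = [X]"
    let ?c = "coevt_at (Suc 0) S (coevt_at 0 R s)"
    have h': "h \<in> Hom (S \<bullet> (R \<bullet> X)) (S \<bullet> (R \<bullet> Z))" using h by simp
    have "layer (Suc 0) [S, R, X] h [S, R, Z] (layer 0 [dual R, dual S] g [?D] ?c)
        = layer 0 [dual R, dual S] g [?D] (layer (Suc (Suc 0)) [S, R, X] h [S, R, Z] ?c)"
      by (subst layer_interchange') (simp_all add: diagram_simps h' g s)
    then show "layer 0 [?D, S, R] (ev (S \<bullet> R)) [] (layer (Suc 0) [S, R, X] h [S, R, Z] (layer 0 [] (coevt (S \<bullet> R)) [?D, S, R] s))
      = ev_at 0 R (ev_at (Suc 0) S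
          (layer (Suc (Suc 0)) [S, R, X] h [S, R, Z] ?c))"
      by (simp add: 1 2 diagram_simps h' g s)
  qed
qed

lemma ptr_unit:
  assumes h: "h \<in> Hom X Z"
  shows "ptr \<one> X Z h = h"
proof -
  have e: "ev \<one> \<in> Hom (dual \<one>) \<one>" "coevt \<one> \<in> Hom \<one> (dual \<one>)"
    using ev_in[of \<one>] coevt_in[of \<one>] by simp_all
  have d: "box (ev \<one>) [dual \<one>] []"
    "box (coevt \<one>) [] [dual \<one>]"
    by (rule den_box; simp add: e)+
  have dh: "box h [X] [Z]" by (rule den_box) (simp add: h)
  have 1: "ev \<one> \<cdot> coevt \<one> = Ident \<one>"
    using zigzag[of \<one>] e by (simp add: dual_unit_eq unit_tens[OF e(1)] tens_unit[OF e(2)])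
  have 1 [rule_format]: "\<forall>n s. fits n [] (fst s) \<longrightarrow> diagram s \<longrightarrow>
      layer n [dual \<one>] (ev \<one>) [] (layer n [] (coevt \<one>) [dual \<one>] s) = s"
    by (rule den_eqD[OF 1]; rule den_cong, (rule d den_intros | simp)+)
  have "den (ptr \<one> X Z h) [X] [Z] (\<lambda>n s. layer n [dual \<one>] (ev \<one>) [] (layer (Suc n) [X] h [Z] (layer n [] (coevt \<one>) [dual \<one>] s)))"
    unfolding ptr_def by (rule den_cong, (rule d dh den_intros | simp)+)
  from this dh show ?thesis
    by (rule den_eqI) (simp add: diagram_simps layer_interchange' 1 h e)
qed

definition left_trace :: "'a \<Rightarrow> 'b \<Rightarrow> 'b" where
  "left_trace X f = ptr X \<one> \<one> f"

definition right_trace :: "'a \<Rightarrow> 'b \<Rightarrow> 'b" where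
  "right_trace X f = evt X \<cdot> (f \<otimes> Ident (dual X)) \<cdot> coev X"

lemma left_trace_in: "f \<in> Hom X X \<Longrightarrow> left_trace X f \<in> Hom \<one> \<one>"
  unfolding left_trace_def by (rule ptr_in) simp

lemma den_left_trace:
  assumes "den f [X] [X] F"
  shows "den (left_trace X f) [] [] (\<lambda>n s. ev_at n X (F (Suc n) (coevt_at n X s)))"
  unfolding left_trace_def using den_ptr[of f X "[]" "[]" F] assms by simp

lemma den_right_trace:
  assumes F: "den f [X] [X] F"
  shows "den (right_trace X f) [] [] (\<lambda>n s. evt_at n X (F n (coev_at n X s)))"
  unfolding right_trace_def by (rule den_cong, (rule den_intros den_duals F | simp)+)

lemma left_trace_cyclic:
  assumes a: "a \<in> Hom U T" and b: "b \<in> Hom T U"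
  shows "left_trace T (a \<cdot> b) = left_trace U (b \<cdot> a)"
  using ptr_cyclic[OF a, of b \<one> \<one>] tens_unit[OF a] b by (simp add: left_trace_def)

lemma left_trace_tens:
  assumes "f \<in> Hom (S \<bullet> R) (S \<bullet> R)"
  shows "left_trace (S \<bullet> R) f = left_trace R (ptr S R R f)"
  using ptr_tens[of f S R \<one> \<one>] assms by (simp add: left_trace_def)

end

section \<open>Half-braidings\<close>

context monoidal_linear_category
begin

text \<open>The pairs of an object \<open>Z\<close> and a half-braiding on \<open>Z\<close> are the objects of the Drinfeld centre.\<close>

definition half_braiding :: "'a \<Rightarrow> ('a \<Rightarrow> 'b) \<Rightarrow> bool" where
  "half_braiding Z e \<longleftrightarrow>
     (\<forall>X. is_iso C (X \<bullet> Z) (Z \<bullet> X) (e X)) \<and>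
     (\<forall>X X'. \<forall>f\<in>Hom X X'. e X' \<cdot> (f \<otimes> Ident Z) = (Ident Z \<otimes> f) \<cdot> e X) \<and>
     (\<forall>X Y. e (X \<bullet> Y) = (e X \<otimes> Ident Y) \<cdot> (Ident X \<otimes> e Y))"

definition hb_inv :: "'a \<Rightarrow> ('a \<Rightarrow> 'b) \<Rightarrow> 'a \<Rightarrow> 'b" where
  "hb_inv Z e X = iso_inv C (X \<bullet> Z) (Z \<bullet> X) (e X)"

lemma iso_tens:
  assumes "is_iso C X Y f" "is_iso C X' Y' f'"
  shows "is_iso C (X \<bullet> X') (Y \<bullet> Y') (f \<otimes> f')"
proof -
  obtain g g' where f: "f \<in> Hom X Y" "g \<in> Hom Y X" "g \<cdot> f = Ident X" "f \<cdot> g = Ident Y"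
    and f': "f' \<in> Hom X' Y'" "g' \<in> Hom Y' X'" "g' \<cdot> f' = Ident X'" "f' \<cdot> g' = Ident Y'"
    using assms unfolding is_iso_def by blast
  have "(g \<otimes> g') \<cdot> (f \<otimes> f') = Ident (X \<bullet> X')"
    using tens_cmp[OF f(1,2) f'(1,2)] f(3) f'(3) tens_Ident by simp
  moreover have "(f \<otimes> f') \<cdot> (g \<otimes> g') = Ident (Y \<bullet> Y')"
    using tens_cmp[OF f(2,1) f'(2,1)] f(4) f'(4) tens_Ident by simp
  ultimately show ?thesis
    unfolding is_iso_def using tens_in[OF f(1) f'(1)] tens_in[OF f(2) f'(2)] by blast
qed

lemma iso_eqI:
  assumes "is_iso C Y Z e" "f \<in> Hom X Y" "g \<in> Hom X Y" "e \<cdot> f = e \<cdot> g"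
  shows "f = g"
proof -
  obtain i where i: "e \<in> Hom Y Z" "i \<in> Hom Z Y" "i \<cdot> e = Ident Y"
    using assms(1) unfolding is_iso_def by blast
  have "f = i \<cdot> (e \<cdot> f)" using cmp_assoc[OF assms(2) i(1,2)] i(3) Ident_cmp[OF assms(2)] by simp
  also have "\<dots> = g" using cmp_assoc[OF assms(3) i(1,2)] i(3) Ident_cmp[OF assms(3)] assms(4) by simp
  finally show ?thesis .
qed

context
  fixes Z e
  assumes hb: "half_braiding Z e"
begin

lemma hb_iso: "is_iso C (X \<bullet> Z) (Z \<bullet> X) (e X)"
  and hb_natural: "f \<in> Hom X X' \<Longrightarrow> e X' \<cdot> (f \<otimes> Ident Z) = (Ident Z \<otimes> f) \<cdot> e X"
  and hb_tens: "e (X \<bullet> Y) = (e X \<otimes> Ident Y) \<cdot> (Ident X \<otimes> e Y)"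
  using hb by (simp_all only: half_braiding_def)

lemma hb_in: "e X \<in> Hom (X \<bullet> Z) (Z \<bullet> X)"
  using hb_iso by (simp add: is_iso_def)

lemma hb_inv_in: "hb_inv Z e X \<in> Hom (Z \<bullet> X) (X \<bullet> Z)"
  and hb_inv_left: "hb_inv Z e X \<cdot> e X = Ident (X \<bullet> Z)"
  and hb_inv_right: "e X \<cdot> hb_inv Z e X = Ident (Z \<bullet> X)"
  unfolding hb_inv_def by (rule iso_inv_props[OF hb_iso])+

lemma den_hb: "box (e X) [X, Z] [Z, X]"
  and den_hb_inv: "box (hb_inv Z e X) [Z, X] [X, Z]"
  by (rule den_box; simp add: hb_in hb_inv_in)+

lemma layer_hb_inv_left [rule_format]:
  "\<forall>n s. fits n [X, Z] (fst s) \<longrightarrow> diagram s \<longrightarrow>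
    layer n [Z, X] (hb_inv Z e X) [X, Z] (layer n [X, Z] (e X) [Z, X] s) = s"
  by (rule den_eqD[OF hb_inv_left[of X]]; rule den_cong, (rule den_intros den_hb den_hb_inv | simp)+)

lemma layer_hb_inv_right [rule_format]:
  "\<forall>n s. fits n [Z, X] (fst s) \<longrightarrow> diagram s \<longrightarrow>
    layer n [X, Z] (e X) [Z, X] (layer n [Z, X] (hb_inv Z e X) [X, Z] s) = s"
  by (rule den_eqD[OF hb_inv_right[of X]]; rule den_cong, (rule den_intros den_hb den_hb_inv | simp)+)

lemmas layer_hb_inverse = layer_hb_inv_left layer_hb_inv_right

lemma den_hb_tens: "den (e (X \<bullet> Y)) [X, Y, Z] [Z, X, Y]
    (\<lambda>n s. layer n [X, Z] (e X) [Z, X] (layer (Suc n) [Y, Z] (e Y) [Z, Y] s))"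
  unfolding hb_tens by (rule den_cong, (rule den_intros den_hb | simp)+)

lemma hb_inv_tens: "hb_inv Z e (X \<bullet> Y) = (Ident X \<otimes> hb_inv Z e Y) \<cdot> (hb_inv Z e X \<otimes> Ident Y)"
  (is "_ = ?g")
proof -
  have d: "den ?g [Z, X, Y] [X, Y, Z]
      (\<lambda>n s. layer (Suc n) [Z, Y] (hb_inv Z e Y) [Y, Z] (layer n [Z, X] (hb_inv Z e X) [X, Z] s))"
    by (rule den_cong, (rule den_intros den_hb_inv | simp)+)
  have g: "?g \<in> Hom (Z \<bullet> (X \<bullet> Y)) ((X \<bullet> Y) \<bullet> Z)" using den_in[OF d] by simp
  have "?g \<cdot> e (X \<bullet> Y) = Ident ((X \<bullet> Y) \<bullet> Z)"
    by (rule den_eqI[where w="[X, Y, Z]" and v="[X, Y, Z]"], (rule d den_hb_tens den_intros | simp)+)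
      (simp add: diagram_simps layer_hb_inverse hb_in hb_inv_in)
  moreover have "e (X \<bullet> Y) \<cdot> ?g = Ident (Z \<bullet> (X \<bullet> Y))"
    by (rule den_eqI[where w="[Z, X, Y]" and v="[Z, X, Y]"], (rule d den_hb_tens den_intros | simp)+)
      (simp add: diagram_simps layer_hb_inverse hb_in hb_inv_in)
  ultimately show ?thesis
    unfolding hb_inv_def[of Z e "X \<bullet> Y"] using iso_inv_eq[OF hb_in g] by simp
qed

lemma hb_inv_natural:
  assumes f: "f \<in> Hom X X'"
  shows "(f \<otimes> Ident Z) \<cdot> hb_inv Z e X = hb_inv Z e X' \<cdot> (Ident Z \<otimes> f)"
proof -
  have df: "box f [X] [X']" by (rule den_box) (simp add: f)
  have 1 [rule_format]: "\<forall>n s. fits n [X, Z] (fst s) \<longrightarrow> diagram s \<longrightarrow>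
      layer n [X', Z] (e X') [Z, X'] (layer n [X] f [X'] s) = layer (Suc n) [X] f [X'] (layer n [X, Z] (e X) [Z, X] s)"
    by (rule den_eqD[OF hb_natural[OF f]]; rule den_cong, (rule den_intros df den_hb | simp)+)
  have "(f \<otimes> Ident Z) \<cdot> hb_inv Z e X
      = hb_inv Z e X' \<cdot> (e X' \<cdot> (f \<otimes> Ident Z)) \<cdot> hb_inv Z e X"
    by (rule den_eqI[where w="[Z, X]" and v="[X', Z]"], (rule den_intros df den_hb den_hb_inv | simp)+)
      (simp add: diagram_simps layer_hb_inverse hb_in hb_inv_in f)
  also have "\<dots> = hb_inv Z e X' \<cdot> (Ident Z \<otimes> f)"
    by (rule den_eqI[where w="[Z, X]" and v="[X', Z]"], (rule den_intros df den_hb den_hb_inv | simp)+)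
      (simp add: diagram_simps layer_hb_inverse hb_in hb_inv_in f 1)
  finally show ?thesis .
qed

text \<open>By the product rule \<open>e \<one>\<close> is its own square, and it is invertible.\<close>

lemma hb_unit: "e \<one> = Ident Z"
proof -
  have e: "e \<one> \<in> Hom Z Z" using hb_in[of \<one>] by simp
  have "is_iso C Z Z (e \<one>)" using hb_iso[of \<one>] by simp
  moreover have "e \<one> \<cdot> e \<one> = e \<one> \<cdot> Ident Z"
    using hb_tens[of \<one> \<one>] by (simp add: tens_unit[OF e] unit_tens[OF e] cmp_Ident[OF e])
  ultimately show ?thesis using iso_eqI[OF _ e Ident_in] by blast
qed

lemma hb_inv_unit: "hb_inv Z e \<one> = Ident Z"
  unfolding hb_inv_def using iso_inv_eq[of "Ident Z" Z Z "Ident Z"] Ident_in cmp_Ident[OF Ident_in]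
  by (simp add: hb_unit)

end

end

context pivotal_linear_category
begin

context
  fixes Z e
  assumes hb: "half_braiding Z e"
begin

lemmas hb_simps = hb_in[OF hb] hb_inv_in[OF hb]
lemmas den_hbs = den_hb[OF hb] den_hb_inv[OF hb]

text \<open>Pulling \<open>Z\<close> across a cap or a cup: the half-braiding is natural with respect to \<open>ev S\<close> and
  \<open>coevt S\<close>, and it is trivial on the unit object.\<close>

lemma hb_ev: "(Ident Z \<otimes> ev S) \<cdot> (e (dual S) \<otimes> Ident S) = (ev S \<otimes> Ident Z) \<cdot> (Ident (dual S) \<otimes> hb_inv Z e S)"
proof -
  have n: "(Ident Z \<otimes> ev S) \<cdot> e (dual S \<bullet> S) = ev S \<otimes> Ident Z"
    using hb_natural[OF hb ev_in, of S] hb_unit[OF hb] Ident_cmp[OF tens_in[OF ev_in Ident_in], of Z S] by simp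
  have 1 [rule_format]: "\<forall>n s. fits n [dual S, S, Z] (fst s) \<longrightarrow> diagram s \<longrightarrow>
      ev_at (Suc n) S (layer n [dual S, Z] (e (dual S)) [Z, dual S]
      (layer (Suc n) [S, Z] (e S) [Z, S] s)) = ev_at n S s"
    by (rule den_eqD[OF n]; rule den_cong, (rule den_hb_tens[OF hb] den_duals den_intros | simp)+)
  have "(Ident Z \<otimes> ev S) \<cdot> (e (dual S) \<otimes> Ident S)
      = ((Ident Z \<otimes> ev S) \<cdot> (e (dual S) \<otimes> Ident S) \<cdot> (Ident (dual S) \<otimes> e S)) \<cdot> (Ident (dual S) \<otimes> hb_inv Z e S)"
    by (rule den_eqI[where w="[dual S, Z, S]" and v="[Z]"], (rule den_hbs den_duals den_intros | simp)+)
      (simp add: diagram_simps layer_hb_inverse[OF hb] hb_simps)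
  also have "\<dots> = (ev S \<otimes> Ident Z) \<cdot> (Ident (dual S) \<otimes> hb_inv Z e S)"
    by (rule den_eqI[where w="[dual S, Z, S]" and v="[Z]"], (rule den_hbs den_duals den_intros | simp)+)
      (simp add: diagram_simps hb_simps 1)
  finally show ?thesis .
qed

lemma hb_coevt: "(Ident (dual S) \<otimes> e S) \<cdot> (coevt S \<otimes> Ident Z) = (hb_inv Z e (dual S) \<otimes> Ident S) \<cdot> (Ident Z \<otimes> coevt S)"
proof -
  have n: "e (dual S \<bullet> S) \<cdot> (coevt S \<otimes> Ident Z) = Ident Z \<otimes> coevt S"
    using hb_natural[OF hb coevt_in, of S] hb_unit[OF hb] cmp_Ident[OF tens_in[OF Ident_in coevt_in], of Z S] by simp
  have 1 [rule_format]: "\<forall>n s. fits n [Z] (fst s) \<longrightarrow> diagram s \<longrightarrow>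
      layer n [dual S, Z] (e (dual S)) [Z, dual S] (layer (Suc n) [S, Z] (e S) [Z, S]
      (coevt_at n S s)) = coevt_at (Suc n) S s"
    by (rule den_eqD[OF n]; rule den_cong, (rule den_hb_tens[OF hb] den_duals den_intros | simp)+)
  have "(Ident (dual S) \<otimes> e S) \<cdot> (coevt S \<otimes> Ident Z)
      = (hb_inv Z e (dual S) \<otimes> Ident S) \<cdot> ((e (dual S) \<otimes> Ident S) \<cdot> (Ident (dual S) \<otimes> e S) \<cdot> (coevt S \<otimes> Ident Z))"
    by (rule den_eqI[where w="[Z]" and v="[dual S, Z, S]"], (rule den_hbs den_duals den_intros | simp)+)
      (simp add: diagram_simps layer_hb_inverse[OF hb] hb_simps)
  also have "\<dots> = (hb_inv Z e (dual S) \<otimes> Ident S) \<cdot> (Ident Z \<otimes> coevt S)"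
    by (rule den_eqI[where w="[Z]" and v="[dual S, Z, S]"], (rule den_hbs den_duals den_intros | simp)+)
      (simp add: diagram_simps 1 hb_simps)
  finally show ?thesis .
qed

lemma layer_hb_ev [rule_format]:
  "\<forall>n s. fits n [dual S, Z, S] (fst s) \<longrightarrow> diagram s \<longrightarrow>
    ev_at n S (layer (Suc n) [Z, S] (hb_inv Z e S) [S, Z] s)
    = ev_at (Suc n) S (layer n [dual S, Z] (e (dual S)) [Z, dual S] s)"
  by (rule den_eqD[OF hb_ev[of S, symmetric]]; rule den_cong, (rule den_hbs den_duals den_intros | simp)+)

lemma layer_hb_coevt [rule_format]:
  "\<forall>n s. fits n [Z] (fst s) \<longrightarrow> diagram s \<longrightarrow>
    layer (Suc n) [S, Z] (e S) [Z, S] (coevt_at n S s)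
    = layer n [Z, dual S] (hb_inv Z e (dual S)) [dual S, Z] (coevt_at (Suc n) S s)"
  by (rule den_eqD[OF hb_coevt[of S]]; rule den_cong, (rule den_hbs den_duals den_intros | simp)+)

text \<open>A closed strand \<open>S\<close> that passes \<open>Z\<close> on the way out and on the way back can be pulled off \<open>Z\<close>.\<close>

lemma ptr_hb_conjugate:
  assumes h: "h \<in> Hom (S \<bullet> X) (S \<bullet> Y)"
  shows "ptr S (Z \<bullet> X) (Z \<bullet> Y) ((hb_inv Z e S \<otimes> Ident Y) \<cdot> (Ident Z \<otimes> h) \<cdot> (e S \<otimes> Ident X)) = Ident Z \<otimes> ptr S X Y h"
proof -
  have dh: "box h [S, X] [S, Y]" by (rule den_box) (simp add: h)
  show ?thesis
    by (rule den_eqI[where w="[Z, X]" and v="[Z, Y]"], (rule den_ptr den_hbs dh den_duals den_intros | simp)+)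
      (simp add: diagram_simps layer_hb_ev layer_hb_coevt layer_interchange' layer_hb_inverse[OF hb] hb_simps h)
qed

end

end

context braided_linear_category
begin

lemma braid_in [simp]: "braid X Y \<in> Hom (X \<bullet> Y) (Y \<bullet> X)"
  using braid_iso by (simp add: is_iso_def)

lemma half_braiding_braid: "half_braiding Z (\<lambda>X. braid X Z)"
  unfolding half_braiding_def
  using braid_iso braid_natural[OF _ Ident_in] braid_tens_left by blast

lemma inv_braid_in [simp]: "inv_braid C X Y \<in> Hom (Y \<bullet> X) (X \<bullet> Y)"
  and inv_braid_left: "inv_braid C X Y \<cdot> braid X Y = Ident (X \<bullet> Y)"
  and inv_braid_right: "braid X Y \<cdot> inv_braid C X Y = Ident (Y \<bullet> X)"
  unfolding inv_braid_def by (rule iso_inv_props[OF braid_iso])+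

abbreviation "braid_at n X Y \<equiv> layer n [X, Y] (braid X Y) [Y, X]"
abbreviation "inv_braid_at n X Y \<equiv> layer n [Y, X] (inv_braid C X Y) [X, Y]"

lemma den_braid: "box (braid X Y) [X, Y] [Y, X]"
  and den_inv_braid: "box (inv_braid C X Y) [Y, X] [X, Y]"
  by (rule den_box; simp)+

lemmas den_braids = den_braid den_inv_braid

lemma layer_inv_braid_left [rule_format]:
  "\<forall>n s. fits n [X, Y] (fst s) \<longrightarrow> diagram s \<longrightarrow>
    inv_braid_at n X Y (braid_at n X Y s) = s"
  by (rule den_eqD[OF inv_braid_left[of X Y]]; rule den_cong, (rule den_intros den_braids | simp)+)

lemma layer_inv_braid_right [rule_format]:
  "\<forall>n s. fits n [Y, X] (fst s) \<longrightarrow> diagram s \<longrightarrow>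
    braid_at n X Y (inv_braid_at n X Y s) = s"
  by (rule den_eqD[OF inv_braid_right[of X Y]]; rule den_cong, (rule den_intros den_braids | simp)+)

lemmas layer_inv_braid = layer_inv_braid_left layer_inv_braid_right

lemma half_braiding_inv_braid: "half_braiding Z (\<lambda>X. inv_braid C Z X)"
  unfolding half_braiding_def
proof (intro conjI allI ballI)
  show "is_iso C (X \<bullet> Z) (Z \<bullet> X) (inv_braid C Z X)" for X
    unfolding inv_braid_def by (rule is_iso_inv[OF braid_iso])
  show "inv_braid C Z X' \<cdot> (f \<otimes> Ident Z) = (Ident Z \<otimes> f) \<cdot> inv_braid C Z X" if f: "f \<in> Hom X X'" for X X' f
  proof -
    have df: "box f [X] [X']" by (rule den_box) (simp add: f)
    have 1 [rule_format]: "\<forall>n s. fits n [Z, X] (fst s) \<longrightarrow> diagram s \<longrightarrow>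
      layer n [X] f [X'] (braid_at n Z X s) = layer n [Z, X'] (braid Z X') [X', Z] (layer (Suc n) [X] f [X'] s)"
    by (rule den_eqD[OF braid_natural[OF Ident_in[of Z] f, symmetric]]; rule den_cong, (rule den_intros df den_braids | simp)+)
    have "inv_braid C Z X' \<cdot> (f \<otimes> Ident Z) = inv_braid C Z X' \<cdot> (f \<otimes> Ident Z) \<cdot> (braid Z X \<cdot> inv_braid C Z X)"
      by (rule den_eqI[where w="[X, Z]" and v="[Z, X']"], (rule den_intros df den_braids | simp)+)
        (simp add: diagram_simps layer_inv_braid f)
    also have "\<dots> = (Ident Z \<otimes> f) \<cdot> inv_braid C Z X"
      by (rule den_eqI[where w="[X, Z]" and v="[Z, X']"], (rule den_intros df den_braids | simp)+)
        (simp add: diagram_simps layer_inv_braid_left f 1)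
    finally show ?thesis .
  qed
  show "inv_braid C Z (X \<bullet> Y) = (inv_braid C Z X \<otimes> Ident Y) \<cdot> (Ident X \<otimes> inv_braid C Z Y)" (is "_ = ?g") for X Y
  proof -
    have d: "den ?g [X, Y, Z] [Z, X, Y]
        (\<lambda>n s. inv_braid_at n Z X (inv_braid_at (Suc n) Z Y s))"
      by (rule den_cong, (rule den_intros den_braids | simp)+)
    have b: "den (braid Z (X \<bullet> Y)) [Z, X, Y] [X, Y, Z]
        (\<lambda>n s. braid_at (Suc n) Z Y (braid_at n Z X s))"
      unfolding braid_tens_right by (rule den_cong, (rule den_intros den_braids | simp)+)
    have g: "?g \<in> Hom ((X \<bullet> Y) \<bullet> Z) (Z \<bullet> (X \<bullet> Y))" using den_in[OF d] by simp
    have "?g \<cdot> braid Z (X \<bullet> Y) = Ident (Z \<bullet> (X \<bullet> Y))"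
      by (rule den_eqI[where w="[Z, X, Y]" and v="[Z, X, Y]"], (rule d b den_intros | simp)+)
        (simp add: diagram_simps layer_inv_braid)
    moreover have "braid Z (X \<bullet> Y) \<cdot> ?g = Ident ((X \<bullet> Y) \<bullet> Z)"
      by (rule den_eqI[where w="[X, Y, Z]" and v="[X, Y, Z]"], (rule d b den_intros | simp)+)
        (simp add: diagram_simps layer_inv_braid)
    ultimately show ?thesis
      unfolding inv_braid_def[of C Z "X \<bullet> Y"] using iso_inv_eq[OF braid_in g] by simp
  qed
qed

lemma hb_inv_inv_braid: "hb_inv Z (\<lambda>X. inv_braid C Z X) S = braid Z S"
  unfolding hb_inv_def by (rule iso_inv_eq) (simp_all add: inv_braid_left inv_braid_right)

lemma hb_inv_braid: "hb_inv Z (\<lambda>X. braid X Z) S = inv_braid C S Z"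
  by (simp add: hb_inv_def inv_braid_def)

lemma braid_unit_left: "braid \<one> Z = Ident Z"
  by (rule hb_unit[OF half_braiding_braid])

lemma braid_unit_right: "braid Z \<one> = Ident Z"
  using hb_inv_unit[OF half_braiding_inv_braid, of Z] hb_inv_inv_braid[of Z \<one>] by simp

end

context monoidal_linear_category
begin

text \<open>This is the tensor product of the Drinfeld centre.\<close>

lemma half_braiding_tens:
  assumes e: "half_braiding I e" and f: "half_braiding J f"
  shows "half_braiding (I \<bullet> J) (\<lambda>X. (Ident I \<otimes> f X) \<cdot> (e X \<otimes> Ident J))"
  unfolding half_braiding_def
proof (intro conjI allI ballI)
  note hbs = hb_in[OF e] hb_in[OF f] and dens = den_hb[OF e] den_hb[OF f] den_intros
  show "is_iso C (X \<bullet> (I \<bullet> J)) (I \<bullet> J \<bullet> X) ((Ident I \<otimes> f X) \<cdot> (e X \<otimes> Ident J))" for X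
    using iso_cmp[OF iso_tens[OF hb_iso[OF e, of X] iso_Ident[of J]]] iso_tens[OF iso_Ident[of I] hb_iso[OF f, of X]] by simp
  show "(Ident I \<otimes> f X') \<cdot> (e X' \<otimes> Ident J) \<cdot> (g \<otimes> Ident (I \<bullet> J))
      = (Ident (I \<bullet> J) \<otimes> g) \<cdot> ((Ident I \<otimes> f X) \<cdot> (e X \<otimes> Ident J))" if g: "g \<in> Hom X X'" for X X' g
  proof -
    have dg: "box g [X] [X']" by (rule den_box) (simp add: g)
    have 1 [rule_format]: "\<forall>n s. fits n [X, I] (fst s) \<longrightarrow> diagram s \<longrightarrow>
      layer n [X', I] (e X') [I, X'] (layer n [X] g [X'] s) = layer (Suc n) [X] g [X'] (layer n [X, I] (e X) [I, X] s)"
    by (rule den_eqD[OF hb_natural[OF e g]]; rule den_cong, (rule dg dens | simp)+)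
    have 2 [rule_format]: "\<forall>n s. fits n [X, J] (fst s) \<longrightarrow> diagram s \<longrightarrow>
      layer n [X', J] (f X') [J, X'] (layer n [X] g [X'] s) = layer (Suc n) [X] g [X'] (layer n [X, J] (f X) [J, X] s)"
    by (rule den_eqD[OF hb_natural[OF f g]]; rule den_cong, (rule dg dens | simp)+)
    show ?thesis
      by (rule den_eqI[where w="[X, I, J]" and v="[I, J, X']"], (rule dg dens | simp)+)
        (simp add: diagram_simps 1 2 hbs)
  qed
  show "(Ident I \<otimes> f (X \<bullet> Y)) \<cdot> (e (X \<bullet> Y) \<otimes> Ident J)
      = (((Ident I \<otimes> f X) \<cdot> (e X \<otimes> Ident J)) \<otimes> Ident Y) \<cdot> (Ident X \<otimes> ((Ident I \<otimes> f Y) \<cdot> (e Y \<otimes> Ident J)))" for X Y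
    by (rule den_eqI[where w="[X, Y, I, J]" and v="[I, J, X, Y]"],
        (rule den_hb_tens[OF e] den_hb_tens[OF f] dens | simp)+)
      (simp add: diagram_simps layer_interchange' hbs)
qed

end

section \<open>Left and right traces agree\<close>

context ribbon_linear_category
begin

text \<open>The twist is the partial trace of the braiding.  Naturality of the braiding and \<open>ptr_cyclic\<close> move \<open>f\<close>
twice through the crossing and once around the closed strand.\<close>

lemma twist_commutes:
  assumes f: "f \<in> Hom X X"
  shows "f \<cdot> right_twist C X = right_twist C X \<cdot> f"
proof -
  let ?c = "braid X X" and ?p = "ptr X X X"
  have p: "right_twist C X = ?p ?c" by (simp add: right_twist_def ptr_def)
  have If: "Ident X \<otimes> f \<in> Hom (X \<bullet> X) (X \<bullet> X)"
    using tens_in[OF Ident_in f] .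
  have "f \<cdot> ?p ?c = ?p ((Ident X \<otimes> f) \<cdot> ?c)"
    using ptr_natural[OF braid_in[of X X] f Ident_in[of X]] cmp_Ident[OF cmp_in[OF ptr_in[OF braid_in[of X X]] f]]
      cmp_Ident[OF cmp_in[OF braid_in[of X X] If]] by (simp add: tens_Ident)
  also have "\<dots> = ?p (?c \<cdot> (f \<otimes> Ident X))" by (simp add: braid_natural[OF f Ident_in])
  also have "\<dots> = ?p ((f \<otimes> Ident X) \<cdot> ?c)" by (rule ptr_cyclic[OF f braid_in, symmetric])
  also have "\<dots> = ?p (?c \<cdot> (Ident X \<otimes> f))" by (simp add: braid_natural[OF Ident_in f])
  also have "\<dots> = ?p ?c \<cdot> f"
    using ptr_natural[OF braid_in[of X X] Ident_in[of X] f] Ident_cmp[OF ptr_in[OF braid_in[of X X]]]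
      Ident_cmp[OF braid_in[of X X]] by (simp add: tens_Ident)
  finally show ?thesis by (simp add: p)
qed

text \<open>The left and the right duality differ by the braiding and the twist, and the twist cancels
  because it commutes with \<open>f\<close>.\<close>

lemma right_trace_eq_left_trace:
  assumes f: "f \<in> Hom X X"
  shows "right_trace X f = left_trace X f"
proof -
  let ?D = "dual X" and ?t = "right_twist C X"
  note dens = den_duals den_braids den_intros
  have a: "ev_at n X (braid_at (Suc n) X X s)
      = ev_at (Suc n) X (inv_braid_at n X ?D s)"
    if "fits n [?D, X, X] (fst s)" "diagram s" for n s
    using layer_hb_ev[OF half_braiding_inv_braid that] by (simp add: hb_inv_inv_braid)
  have dl: "den (left_twist C X) [X] [X] (\<lambda>n s. evt_at (Suc n) X (braid_at n X X
      (coev_at (Suc n) X s)))"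
    unfolding left_twist_def by (rule den_cong, (rule dens | simp)+)
  have dr: "den (right_twist C X) [X] [X] (\<lambda>n s. ev_at n X (braid_at (Suc n) X X
      (coevt_at n X s)))"
    unfolding right_twist_def by (rule den_cong, (rule dens | simp)+)
  have t: "?t \<in> Hom X X" using den_in[OF dr] by simp
  have dt: "box ?t [X] [X]" by (rule den_box) (simp add: t)
  have df: "box f [X] [X]" by (rule den_box) (simp add: f)
  \<comment> \<open>By \<open>a\<close> a crossing moves past the cap; then the curl of the twist cancels against the braiding.\<close>
  have A: "evt X = ev X \<cdot> (Ident ?D \<otimes> left_twist C X) \<cdot> braid X ?D"
    by (rule den_eqI[where w="[X, ?D]" and v="[]"], (rule dl dens | simp)+)
      (simp add: diagram_simps layer_interchange layer_zigzags layer_inv_braid a)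
  have B: "coevt X = braid X ?D \<cdot> (?t \<otimes> Ident ?D) \<cdot> coev X"
    by (rule den_eqI[where w="[]" and v="[?D, X]"], (rule dr dens | simp)+)
      (simp add: diagram_simps layer_interchange layer_zigzags layer_inv_braid a)
  have N [rule_format]: "\<forall>n s. fits n [X, ?D] (fst s) \<longrightarrow> diagram s \<longrightarrow>
      braid_at n X ?D (layer n [X] g [X] s) = layer (Suc n) [X] g [X] (braid_at n X ?D s)"
    if g: "g \<in> Hom X X" for g
  proof -
    have dg: "box g [X] [X]" by (rule den_box) (simp add: g)
    show ?thesis
      by (rule den_eqD[OF braid_natural[OF g Ident_in[of ?D]]]; rule den_cong, (rule dg dens | simp)+)
  qed
  have "right_trace X f = ev X \<cdot> (Ident ?D \<otimes> ?t) \<cdot> braid X ?D \<cdot> (f \<otimes> Ident ?D) \<cdot> coev X"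
    unfolding right_trace_def A by (simp add: twist_eq)
  also have "\<dots> = ev X \<cdot> (Ident ?D \<otimes> (?t \<cdot> f)) \<cdot> braid X ?D \<cdot> coev X"
    by (rule den_eqI[where w="[]" and v="[]"], (rule dt df dens | simp)+)
      (simp add: diagram_simps N f t)
  also have "\<dots> = ev X \<cdot> (Ident ?D \<otimes> (f \<cdot> ?t)) \<cdot> braid X ?D \<cdot> coev X"
    by (simp add: twist_commutes[OF f])
  also have "\<dots> = ev X \<cdot> (Ident ?D \<otimes> f) \<cdot> (braid X ?D \<cdot> (?t \<otimes> Ident ?D) \<cdot> coev X)"
    by (rule den_eqI[where w="[]" and v="[]"], (rule dt df dens | simp)+)
      (simp add: diagram_simps N f t)
  also have "\<dots> = ev X \<cdot> (Ident ?D \<otimes> f) \<cdot> coevt X"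
    by (simp only: B[symmetric])
  also have "\<dots> = left_trace X f"
    unfolding left_trace_def ptr_def using tens_unit[OF ev_in] tens_unit[OF coevt_in] by simp
  finally show ?thesis .
qed

end

section \<open>Dimensions and sliding over a handle\<close>

lemma linear_map_on_compose:
  assumes "linear_map_on r s U V f" "linear_map_on s t V W g"
  shows "linear_map_on r t U W (\<lambda>x. g (f x))"
  using assms unfolding linear_map_on_def by simp

context linear_category
begin

lemma linear_map_on_eq_span:
  assumes F: "linear_map_on (smul C) (smul C) (Hom X Y) V F" and G: "linear_map_on (smul C) (smul C) (Hom X Y) V G"
    and B: "finite B" "vs.span B = Hom X Y" and eq: "\<And>b. b \<in> B \<Longrightarrow> F b = G b" and x: "x \<in> Hom X Y"
  shows "F x = G x"
proof -
  have "x \<in> range (\<lambda>u. \<Sum>b\<in>B. u b \<star> b)" using x B by (simp add: vs.span_finite)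
  then obtain u where u: "x = (\<Sum>b\<in>B. u b \<star> b)" by blast
  have b: "b \<in> Hom X Y" if "b \<in> B" for b using vs.span_base[OF that] B by simp
  have "F x = (\<Sum>b\<in>B. F (u b \<star> b))" unfolding u by (rule linear_map_on_sum[OF F]) (rule Hom_smul[OF b])
  also have "\<dots> = (\<Sum>b\<in>B. G (u b \<star> b))"
    using F G b eq unfolding linear_map_on_def by (intro sum.cong) auto
  also have "\<dots> = G x" unfolding u by (rule linear_map_on_sum[OF G, symmetric]) (rule Hom_smul[OF b])
  finally show ?thesis .
qed

end

context monoidal_linear_category
begin

lemma tens_zero_left: "g \<in> Hom Y Y' \<Longrightarrow> 0 \<otimes> g = 0"
  using linear_map_on_sum[OF tens_linear_left, of g Y Y' "{}" "\<lambda>_. 0" \<one> \<one>] by simp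

lemma tens_smul_left: "f \<in> Hom X X' \<Longrightarrow> g \<in> Hom Y Y' \<Longrightarrow> (a \<star> f) \<otimes> g = a \<star> (f \<otimes> g)"
  using tens_linear_left unfolding linear_map_on_def by blast

lemma tens_smul_right: "f \<in> Hom X X' \<Longrightarrow> g \<in> Hom Y Y' \<Longrightarrow> f \<otimes> (a \<star> g) = a \<star> (f \<otimes> g)"
  using tens_linear_right unfolding linear_map_on_def by blast

end

context pivotal_linear_category
begin

text \<open>The strands \<open>S\<close> and \<open>R\<close> are closed on opposite sides, so the order does not matter.  The right partial
trace of \<open>g\<close> is thereby controlled by left partial traces alone.\<close>

lemma left_trace_right_ptr:
  assumes g: "g \<in> Hom (S \<bullet> R) (S \<bullet> R)"
  shows "left_trace S ((Ident S \<otimes> evt R) \<cdot> (g \<otimes> Ident (dual R)) \<cdot> (Ident S \<otimes> coev R)) = right_trace R (ptr S R R g)"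
proof -
  have dg: "box g [S, R] [S, R]" by (rule den_box) (simp add: g)
  show ?thesis
    by (rule den_eqI[where w="[]" and v="[]"], (rule den_left_trace den_right_trace den_ptr dg den_duals den_intros | simp)+)
      (simp add: diagram_simps layer_interchange' g)
qed

end

context modular_tensor_category
begin

lemma tr_eq:
  assumes f: "f \<in> Hom X X"
  shows "left_trace X f = tr C X f \<star> Ident \<one>"
proof -
  obtain a where a: "left_trace X f = a \<star> Ident \<one>" using End_scalar[OF unit_in_Irr left_trace_in[OF f]] by blast
  have "tr C X f = a"
    unfolding tr_def right_trace_def[symmetric]
    using a right_trace_eq_left_trace[OF f] smul_Ident_inject[OF unit_simple] by auto
  then show ?thesis using a by simp
qed

lemma tr_eqI: "f \<in> Hom X X \<Longrightarrow> left_trace X f = a \<star> Ident \<one> \<Longrightarrow> tr C X f = a"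
  using tr_eq smul_Ident_inject[OF unit_simple] by metis

lemma tr_smul: "f \<in> Hom X X \<Longrightarrow> tr C X (a \<star> f) = a * tr C X f"
  by (rule tr_eqI) (simp_all add: Hom_smul left_trace_def ptr_smul tr_eq[unfolded left_trace_def])

lemma tr_add: "f \<in> Hom X X \<Longrightarrow> g \<in> Hom X X \<Longrightarrow> tr C X (f + g) = tr C X f + tr C X g"
  using ptr_linear[of X \<one> \<one>]
  by (intro tr_eqI) (simp_all add: Hom_add left_trace_def tr_eq[unfolded left_trace_def, symmetric] vs.scale_left_distrib linear_map_on_def)

lemma tr_cyclic: "a \<in> Hom U T \<Longrightarrow> b \<in> Hom T U \<Longrightarrow> tr C T (a \<cdot> b) = tr C U (b \<cdot> a)"
  using tr_eqI[of "a \<cdot> b" T] left_trace_cyclic[of a U T b] tr_eq[of "b \<cdot> a" U] cmp_in[of b T U a T] cmp_in[of a U T b U]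
  by simp

lemma tr_tens: "f \<in> Hom (S \<bullet> R) (S \<bullet> R) \<Longrightarrow> tr C (S \<bullet> R) f = tr C R (ptr S R R f)"
  using tr_eqI[of f "S \<bullet> R"] left_trace_tens[of f S R] tr_eq[of "ptr S R R f" R] ptr_in[of f S R R] by simp

lemma tr_smul_Ident: "tr C X (a \<star> Ident X) = a * dm C X"
  by (simp add: dm_def tr_smul Ident_in)

lemma dm_unit: "dm C \<one> = 1"
  unfolding dm_def by (rule tr_eqI) (simp_all add: Ident_in left_trace_def ptr_unit)

lemma coev_nonzero:
  assumes "S \<in> Irr"
  shows "coev S \<noteq> 0"
proof
  assume "coev S = 0"
  then have "Ident S = (Ident S \<otimes> ev S) \<cdot> 0"
    using zigzag[of S] tens_zero_left[OF Ident_in] by simp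
  moreover have "Ident S \<otimes> ev S \<in> Hom (S \<bullet> (dual S \<bullet> S)) S"
    using tens_in[OF Ident_in[of S] ev_in[of S]] by simp
  ultimately show False using cmp_zero_right Irr_nonzero[OF assms] by simp
qed

text \<open>By semisimplicity the nonzero map \<open>coev S\<close> has a left inverse up to a scalar, and every map
  \<open>S \<bullet> dual S \<rightarrow> \<one>\<close> is a multiple of \<open>evt S\<close>.\<close>

lemma dm_nonzero:
  assumes S: "S \<in> Irr"
  shows "dm C S \<noteq> 0"
proof
  assume d: "dm C S = 0"
  let ?X = "S \<bullet> dual S"
  have "right_trace S (Ident S) = 0" using tr_eq[OF Ident_in[of S]] right_trace_eq_left_trace[OF Ident_in[of S]] d by (simp add: dm_def)
  then have ec: "evt S \<cdot> coev S = 0"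
    by (simp add: right_trace_def tens_Ident cmp_Ident[OF evt_in, simplified])
  have r0: "r \<cdot> coev S = 0" if r: "r \<in> Hom ?X \<one>" for r
  proof -
    let ?r = "(r \<otimes> Ident S) \<cdot> (Ident S \<otimes> coevt S)"
    have dr: "box r [S, dual S] []" by (rule den_box) (simp add: r)
    have d': "den ?r [S] [S] (\<lambda>n s. layer n [S, dual S] r [] (coevt_at (Suc n) S s))"
      by (rule den_cong, (rule dr den_duals den_intros | simp)+)
    have "r = evt S \<cdot> (?r \<otimes> Ident (dual S))"
      by (rule den_eqI[where w="[S, dual S]" and v="[]"], (rule d' dr den_duals den_intros | simp)+)
        (simp add: diagram_simps layer_interchange' layer_zigzags r)
    moreover obtain c where "?r = c \<star> Ident S"
      using End_scalar[OF S] den_in[OF d'] by auto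
    ultimately have "r = c \<star> evt S"
      using cmp_Ident[OF evt_in] cmp_smul_right[OF evt_in Ident_in]
      by (simp add: tens_smul_left[OF Ident_in Ident_in] tens_Ident)
    then show ?thesis using ec cmp_smul_left[OF coev_in evt_in] by simp
  qed
  have "coev S = (\<Sum>T\<in>Irr. \<Sum>b\<in>basis T ?X. b \<cdot> cobasis T ?X b \<cdot> coev S)"
    using linear_map_on_Ident[OF cmp_linear_left[OF coev_in]] Ident_cmp[OF coev_in] by simp
  also have "\<dots> = 0"
  proof (intro sum.neutral ballI)
    fix T b assume T: "T \<in> Irr" and b: "b \<in> basis T ?X"
    have "cobasis T ?X b \<cdot> coev S = 0"
    proof (cases "T = \<one>")
      case True
      then show ?thesis using r0 cobasis_in[OF T b] by simp
    next
      case False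
      then show ?thesis using Hom_Irr_zero[OF unit_in_Irr T] cmp_in[OF coev_in cobasis_in[OF T b]] by blast
    qed
    then show "b \<cdot> cobasis T ?X b \<cdot> coev S = 0"
      using cmp_assoc[OF coev_in cobasis_in[OF T b] basis_in[OF T b]] cmp_zero_right[OF basis_in[OF T b]] by simp
  qed
  finally show False using coev_nonzero[OF S] by simp
qed

text \<open>Rotating \<open>R\<close> identifies \<open>Hom T (S \<bullet> R)\<close> with \<open>Hom (T \<bullet> dual R) S\<close>.  Dual bases go to dual
  bases up to the factor \<open>d(T) / d(S)\<close>, because rotation preserves traces of composites but the
  trace of an identity is its dimension.  This gives a resolution of the identity of
  \<open>T \<bullet> dual R\<close>.\<close>

lemma rotated_basis_complete:
  assumes T: "T \<in> Irr"
  shows "(\<Sum>S\<in>Irr. \<Sum>b\<in>basis T (S \<bullet> R). (dm C S / dm C T) \<star>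
      ((cobasis T (S \<bullet> R) b \<otimes> Ident (dual R)) \<cdot> (Ident S \<otimes> coev R) \<cdot> ((Ident S \<otimes> evt R) \<cdot> (b \<otimes> Ident (dual R)))))
    = Ident (T \<bullet> dual R)"
proof -
  let ?D = "dual R" and ?X = "T \<bullet> dual R"
  define up where "up S b = (Ident S \<otimes> evt R) \<cdot> (b \<otimes> Ident ?D)" for S b
  define dn where "dn S c = (c \<otimes> Ident ?D) \<cdot> (Ident S \<otimes> coev R)" for S c
  have evt': "Ident S \<otimes> evt R \<in> Hom ((S \<bullet> R) \<bullet> ?D) S" and coev': "Ident S \<otimes> coev R \<in> Hom S ((S \<bullet> R) \<bullet> ?D)" for S
    using tens_in[OF Ident_in[of S] evt_in[of R]] tens_in[OF Ident_in[of S] coev_in[of R]] by simp_all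
  have up: "up S b \<in> Hom ?X S" if "b \<in> Hom T (S \<bullet> R)" for S b
    unfolding up_def by (rule cmp_in[OF tens_in[OF that Ident_in] evt'])
  have dn: "dn S c \<in> Hom S ?X" if "c \<in> Hom (S \<bullet> R) T" for S c
    unfolding dn_def by (rule cmp_in[OF coev' tens_in[OF that Ident_in]])
  have dn_linear: "linear_map_on (smul C) (smul C) (Hom (S \<bullet> R) T) (Hom S ?X) (dn S)" for S
    unfolding dn_def by (rule linear_map_on_compose[OF tens_linear_left[OF Ident_in] cmp_linear_left[OF coev']])
  have updn: "up S b \<cdot> dn S' (cobasis T (S' \<bullet> R) b') = (if S = S' \<and> b = b' then (dm C T / dm C S) \<star> Ident S else 0)"
    if S: "S \<in> Irr" "S' \<in> Irr" and b: "b \<in> basis T (S \<bullet> R)" "b' \<in> basis T (S' \<bullet> R)" for S S' b b'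
  proof (cases "S = S'")
    case False
    then show ?thesis
      using Hom_Irr_zero[OF S(2,1)] cmp_in[OF dn[OF cobasis_in[OF T b(2)]] up[OF basis_in[OF T b(1)]]] by auto
  next
    case True
    let ?c = "cobasis T (S \<bullet> R) b'"
    have b': "b \<in> Hom T (S \<bullet> R)" and c: "?c \<in> Hom (S \<bullet> R) T" using basis_in[OF T b(1)] cobasis_in[OF T] b(2) True by auto
    have bc: "b \<cdot> ?c \<in> Hom (S \<bullet> R) (S \<bullet> R)" by (rule cmp_in[OF c b'])
    have db: "box b [T] [S, R]" and dc: "box ?c [S, R] [T]"
      by (rule den_box; use b' c in simp)+
    have eq: "up S b \<cdot> dn S ?c = (Ident S \<otimes> evt R) \<cdot> ((b \<cdot> ?c) \<otimes> Ident ?D) \<cdot> (Ident S \<otimes> coev R)"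
      unfolding up_def dn_def
      by (rule den_eqI[where w="[S]" and v="[S]"], (rule db dc den_duals den_intros | simp)+)
    have x: "up S b \<cdot> dn S ?c \<in> Hom S S" using cmp_in[OF dn[OF c] up[OF b']] .
    then obtain a where a: "up S b \<cdot> dn S ?c = a \<star> Ident S" using End_scalar[OF S(1)] by blast
    have "left_trace S (up S b \<cdot> dn S ?c) = left_trace R (ptr S R R (b \<cdot> ?c))"
      unfolding eq using left_trace_right_ptr[OF bc] right_trace_eq_left_trace[OF ptr_in[OF bc]] by simp
    then have "tr C S (up S b \<cdot> dn S ?c) = tr C R (ptr S R R (b \<cdot> ?c))"
      using tr_eq[OF x] tr_eq[OF ptr_in[OF bc]] smul_Ident_inject[OF unit_simple] by simp
    also have "\<dots> = tr C (S \<bullet> R) (b \<cdot> ?c)" using tr_tens[OF bc] by simp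
    also have "\<dots> = tr C T (?c \<cdot> b)" by (rule tr_cyclic[OF b' c])
    also have "\<dots> = (if b = b' then dm C T else 0)"
      using cobasis_basis[OF T b(1), of b'] b(2) True tr_smul_Ident[of T 0] by (simp add: dm_def)
    finally have "a * dm C S = (if b = b' then dm C T else 0)" using a tr_smul_Ident by simp
    then have "a = (if b = b' then dm C T / dm C S else 0)"
      using dm_nonzero[OF S(1)] by (auto simp: field_simps)
    then show ?thesis using a True by simp
  qed
  let ?L = "\<Sum>S\<in>Irr. \<Sum>b\<in>basis T (S \<bullet> R). (dm C S / dm C T) \<star> (dn S (cobasis T (S \<bullet> R) b) \<cdot> up S b)"
  have in1: "(dm C S / dm C T) \<star> (dn S (cobasis T (S \<bullet> R) b) \<cdot> up S b) \<in> Hom ?X ?X" if "b \<in> basis T (S \<bullet> R)" for S b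
    by (rule Hom_smul[OF cmp_in[OF up[OF basis_in[OF T that]] dn[OF cobasis_in[OF T that]]]])
  have in2: "(\<Sum>b\<in>basis T (S \<bullet> R). (dm C S / dm C T) \<star> (dn S (cobasis T (S \<bullet> R) b) \<cdot> up S b)) \<in> Hom ?X ?X" for S
    by (rule Hom_sum[OF in1])
  have L: "?L \<in> Hom ?X ?X" by (rule Hom_sum[OF in2])
  have "?L = Ident ?X"
  proof (rule Irr_separating[OF L Ident_in])
    fix S' i assume S': "S' \<in> Irr" and i: "i \<in> Hom S' ?X"
    \<comment> \<open>Rotating \<open>i\<close> back shows that it is the rotation of some \<open>a : S' \<bullet> R \<rightarrow> T\<close>.\<close>
    let ?a = "(Ident T \<otimes> ev R) \<cdot> (i \<otimes> Ident R)"
    have di: "box i [S'] [T, ?D]" by (rule den_box) (simp add: i)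
    have da: "den ?a [S', R] [T] (\<lambda>n s. ev_at (Suc n) R (layer n [S'] i [T, ?D] s))"
      by (rule den_cong, (rule di den_duals den_intros | simp)+)
    have a: "?a \<in> Hom (S' \<bullet> R) T" using den_in[OF da] by simp
    have i_eq: "i = dn S' ?a"
      unfolding dn_def
      by (rule den_eqI[where w="[S']" and v="[T, ?D]"], (rule da di den_duals den_intros | simp)+)
        (simp add: diagram_simps layer_interchange layer_zigzags i)
    have "?L \<cdot> dn S' c = dn S' c" if c: "c \<in> cobasis T (S' \<bullet> R) ` basis T (S' \<bullet> R)" for c
    proof -
      obtain b' where b': "b' \<in> basis T (S' \<bullet> R)" "c = cobasis T (S' \<bullet> R) b'" using c by blast
      have dc: "dn S' c \<in> Hom S' ?X" using dn[OF cobasis_in[OF T b'(1)]] b'(2) by simp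
      have summand: "((dm C S / dm C T) \<star> (dn S (cobasis T (S \<bullet> R) b) \<cdot> up S b)) \<cdot> dn S' c
          = (if S = S' \<and> b = b' then dn S' c else 0)" if S: "S \<in> Irr" and b: "b \<in> basis T (S \<bullet> R)" for S b
      proof -
        note ub = up[OF basis_in[OF T b]] and db = dn[OF cobasis_in[OF T b]]
        have "((dm C S / dm C T) \<star> (dn S (cobasis T (S \<bullet> R) b) \<cdot> up S b)) \<cdot> dn S' c
            = (dm C S / dm C T) \<star> (dn S (cobasis T (S \<bullet> R) b) \<cdot> (up S b \<cdot> dn S' c))"
          by (simp add: cmp_smul_left[OF dc cmp_in[OF ub db]] cmp_assoc[OF dc ub db])
        also have "\<dots> = (if S = S' \<and> b = b' then dn S' c else 0)"
        proof (cases "S = S' \<and> b = b'")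
          case True
          then have *: "up S b \<cdot> dn S' c = (dm C T / dm C S) \<star> Ident S" and c: "dn S' c = dn S (cobasis T (S \<bullet> R) b)"
            using updn[OF S S' b b'(1)] b'(2) by auto
          have "(dm C S / dm C T) \<star> (dn S (cobasis T (S \<bullet> R) b) \<cdot> (up S b \<cdot> dn S' c)) = dn S (cobasis T (S \<bullet> R) b)"
            unfolding * cmp_smul_Ident[OF db] using dm_nonzero[OF S] dm_nonzero[OF T] by simp
          then show ?thesis using True c by simp
        next
          case False
          then have "up S b \<cdot> dn S' c = 0" using updn[OF S S' b b'(1)] b'(2) by (simp only: if_False)
          then show ?thesis using False cmp_zero_right[OF db] by (simp only: if_False vs.scale_zero_right)
        qed
        finally show ?thesis .
      qed
      have "?L \<cdot> dn S' c = (\<Sum>S\<in>Irr. \<Sum>b\<in>basis T (S \<bullet> R).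
          ((dm C S / dm C T) \<star> (dn S (cobasis T (S \<bullet> R) b) \<cdot> up S b)) \<cdot> dn S' c)"
        by (simp add: cmp_sum_left[OF dc, where Z="?X"] in1 in2)
      also have "\<dots> = (\<Sum>S\<in>Irr. \<Sum>b\<in>basis T (S \<bullet> R). if S = S' \<and> b = b' then dn S' c else 0)"
        by (intro sum.cong refl summand)
      also have "\<dots> = (\<Sum>S\<in>Irr. if S = S' then dn S' c else 0)"
        using b'(1) finite_basis[OF T] by (intro sum.cong refl) (auto simp: if_distrib)
      also have "\<dots> = dn S' c" using S' finite_Irr by simp
      finally show ?thesis .
    qed
    from linear_map_on_eq_span[OF linear_map_on_compose[OF dn_linear cmp_linear_right[OF L]] dn_linear
        finite_imageI[OF finite_basis[OF T]] span_cobasis[OF T] this a]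
    show "?L \<cdot> i = Ident ?X \<cdot> i"
      using i_eq Ident_cmp[OF i] by simp
  qed
  then show ?thesis by (simp only: up_def dn_def)
qed

text \<open>The resolution of the identity of \<open>T \<bullet> dual R\<close> is inserted next to the closed strand of \<open>ptr R X Z h\<close>.
After rotating back, \<open>T\<close> splits into \<open>S \<bullet> R\<close> below \<open>h\<close> and the two strands fuse again above \<open>h\<close>.\<close>

lemma handle_slide:
  assumes T: "T \<in> Irr" and h: "h \<in> Hom (R \<bullet> X) (R \<bullet> Z)"
  shows "(\<Sum>S\<in>Irr. \<Sum>b\<in>basis T (S \<bullet> R). dm C S \<star> ((cobasis T (S \<bullet> R) b \<otimes> Ident Z) \<cdot> (Ident S \<otimes> h) \<cdot> (b \<otimes> Ident X)))
    = dm C T \<star> (Ident T \<otimes> ptr R X Z h)"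
proof -
  let ?D = "dual R" and ?E = "T \<bullet> dual R"
  define up where "up S b = (Ident S \<otimes> evt R) \<cdot> (b \<otimes> Ident ?D)" for S b
  define dn where "dn S c = (c \<otimes> Ident ?D) \<cdot> (Ident S \<otimes> coev R)" for S c
  \<comment> \<open>\<open>K x\<close> is the right-hand side with \<open>x\<close> in place of the identity of \<open>T \<bullet> dual R\<close>.\<close>
  define K where "K x = (Ident T \<otimes> ev R \<otimes> Ident Z) \<cdot> (x \<otimes> h) \<cdot> (Ident T \<otimes> coevt R \<otimes> Ident X)" for x
  have dh: "box h [R, X] [R, Z]" by (rule den_box) (simp add: h)
  have e: "Ident T \<otimes> ev R \<otimes> Ident Z \<in> Hom (?E \<bullet> (R \<bullet> Z)) (T \<bullet> Z)"
    using tens_in[OF tens_in[OF Ident_in[of T] ev_in[of R]] Ident_in[of Z]] by simp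
  have c: "Ident T \<otimes> coevt R \<otimes> Ident X \<in> Hom (T \<bullet> X) (?E \<bullet> (R \<bullet> X))"
    using tens_in[OF tens_in[OF Ident_in[of T] coevt_in[of R]] Ident_in[of X]] by simp
  have K: "linear_map_on (smul C) (smul C) (Hom ?E ?E) (Hom (T \<bullet> X) (T \<bullet> Z)) K"
    unfolding K_def by (rule linear_map_on_compose[OF linear_map_on_compose[OF tens_linear_left[OF h] cmp_linear_right[OF e]] cmp_linear_left[OF c]])
  have K_Ident: "K (Ident ?E) = Ident T \<otimes> ptr R X Z h"
    unfolding K_def
    by (rule den_eqI[where w="[T, X]" and v="[T, Z]"], (rule den_ptr dh den_duals den_intros | simp)+)
  have in1: "dn S (cobasis T (S \<bullet> R) b) \<cdot> up S b \<in> Hom ?E ?E"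
    and K1: "K (dn S (cobasis T (S \<bullet> R) b) \<cdot> up S b)
      = (cobasis T (S \<bullet> R) b \<otimes> Ident Z) \<cdot> (Ident S \<otimes> h) \<cdot> (b \<otimes> Ident X)" if b: "b \<in> basis T (S \<bullet> R)" for S b
  proof -
    let ?c = "cobasis T (S \<bullet> R) b"
    have b': "b \<in> Hom T (S \<bullet> R)" and c': "?c \<in> Hom (S \<bullet> R) T" using basis_in[OF T b] cobasis_in[OF T b] by auto
    have db: "box b [T] [S, R]" and dc: "box ?c [S, R] [T]"
      by (rule den_box; use b' c' in simp)+
    have u: "den (up S b) [T, ?D] [S] (\<lambda>n s. evt_at (Suc n) R (layer n [T] b [S, R] s))"
      unfolding up_def by (rule den_cong, (rule db den_duals den_intros | simp)+)
    have d: "den (dn S ?c) [S] [T, ?D] (\<lambda>n s. layer n [S, R] ?c [T] (coev_at (Suc n) R s))"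
      unfolding dn_def by (rule den_cong, (rule dc den_duals den_intros | simp)+)
    have uin: "up S b \<in> Hom ?E S" and din: "dn S ?c \<in> Hom S ?E" using den_in[OF u] den_in[OF d] by simp_all
    show "dn S ?c \<cdot> up S b \<in> Hom ?E ?E" by (rule cmp_in[OF uin din])
    have du: "box (up S b) [T, ?D] [S]"
      and dd: "box (dn S ?c) [S] [T, ?D]"
      by (rule den_box; use uin din in simp)+
    have 1: "(Ident T \<otimes> ev R) \<cdot> (dn S ?c \<otimes> Ident R) = ?c"
      by (rule den_eqI[where w="[S, R]" and v="[T]"], (rule d dc den_duals den_intros | simp)+)
        (simp add: diagram_simps layer_interchange' layer_zigzags c')
    have 2: "(up S b \<otimes> Ident R) \<cdot> (Ident T \<otimes> coevt R) = b"
      by (rule den_eqI[where w="[T]" and v="[S, R]"], (rule u db den_duals den_intros | simp)+)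
        (simp add: diagram_simps layer_interchange layer_zigzags b')
    have 1 [rule_format]: "\<forall>n s. fits n [S, R] (fst s) \<longrightarrow> diagram s \<longrightarrow>
        ev_at (Suc n) R (layer n [S] (dn S ?c) [T, ?D] s) = layer n [S, R] ?c [T] s"
      by (rule den_eqD[OF 1]; rule den_cong, (rule dd dc den_duals den_intros | simp)+)
    have 2 [rule_format]: "\<forall>n s. fits n [T] (fst s) \<longrightarrow> diagram s \<longrightarrow>
        layer n [T, ?D] (up S b) [S] (coevt_at (Suc n) R s) = layer n [T] b [S, R] s"
      by (rule den_eqD[OF 2]; rule den_cong, (rule du db den_duals den_intros | simp)+)
    have 3: "layer 0 [T, ?D] (up S b) [S] (layer (Suc (Suc 0)) [R, X] h [R, Z] (coevt_at (Suc 0) R s))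
        = layer (Suc 0) [R, X] h [R, Z] (layer 0 [T] b [S, R] s)" if "diagram s" "fst s = [T, X]" for s
      by (subst layer_interchange) (use that in \<open>simp_all add: diagram_simps uin h 2\<close>)
    show "K (dn S ?c \<cdot> up S b) = (?c \<otimes> Ident Z) \<cdot> (Ident S \<otimes> h) \<cdot> (b \<otimes> Ident X)"
      unfolding K_def
      by (rule den_eqI[where w="[T, X]" and v="[T, Z]"], (rule du dd db dc dh den_duals den_intros | simp)+)
        (simp add: diagram_simps uin din h b' c' 1 3)
  qed
  have K_smul: "K (a \<star> x) = a \<star> K x" if "x \<in> Hom ?E ?E" for a x
    using K that unfolding linear_map_on_def by blast
  have "Ident T \<otimes> ptr R X Z h = K (\<Sum>S\<in>Irr. \<Sum>b\<in>basis T (S \<bullet> R). (dm C S / dm C T) \<star> (dn S (cobasis T (S \<bullet> R) b) \<cdot> up S b))"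
    using rotated_basis_complete[OF T, of R] K_Ident by (simp add: up_def dn_def)
  also have "\<dots> = (\<Sum>S\<in>Irr. \<Sum>b\<in>basis T (S \<bullet> R). (dm C S / dm C T) \<star>
      ((cobasis T (S \<bullet> R) b \<otimes> Ident Z) \<cdot> (Ident S \<otimes> h) \<cdot> (b \<otimes> Ident X)))"
    by (subst linear_map_on_sum[OF K], intro Hom_sum Hom_smul in1, assumption, rule sum.cong[OF refl],
      subst linear_map_on_sum[OF K], intro Hom_smul in1, assumption, rule sum.cong[OF refl])
      (simp add: K_smul in1 K1)
  finally show ?thesis
    using dm_nonzero[OF T] by (simp add: vs.scale_sum_right)
qed

end

section \<open>Closed loops and modularity\<close>

context braided_linear_category
begin

lemma den_braid_tens_left: "den (braid (X \<bullet> Y) Z) [X, Y, Z] [Z, X, Y]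
    (\<lambda>n s. braid_at n X Z (braid_at (Suc n) Y Z s))"
  unfolding braid_tens_left by (rule den_cong, (rule den_braids den_intros | simp)+)

lemma den_braid_tens_right: "den (braid Z (X \<bullet> Y)) [Z, X, Y] [X, Y, Z]
    (\<lambda>n s. braid_at (Suc n) Z Y (braid_at n Z X s))"
  unfolding braid_tens_right by (rule den_cong, (rule den_braids den_intros | simp)+)

definition double_braid :: "'a \<Rightarrow> 'a \<Rightarrow> 'b" where
  "double_braid S W = braid W S \<cdot> braid S W"

lemma den_double_braid_braids: "den (double_braid S W) [S, W] [S, W]
    (\<lambda>n s. braid_at n W S (braid_at n S W s))"
  unfolding double_braid_def by (rule den_cong, (rule den_braids den_intros | simp)+)

lemma double_braid_in [simp]: "double_braid S W \<in> Hom (S \<bullet> W) (S \<bullet> W)"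
  using den_in[OF den_double_braid_braids] by simp

lemma den_double_braid: "box (double_braid S W) [S, W] [S, W]"
  by (rule den_box) simp

lemma double_braid_natural:
  assumes f: "f \<in> Hom S S'" and g: "g \<in> Hom W W'"
  shows "double_braid S' W' \<cdot> (f \<otimes> g) = (f \<otimes> g) \<cdot> double_braid S W"
proof -
  have fg: "f \<otimes> g \<in> Hom (S \<bullet> W) (S' \<bullet> W')" and gf: "g \<otimes> f \<in> Hom (W \<bullet> S) (W' \<bullet> S')"
    using tens_in[OF f g] tens_in[OF g f] .
  have "double_braid S' W' \<cdot> (f \<otimes> g) = braid W' S' \<cdot> (braid S' W' \<cdot> (f \<otimes> g))"
    unfolding double_braid_def by (rule cmp_assoc[OF fg braid_in braid_in, symmetric])
  also have "\<dots> = braid W' S' \<cdot> (g \<otimes> f) \<cdot> braid S W"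
    by (simp only: braid_natural[OF f g] cmp_assoc[OF braid_in gf braid_in])
  also have "\<dots> = (f \<otimes> g) \<cdot> double_braid S W"
    by (simp only: braid_natural[OF g f] double_braid_def cmp_assoc[OF braid_in braid_in fg])
  finally show ?thesis .
qed

lemma double_braid_tens_left: "double_braid (Y \<bullet> S) T = (Ident Y \<otimes> braid T S) \<cdot> (double_braid Y T \<otimes> Ident S) \<cdot> (Ident Y \<otimes> braid S T)"
  unfolding double_braid_def[of "Y \<bullet> S" T]
  by (rule den_eqI[where w="[Y, S, T]" and v="[Y, S, T]"],
    (rule den_braid_tens_left den_braid_tens_right den_double_braid_braids den_braids den_intros | simp)+)

lemma double_braid_tens_right: "double_braid S (I \<bullet> W) = (braid I S \<otimes> Ident W) \<cdot> (Ident I \<otimes> double_braid S W) \<cdot> (braid S I \<otimes> Ident W)"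
  unfolding double_braid_def[of S "I \<bullet> W"]
  by (rule den_eqI[where w="[S, I, W]" and v="[S, I, W]"],
    (rule den_braid_tens_left den_braid_tens_right den_double_braid_braids den_braids den_intros | simp)+)

end

context ribbon_linear_category
begin

definition loop :: "'a \<Rightarrow> 'a \<Rightarrow> 'b" where
  "loop S W = ptr S W W (double_braid S W)"

lemma loop_in: "loop S W \<in> Hom W W"
  unfolding loop_def by (rule ptr_in) simp

lemma loop_natural:
  assumes f: "f \<in> Hom W W'"
  shows "loop S W' \<cdot> f = f \<cdot> loop S W"
proof -
  have If: "Ident S \<otimes> f \<in> Hom (S \<bullet> W) (S \<bullet> W')" using tens_in[OF Ident_in f] .
  have "loop S W' \<cdot> f = ptr S W W' (double_braid S W' \<cdot> (Ident S \<otimes> f))"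
    using ptr_natural[OF double_braid_in[of S W'] Ident_in[of W'] f] Ident_cmp[OF loop_in[of S W']] Ident_cmp[OF double_braid_in[of S W']]
    by (simp add: loop_def tens_Ident)
  also have "\<dots> = ptr S W W' ((Ident S \<otimes> f) \<cdot> double_braid S W)"
    by (simp add: double_braid_natural[OF Ident_in f])
  also have "\<dots> = f \<cdot> loop S W"
    using ptr_natural[OF double_braid_in[of S W] f Ident_in[of W]] cmp_Ident[OF cmp_in[OF loop_in[of S W] f]]
      cmp_Ident[OF cmp_in[OF double_braid_in[of S W] If]]
    by (simp add: loop_def tens_Ident)
  finally show ?thesis .
qed

text \<open>Of the two strands of a loop labelled \<open>Y \<bullet> S\<close> the inner one, \<open>Y\<close>, encircles only \<open>T\<close> and contributes its
scalar.\<close>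

lemma loop_tens:
  assumes a: "loop Y T = a \<star> Ident T" 
  shows "loop (Y \<bullet> S) T = a \<star> loop S T"
proof -
  let ?m = "double_braid Y T \<otimes> Ident S"
  have m: "?m \<in> Hom (Y \<bullet> (T \<bullet> S)) (Y \<bullet> (T \<bullet> S))" using tens_in[OF double_braid_in Ident_in, of Y T S] by simp
  have "loop (Y \<bullet> S) T = ptr S T T (ptr Y (S \<bullet> T) (S \<bullet> T) (double_braid (Y \<bullet> S) T))"
    unfolding loop_def by (rule ptr_tens) (use double_braid_in[of "Y \<bullet> S" T] in simp)
  also have "ptr Y (S \<bullet> T) (S \<bullet> T) (double_braid (Y \<bullet> S) T) = braid T S \<cdot> ptr Y (T \<bullet> S) (T \<bullet> S) ?m \<cdot> braid S T"
    unfolding double_braid_tens_left by (rule ptr_natural[OF m braid_in braid_in])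
  also have "ptr Y (T \<bullet> S) (T \<bullet> S) ?m = a \<star> Ident (T \<bullet> S)"
    using ptr_tens_Ident[OF double_braid_in[of Y T], of S] a
    by (simp add: loop_def tens_smul_left[OF Ident_in Ident_in] tens_Ident)
  also have "braid T S \<cdot> (a \<star> Ident (T \<bullet> S)) \<cdot> braid S T = a \<star> double_braid S T"
    by (simp add: cmp_smul_Ident[OF braid_in] cmp_smul_left[OF braid_in braid_in] double_braid_def)
  finally show ?thesis by (simp add: loop_def ptr_smul[OF double_braid_in])
qed

text \<open>A loop around the strand \<open>I\<close> below a coupon and its inverse above the coupon: if the coupon is
  written as \<open>(I \<otimes> u) \<cdot> (v \<otimes> X)\<close>, the lower double braiding moves up past \<open>v\<close>, where it cancels against
  the upper one except for a loop around \<open>W\<close>.\<close>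

lemma ptr_double_braid_conjugate:
  assumes v: "v \<in> Hom I (I \<bullet> W)" and u: "u \<in> Hom (W \<bullet> X) X'"
  shows "ptr S (I \<bullet> X) (I \<bullet> X')
      (((inv_braid C S I \<cdot> inv_braid C I S) \<otimes> Ident X') \<cdot> (Ident S \<otimes> ((Ident I \<otimes> u) \<cdot> (v \<otimes> Ident X))) \<cdot> (double_braid S I \<otimes> Ident X))
    = (Ident I \<otimes> u) \<cdot> (Ident I \<otimes> loop S W \<otimes> Ident X) \<cdot> (v \<otimes> Ident X)"
proof -
  let ?N = "(Ident S \<otimes> u) \<cdot> (double_braid S W \<otimes> Ident X)"
  have dv: "box v [I] [I, W]" by (rule den_box) (simp add: v)
  have du: "box u [W, X] [X']" by (rule den_box) (simp add: u)
  note dens = dv du den_double_braid den_braids den_intros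
  have IWv: "v \<otimes> Ident X \<in> Hom (I \<bullet> X) (I \<bullet> (W \<bullet> X))" using tens_in[OF v Ident_in[of X]] by simp
  have dN: "den ?N [S, W, X] [S, X'] (\<lambda>n s. layer (Suc n) [W, X] u [X'] (layer n [S, W] (double_braid S W) [S, W] s))"
    by (rule den_cong, (rule dens | simp)+)
  have N: "?N \<in> Hom (S \<bullet> (W \<bullet> X)) (S \<bullet> X')" using den_in[OF dN] by simp
  have d2: "den (double_braid S (I \<bullet> W)) [S, I, W] [S, I, W]
      (\<lambda>n s. braid_at n I S (layer (Suc n) [S, W] (double_braid S W) [S, W] (braid_at n S I s)))"
    unfolding double_braid_tens_right by (rule den_cong, (rule dens | simp)+)
  have 1 [rule_format]: "\<forall>n s. fits n [S, I] (fst s) \<longrightarrow> diagram s \<longrightarrow>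
      layer (Suc n) [I] v [I, W] (layer n [S, I] (double_braid S I) [S, I] s)
      = braid_at n I S (layer (Suc n) [S, W] (double_braid S W) [S, W] (braid_at n S I
          (layer (Suc n) [I] v [I, W] s)))"
    by (rule den_eqD[OF double_braid_natural[OF Ident_in[of S] v, symmetric]]; rule den_cong, (rule d2 dens | simp)+)
  let ?h = "(inv_braid C S I \<otimes> Ident X') \<cdot> (Ident I \<otimes> ?N) \<cdot> (braid S I \<otimes> Ident (W \<bullet> X))"
  have dh: "den ?h [S, I, W, X] [S, I, X'] (\<lambda>n s. inv_braid_at n S I
      (layer (Suc (Suc n)) [W, X] u [X'] (layer (Suc n) [S, W] (double_braid S W) [S, W] (braid_at n S I s))))"
    by (rule den_cong, (rule dN dens | simp)+)
  have h: "?h \<in> Hom (S \<bullet> (I \<bullet> (W \<bullet> X))) (S \<bullet> (I \<bullet> X'))" using den_in[OF dh] by simp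
  have "((inv_braid C S I \<cdot> inv_braid C I S) \<otimes> Ident X') \<cdot> (Ident S \<otimes> ((Ident I \<otimes> u) \<cdot> (v \<otimes> Ident X))) \<cdot> (double_braid S I \<otimes> Ident X)
      = (Ident S \<otimes> Ident (I \<bullet> X')) \<cdot> ?h \<cdot> (Ident S \<otimes> (v \<otimes> Ident X))"
    by (rule den_eqI[where w="[S, I, X]" and v="[S, I, X']"], (rule dh dens | simp)+)
      (simp add: diagram_simps layer_interchange' layer_inv_braid 1 u v)
  then have "ptr S (I \<bullet> X) (I \<bullet> X')
      (((inv_braid C S I \<cdot> inv_braid C I S) \<otimes> Ident X') \<cdot> (Ident S \<otimes> ((Ident I \<otimes> u) \<cdot> (v \<otimes> Ident X))) \<cdot> (double_braid S I \<otimes> Ident X))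
      = Ident (I \<bullet> X') \<cdot> ptr S (I \<bullet> (W \<bullet> X)) (I \<bullet> X') ?h \<cdot> (v \<otimes> Ident X)"
    using ptr_natural[OF h Ident_in IWv] by simp
  also have "ptr S (I \<bullet> (W \<bullet> X)) (I \<bullet> X') ?h = Ident I \<otimes> ptr S (W \<bullet> X) X' ?N"
    using ptr_hb_conjugate[OF half_braiding_braid[of I] N] by (simp add: hb_inv_braid)
  also have "ptr S (W \<bullet> X) X' ?N = u \<cdot> (loop S W \<otimes> Ident X)"
  proof -
    have dX: "double_braid S W \<otimes> Ident X \<in> Hom (S \<bullet> (W \<bullet> X)) (S \<bullet> (W \<bullet> X))"
      using tens_in[OF double_braid_in[of S W] Ident_in[of X]] by simp
    have lX: "loop S W \<otimes> Ident X \<in> Hom (W \<bullet> X) (W \<bullet> X)"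
      using tens_in[OF loop_in Ident_in] .
    show ?thesis
      using ptr_natural[OF dX u Ident_in] ptr_tens_Ident[OF double_braid_in[of S W], of X]
        cmp_Ident[OF N] cmp_Ident[OF cmp_in[OF lX u]]
      by (simp add: tens_Ident loop_def)
  qed
  also have "Ident (I \<bullet> X') \<cdot> (Ident I \<otimes> (u \<cdot> (loop S W \<otimes> Ident X))) \<cdot> (v \<otimes> Ident X)
      = (Ident I \<otimes> u) \<cdot> (Ident I \<otimes> loop S W \<otimes> Ident X) \<cdot> (v \<otimes> Ident X)"
  proof -
    have dl: "box (loop S W) [W] [W]" by (rule den_box) (simp add: loop_in)
    show ?thesis
      by (rule den_eqI[where w="[I, X]" and v="[I, X']"], (rule dl dens | simp)+)
  qed
  finally show ?thesis .
qed

end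

context modular_tensor_category
begin

lemma loop_Irr:
  assumes T: "T \<in> Irr"
  shows "loop S T = (S_matrix C S T / dm C T) \<star> Ident T"
proof -
  obtain a where a: "loop S T = a \<star> Ident T" using End_scalar[OF T loop_in] by blast
  have "S_matrix C S T = tr C T (loop S T)"
    using tr_tens[OF double_braid_in[of S T]] by (simp add: S_matrix_def double_braid_def loop_def)
  then show ?thesis using a dm_nonzero[OF T] by (simp add: tr_smul_Ident)
qed

text \<open>The identity of \<open>S \<bullet> R\<close> is resolved on the loop, and each \<open>b*\<close> slides once around the loop to meet its \<open>b\<close>.\<close>

lemma loop_tens_basis: "loop (S \<bullet> R) T = (\<Sum>U\<in>Irr. \<Sum>b\<in>basis U (S \<bullet> R). loop U T)"
proof -
  let ?X = "S \<bullet> R" and ?m = "double_braid (S \<bullet> R) T"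
  have term1: "ptr ?X T T (?m \<cdot> ((b \<cdot> cobasis U ?X b) \<otimes> Ident T)) = loop U T"
    and in1: "?m \<cdot> ((b \<cdot> cobasis U ?X b) \<otimes> Ident T) \<in> Hom (?X \<bullet> T) (?X \<bullet> T)"
    if U: "U \<in> Irr" and b: "b \<in> basis U ?X" for U b
  proof -
    let ?c = "cobasis U ?X b"
    note b' = basis_in[OF U b] and c = cobasis_in[OF U b]
    note bT = tens_in[OF b' Ident_in[of T]] and cT = tens_in[OF c Ident_in[of T]]
    have bc: "(b \<cdot> ?c) \<otimes> Ident T = (b \<otimes> Ident T) \<cdot> (?c \<otimes> Ident T)"
      using tens_cmp[OF c b' Ident_in[of T] Ident_in[of T]] cmp_Ident[OF Ident_in[of T]] by simp
    have cb: "(?c \<otimes> Ident T) \<cdot> (b \<otimes> Ident T) = Ident (U \<bullet> T)"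
      using tens_cmp[OF b' c Ident_in[of T] Ident_in[of T]] cmp_Ident[OF Ident_in[of T]] cobasis_basis[OF U b b]
      by (simp add: tens_Ident)
    show "?m \<cdot> ((b \<cdot> ?c) \<otimes> Ident T) \<in> Hom (?X \<bullet> T) (?X \<bullet> T)"
      by (rule cmp_in[OF tens_in[OF cmp_in[OF c b'] Ident_in] double_braid_in])
    have "ptr ?X T T (?m \<cdot> ((b \<cdot> ?c) \<otimes> Ident T)) = ptr ?X T T (?m \<cdot> (b \<otimes> Ident T) \<cdot> (?c \<otimes> Ident T))"
      by (simp only: bc cmp_assoc[OF cT bT double_braid_in])
    also have "\<dots> = ptr U T T ((?c \<otimes> Ident T) \<cdot> (?m \<cdot> (b \<otimes> Ident T)))"
      by (rule ptr_cyclic[OF c cmp_in[OF bT double_braid_in], symmetric])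
    also have "(?c \<otimes> Ident T) \<cdot> (?m \<cdot> (b \<otimes> Ident T)) = (?c \<otimes> Ident T) \<cdot> (b \<otimes> Ident T) \<cdot> double_braid U T"
      by (simp only: double_braid_natural[OF b' Ident_in] cmp_assoc[OF double_braid_in bT cT])
    also have "\<dots> = double_braid U T" by (simp only: cb Ident_cmp[OF double_braid_in])
    finally show "ptr ?X T T (?m \<cdot> ((b \<cdot> ?c) \<otimes> Ident T)) = loop U T" by (simp add: loop_def)
  qed
  have K: "linear_map_on (smul C) (smul C) (Hom ?X ?X) (Hom T T) (\<lambda>x. ptr ?X T T (?m \<cdot> (x \<otimes> Ident T)))"
    by (rule linear_map_on_compose[OF linear_map_on_compose[OF tens_linear_left[OF Ident_in] cmp_linear_right[OF double_braid_in]] ptr_linear])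
  have "loop ?X T = ptr ?X T T (?m \<cdot> (Ident ?X \<otimes> Ident T))"
    unfolding tens_Ident cmp_Ident[OF double_braid_in] by (simp add: loop_def)
  also have "\<dots> = (\<Sum>U\<in>Irr. \<Sum>b\<in>basis U ?X. ptr ?X T T (?m \<cdot> ((b \<cdot> cobasis U ?X b) \<otimes> Ident T)))"
    by (rule linear_map_on_Ident[OF K])
  also have "\<dots> = (\<Sum>U\<in>Irr. \<Sum>b\<in>basis U ?X. loop U T)"
    by (intro sum.cong refl term1)
  finally show ?thesis .
qed

text \<open>The multiplicity of \<open>U\<close> in \<open>S \<bullet> R\<close> is the size of the basis.  The sum is \<open>handle_slide\<close> with nothing
else on the strand \<open>R\<close>.\<close>

lemma sum_dm_basis:
  assumes "U \<in> Irr"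
  shows "(\<Sum>S\<in>Irr. \<Sum>b\<in>basis U (S \<bullet> R). dm C S) = dm C U * dm C R"
proof -
  have "(\<Sum>S\<in>Irr. \<Sum>b\<in>basis U (S \<bullet> R). dm C S) \<star> Ident U
      = (\<Sum>S\<in>Irr. \<Sum>b\<in>basis U (S \<bullet> R). dm C S \<star>
          ((cobasis U (S \<bullet> R) b \<otimes> Ident \<one>) \<cdot> (Ident S \<otimes> Ident R) \<cdot> (b \<otimes> Ident \<one>)))"
    unfolding vs.scale_sum_left
  proof (intro sum.cong refl)
    fix S b assume b: "b \<in> basis U (S \<bullet> R)"
    show "dm C S \<star> Ident U = dm C S \<star> ((cobasis U (S \<bullet> R) b \<otimes> Ident \<one>) \<cdot> (Ident S \<otimes> Ident R) \<cdot> (b \<otimes> Ident \<one>))"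
      using tens_unit[OF cobasis_in[OF assms b]] tens_unit[OF basis_in[OF assms b]] cmp_Ident[OF cobasis_in[OF assms b]]
        cobasis_basis[OF assms b b] by (simp add: tens_Ident)
  qed
  also have "\<dots> = dm C U \<star> (Ident U \<otimes> ptr R \<one> \<one> (Ident R))"
    by (rule handle_slide[OF assms]) (simp add: Ident_in)
  also have "\<dots> = (dm C U * dm C R) \<star> Ident U"
    using tr_eq[OF Ident_in[of R]] tens_smul_right[OF Ident_in[of U] Ident_in[of \<one>]]
    by (simp add: left_trace_def dm_def tens_Ident)
  finally show ?thesis using smul_Ident_inject[OF Irr_simple[OF assms]] by simp
qed

lemma S_matrix_unit: "S_matrix C S \<one> = dm C S"
  by (simp add: S_matrix_def dm_def braid_unit_left braid_unit_right cmp_Ident[OF Ident_in])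

definition loop_sum :: "'o \<Rightarrow> 'k" where
  "loop_sum T = (\<Sum>S\<in>Irr. dm C S * (S_matrix C S T / dm C T))"

text \<open>A loop labelled \<open>R\<close> can be absorbed by sliding it over the weighted sum of all loops, which
  multiplies the sum by \<open>d(R)\<close>.  It also multiplies the sum by its own value.\<close>

lemma loop_sum_absorbs:
  assumes T: "T \<in> Irr"
  shows "loop_sum T * (S_matrix C R T / dm C T) = dm C R * loop_sum T"
proof -
  let ?w = "\<lambda>S. S_matrix C S T / dm C T"
  have l: "loop S T = ?w S \<star> Ident T" for S by (rule loop_Irr[OF T])
  have "(loop_sum T * ?w R) \<star> Ident T = (\<Sum>S\<in>Irr. dm C S \<star> loop (S \<bullet> R) T)"
    unfolding loop_sum_def sum_distrib_right vs.scale_sum_left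
    by (intro sum.cong refl) (simp add: loop_tens[OF l] l[of R] mult.assoc)
  also have "\<dots> = (\<Sum>U\<in>Irr. (\<Sum>S\<in>Irr. \<Sum>b\<in>basis U (S \<bullet> R). dm C S) \<star> loop U T)"
    unfolding loop_tens_basis vs.scale_sum_right vs.scale_sum_left by (rule sum.swap)
  also have "\<dots> = (\<Sum>U\<in>Irr. (dm C U * dm C R) \<star> loop U T)"
    by (intro sum.cong refl) (simp only: sum_dm_basis)
  also have "\<dots> = (dm C R * loop_sum T) \<star> Ident T"
    unfolding loop_sum_def sum_distrib_left vs.scale_sum_left
    by (intro sum.cong refl) (simp add: l ac_simps)
  finally show ?thesis using smul_Ident_inject[OF Irr_simple[OF T]] by simp
qed

lemma loop_sum_unit: "loop_sum \<one> = global_dim C Irr"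
  by (simp add: loop_sum_def global_dim_def S_matrix_unit dm_unit power2_eq_square)

text \<open>Otherwise \<open>loop_sum_absorbs\<close> makes column \<open>T\<close> of the \<open>S\<close>-matrix equal to \<open>d(T)\<close> times column \<open>\<one>\<close>,
and a left inverse separates these columns.\<close>

lemma loop_sum_nonunit:
  assumes T: "T \<in> Irr" "T \<noteq> \<one>"
  shows "loop_sum T = 0"
proof (rule ccontr)
  assume "loop_sum T \<noteq> 0"
  then have "S_matrix C R T = dm C T * S_matrix C R \<one>" for R
    using loop_sum_absorbs[OF T(1), of R] dm_nonzero[OF T(1)] by (simp add: S_matrix_unit field_simps)
  moreover obtain M where M: "\<And>I J. I \<in> Irr \<Longrightarrow> J \<in> Irr \<Longrightarrow>
      (\<Sum>K\<in>Irr. M I K * S_matrix C K J) = (if I = J then 1 else 0)"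
    using S_matrix_invertible by blast
  ultimately have "(\<Sum>K\<in>Irr. M T K * S_matrix C K T) = dm C T * (\<Sum>K\<in>Irr. M T K * S_matrix C K \<one>)"
    by (simp add: sum_distrib_left ac_simps)
  then show False using M[OF T(1) T(1)] M[OF T(1) unit_in_Irr] T(2) by simp
qed

text \<open>Otherwise all loop sums vanish, which says that the row of the dimensions is annihilated by the
\<open>S\<close>-matrix, although its entry at \<open>\<one>\<close> is \<open>1\<close>.\<close>

lemma global_dim_nonzero: "global_dim C Irr \<noteq> 0"
proof
  assume "global_dim C Irr = 0"
  then have zero: "loop_sum T = 0" if "T \<in> Irr" for T using loop_sum_unit loop_sum_nonunit that by metis
  have row: "(\<Sum>S\<in>Irr. dm C S * S_matrix C S T) = 0" if "T \<in> Irr" for T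
  proof -
    have "loop_sum T = (\<Sum>S\<in>Irr. dm C S * S_matrix C S T) / dm C T"
      by (simp add: loop_sum_def sum_divide_distrib)
    then show ?thesis using zero[OF that] dm_nonzero[OF that] by simp
  qed
  obtain M where M: "\<And>I J. I \<in> Irr \<Longrightarrow> J \<in> Irr \<Longrightarrow>
      (\<Sum>K\<in>Irr. S_matrix C I K * M K J) = (if I = J then 1 else 0)"
    using S_matrix_invertible by blast
  have "0 = (\<Sum>T\<in>Irr. (\<Sum>S\<in>Irr. dm C S * S_matrix C S T) * M T \<one>)" using row by simp
  also have "\<dots> = (\<Sum>S\<in>Irr. dm C S * (\<Sum>T\<in>Irr. S_matrix C S T * M T \<one>))"
    unfolding sum_distrib_left sum_distrib_right by (subst sum.swap) (simp add: ac_simps)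
  also have "\<dots> = (\<Sum>S\<in>Irr. if S = \<one> then dm C S else 0)"
    using M unit_in_Irr by (intro sum.cong) auto
  also have "\<dots> = 1" using finite_Irr unit_in_Irr dm_unit by simp
  finally show False by simp
qed

text \<open>Composed with a map from a simple object \<open>T\<close> to \<open>dual I \<bullet> I\<close>, the sum of loops becomes the loop sum of
\<open>T\<close>, by naturality.  For \<open>T = \<one>\<close> that map is a multiple of \<open>coevt I\<close>, by rotation to an endomorphism of \<open>I\<close>,
and for \<open>T \<noteq> \<one>\<close> it is killed by \<open>ev I\<close>.\<close>

lemma loop_sum_dual_tens:
  assumes I: "I \<in> Irr"
  shows "(\<Sum>S\<in>Irr. dm C S \<star> loop S (dual I \<bullet> I)) = (global_dim C Irr / dm C I) \<star> (coevt I \<cdot> ev I)"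
proof (rule Irr_separating)
  let ?W = "dual I \<bullet> I"
  have in1: "dm C S \<star> loop S ?W \<in> Hom ?W ?W" for S by (rule Hom_smul[OF loop_in])
  show "(\<Sum>S\<in>Irr. dm C S \<star> loop S ?W) \<in> Hom ?W ?W" by (rule Hom_sum[OF in1])
  have ce: "coevt I \<cdot> ev I \<in> Hom ?W ?W" by (rule cmp_in[OF ev_in coevt_in])
  show "(global_dim C Irr / dm C I) \<star> (coevt I \<cdot> ev I) \<in> Hom ?W ?W" by (rule Hom_smul[OF ce])
  fix T i assume T: "T \<in> Irr" and i: "i \<in> Hom T ?W"
  have "(\<Sum>S\<in>Irr. dm C S \<star> loop S ?W) \<cdot> i = (\<Sum>S\<in>Irr. dm C S \<star> (loop S ?W \<cdot> i))"
    by (simp add: cmp_sum_left[OF i in1] cmp_smul_left[OF i loop_in])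
  also have "\<dots> = (\<Sum>S\<in>Irr. (dm C S * (S_matrix C S T / dm C T)) \<star> i)"
    by (intro sum.cong refl) (simp add: loop_natural[OF i] loop_Irr[OF T] cmp_smul_Ident[OF i])
  also have "\<dots> = loop_sum T \<star> i" by (simp add: loop_sum_def vs.scale_sum_left)
  also have "\<dots> = ((global_dim C Irr / dm C I) \<star> (coevt I \<cdot> ev I)) \<cdot> i"
  proof (cases "T = \<one>")
    case False
    then have "ev I \<cdot> i = 0" using Hom_Irr_zero[OF T unit_in_Irr] cmp_in[OF i ev_in] by blast
    then have "coevt I \<cdot> ev I \<cdot> i = 0"
      using cmp_assoc[OF i ev_in coevt_in] cmp_zero_right[OF coevt_in] by simp
    then show ?thesis using False loop_sum_nonunit[OF T] by (simp add: cmp_smul_left[OF i ce])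
  next
    case True
    let ?j = "(evt I \<otimes> Ident I) \<cdot> (Ident I \<otimes> i)"
    have i': "i \<in> Hom \<one> (dual I \<bullet> I)" using i True by simp
    have di: "box i [] [dual I, I]" by (rule den_box) (simp add: i')
    have dj: "den ?j [I] [I] (\<lambda>n s. evt_at n I (layer (Suc n) [] i [dual I, I] s))"
      by (rule den_cong, (rule di den_duals den_intros | simp)+)
    have "i = (Ident (dual I) \<otimes> ?j) \<cdot> coevt I"
      by (rule den_eqI[where w="[]" and v="[dual I, I]"], (rule dj di den_duals den_intros | simp)+)
        (simp add: diagram_simps layer_interchange' layer_zigzags i')
    moreover obtain c where "?j = c \<star> Ident I" using End_scalar[OF I] den_in[OF dj] by auto
    ultimately have c: "i = c \<star> coevt I"
      by (simp add: tens_smul_right[OF Ident_in Ident_in] tens_Ident smul_Ident_cmp[OF coevt_in])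
    have "ev I \<cdot> coevt I = dm C I \<star> Ident \<one>"
      using tr_eq[OF Ident_in[of I]] cmp_Ident[OF ev_in]
      by (simp add: left_trace_def ptr_def dm_def tens_Ident tens_unit[OF ev_in, simplified] tens_unit[OF coevt_in, simplified])
    then have "coevt I \<cdot> ev I \<cdot> coevt I = dm C I \<star> coevt I"
      using cmp_assoc[OF coevt_in[of I] ev_in[of I] coevt_in[of I]] cmp_smul_Ident[OF coevt_in] by simp
    then have "coevt I \<cdot> ev I \<cdot> i = dm C I \<star> i"
      unfolding c by (simp add: cmp_smul_right[OF ce coevt_in] mult.commute)
    then show ?thesis
      using True dm_nonzero[OF I] by (simp add: cmp_smul_left[OF i ce] loop_sum_unit)
  qed
  finally show "(\<Sum>S\<in>Irr. dm C S \<star> loop S ?W) \<cdot> i = ((global_dim C Irr / dm C I) \<star> (coevt I \<cdot> ev I)) \<cdot> i" .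
qed

text \<open>Bending the lower \<open>I\<close> strand of \<open>f\<close> writes \<open>f\<close> as a composite through \<open>I \<bullet> (dual I \<bullet> I) \<bullet> X\<close>.  The
loops around \<open>dual I \<bullet> I\<close> sum up to a multiple of \<open>coevt I \<cdot> ev I\<close>, which closes the \<open>I\<close> strand of \<open>f\<close> and
leaves a straight strand \<open>I\<close> beside it.\<close>

lemma sum_ptr_double_braid_conjugate:
  assumes I: "I \<in> Irr" and f: "f \<in> Hom (I \<bullet> X) (I \<bullet> X')"
  shows "(\<Sum>S\<in>Irr. dm C S \<star> ptr S (I \<bullet> X) (I \<bullet> X')
      (((inv_braid C S I \<cdot> inv_braid C I S) \<otimes> Ident X') \<cdot> (Ident S \<otimes> f) \<cdot> (double_braid S I \<otimes> Ident X)))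
    = (global_dim C Irr / dm C I) \<star> (Ident I \<otimes> ptr I X X' f)"
proof -
  let ?W = "dual I \<bullet> I"
  define u where "u = (ev I \<otimes> Ident X') \<cdot> (Ident (dual I) \<otimes> f)"
  define v where "v = coev I \<otimes> Ident I"
  have df: "box f [I, X] [I, X']" by (rule den_box) (simp add: f)
  have du: "den u [dual I, I, X] [X'] (\<lambda>n s. ev_at n I (layer (Suc n) [I, X] f [I, X'] s))"
    unfolding u_def by (rule den_cong, (rule df den_duals den_intros | simp)+)
  have dv: "den v [I] [I, dual I, I] (\<lambda>n. coev_at n I)"
    unfolding v_def by (rule den_cong, (rule df den_duals den_intros | simp)+)
  have u: "u \<in> Hom (?W \<bullet> X) X'" and v: "v \<in> Hom I (I \<bullet> ?W)" using den_in[OF du] den_in[OF dv] by simp_all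
  have f_eq: "f = (Ident I \<otimes> u) \<cdot> (v \<otimes> Ident X)"
    by (rule den_eqI[where w="[I, X]" and v="[I, X']"], (rule du dv df den_duals den_intros | simp)+)
      (simp add: diagram_simps layer_interchange' layer_zigzags f)
  define K where "K x = (Ident I \<otimes> u) \<cdot> (Ident I \<otimes> x \<otimes> Ident X) \<cdot> (v \<otimes> Ident X)" for x
  have Iu: "Ident I \<otimes> u \<in> Hom ((I \<bullet> ?W) \<bullet> X) (I \<bullet> X')" using tens_in[OF Ident_in[of I] u] by simp
  have vX: "v \<otimes> Ident X \<in> Hom (I \<bullet> X) ((I \<bullet> ?W) \<bullet> X)" using tens_in[OF v Ident_in[of X]] .
  have K: "linear_map_on (smul C) (smul C) (Hom ?W ?W) (Hom (I \<bullet> X) (I \<bullet> X')) K"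
    unfolding K_def
    by (rule linear_map_on_compose[OF linear_map_on_compose[OF linear_map_on_compose[OF
        tens_linear_right[OF Ident_in] tens_linear_left[OF Ident_in]] cmp_linear_right[OF Iu]] cmp_linear_left[OF vX]])
  have K_smul: "K (a \<star> x) = a \<star> K x" if "x \<in> Hom ?W ?W" for a x
    using K that unfolding linear_map_on_def by blast
  have ce: "coevt I \<cdot> ev I \<in> Hom ?W ?W" by (rule cmp_in[OF ev_in coevt_in])
  have "(\<Sum>S\<in>Irr. dm C S \<star> ptr S (I \<bullet> X) (I \<bullet> X')
      (((inv_braid C S I \<cdot> inv_braid C I S) \<otimes> Ident X') \<cdot> (Ident S \<otimes> f) \<cdot> (double_braid S I \<otimes> Ident X)))
    = (\<Sum>S\<in>Irr. dm C S \<star> K (loop S ?W))"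
    unfolding f_eq ptr_double_braid_conjugate[OF v u] K_def ..
  also have "\<dots> = K (\<Sum>S\<in>Irr. dm C S \<star> loop S ?W)"
    by (subst linear_map_on_sum[OF K Hom_smul[OF loop_in]]) (simp add: K_smul loop_in)
  also have "\<dots> = (global_dim C Irr / dm C I) \<star> K (coevt I \<cdot> ev I)"
    by (simp add: loop_sum_dual_tens[OF I] K_smul[OF ce])
  also have "K (coevt I \<cdot> ev I) = Ident I \<otimes> ptr I X X' f"
    unfolding K_def
    by (rule den_eqI[where w="[I, X]" and v="[I, X']"], (rule den_ptr du dv df den_duals den_intros | simp)+)
      (simp add: diagram_simps layer_zigzags f)
  finally show ?thesis .
qed

end

section \<open>The representation of the tube category on a half-braiding\<close>

context modular_tensor_category
begin

lemma tube_HomD: "f \<in> tube_Hom C Irr X Y \<Longrightarrow> R \<in> Irr \<Longrightarrow> f R \<in> Hom (R \<bullet> X) (Y \<bullet> R)"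
  by (simp add: tube_Hom_def)

lemma tube_Ident_in: "tube_Ident C X \<in> tube_Hom C Irr X X"
  using Ident_in[of X] unit_in_Irr by (simp add: tube_Hom_def tube_Ident_def)

lemma tube_cmp_eq: "tube_cmp C Irr X Z g f T = (if T \<in> Irr then
    (\<Sum>S\<in>Irr. \<Sum>R\<in>Irr. \<Sum>b\<in>basis T (S \<bullet> R).
      (Ident Z \<otimes> cobasis T (S \<bullet> R) b) \<cdot> (g S \<otimes> Ident R) \<cdot> (Ident S \<otimes> f R) \<cdot> (b \<otimes> Ident X)) else 0)"
  by (simp add: tube_cmp_def dual_bases_eq)

lemma den_basis: "T \<in> Irr \<Longrightarrow> b \<in> basis T (S \<bullet> R) \<Longrightarrow> box b [T] [S, R]"
  by (rule den_box) (use basis_in[of T b "S \<bullet> R"] in simp)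

lemma den_cobasis: "T \<in> Irr \<Longrightarrow> b \<in> basis T (S \<bullet> R) \<Longrightarrow>
    box (cobasis T (S \<bullet> R) b) [S, R] [T]"
  by (rule den_box) (use cobasis_in[of T b "S \<bullet> R"] in simp)

lemma tube_cmp_summand_in:
  assumes T: "T \<in> Irr" and b: "b \<in> basis T (S \<bullet> R)"
    and f: "f \<in> Hom (R \<bullet> X) (Y \<bullet> R)" and g: "g \<in> Hom (S \<bullet> Y) (Z \<bullet> S)"
  shows "(Ident Z \<otimes> cobasis T (S \<bullet> R) b) \<cdot> (g \<otimes> Ident R) \<cdot> (Ident S \<otimes> f) \<cdot> (b \<otimes> Ident X) \<in> Hom (T \<bullet> X) (Z \<bullet> T)"
proof -
  have df: "box f [R, X] [Y, R]" by (rule den_box) (simp add: f)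
  have dg: "box g [S, Y] [Z, S]" by (rule den_box) (simp add: g)
  have "\<exists>F. den ((Ident Z \<otimes> cobasis T (S \<bullet> R) b) \<cdot> (g \<otimes> Ident R) \<cdot> (Ident S \<otimes> f) \<cdot> (b \<otimes> Ident X)) [T, X] [Z, T] F"
    by (rule exI, (rule df dg den_basis[OF T b] den_cobasis[OF T b] den_intros | simp)+)
  then show ?thesis using den_in by fastforce
qed

lemma tube_cmp_in:
  assumes "f \<in> tube_Hom C Irr X Y" "g \<in> tube_Hom C Irr Y Z"
  shows "tube_cmp C Irr X Z g f \<in> tube_Hom C Irr X Z"
  unfolding tube_Hom_def tube_cmp_eq
  by (auto intro!: Hom_sum tube_cmp_summand_in tube_HomD[OF assms(1)] tube_HomD[OF assms(2)])

definition hb_term :: "'o \<Rightarrow> ('o \<Rightarrow> 'm) \<Rightarrow> 'm \<Rightarrow> 'o \<Rightarrow> 'm \<Rightarrow> 'm" where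
  "hb_term Z e g S f = hb_inv Z e S \<cdot> (g \<otimes> Ident S) \<cdot> f"

text \<open>The action of the tube category on \<open>Hom(-, Z)\<close> for a half-braiding on \<open>Z\<close>: the strand \<open>S\<close> of \<open>f\<close> is
pulled across \<open>Z\<close> and closed off.\<close>

definition hb_act :: "'o \<Rightarrow> ('o \<Rightarrow> 'm) \<Rightarrow> 'o \<Rightarrow> ('o \<Rightarrow> 'm) \<Rightarrow> 'm \<Rightarrow> 'm" where
  "hb_act Z e A f g = (\<Sum>S\<in>Irr. ptr S A Z (hb_term Z e g S (f S)))"

text \<open>Up to its weight, this is the component at \<open>S\<close> of the tube morphism given by \<open>j \<cdot> i\<close>: a strand \<open>S\<close> that
crosses \<open>Z\<close> between \<open>i\<close> and \<open>j\<close>.\<close>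

definition hb_lift :: "'o \<Rightarrow> ('o \<Rightarrow> 'm) \<Rightarrow> 'm \<Rightarrow> 'm \<Rightarrow> 'o \<Rightarrow> 'm" where
  "hb_lift Z e j i S = (j \<otimes> Ident S) \<cdot> e S \<cdot> (Ident S \<otimes> i)"

context
  fixes Z e
  assumes hb: "half_braiding Z e"
begin

lemma hb_term_in:
  assumes f: "f \<in> Hom (S \<bullet> A) (Y \<bullet> S)" and g: "g \<in> Hom Y Z"
  shows "hb_term Z e g S f \<in> Hom (S \<bullet> A) (S \<bullet> Z)"
  unfolding hb_term_def by (rule cmp_in[OF f cmp_in[OF tens_in[OF g Ident_in] hb_inv_in[OF hb]]])

lemma hb_term_linear_right:
  assumes g: "g \<in> Hom Y Z"
  shows "linear_map_on (smul C) (smul C) (Hom (S \<bullet> A) (Y \<bullet> S)) (Hom (S \<bullet> A) (S \<bullet> Z)) (hb_term Z e g S)"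
  unfolding hb_term_def by (rule cmp_linear_right[OF cmp_in[OF tens_in[OF g Ident_in] hb_inv_in[OF hb]]])

lemma hb_term_linear_left:
  assumes f: "f \<in> Hom (S \<bullet> A) (Y \<bullet> S)"
  shows "linear_map_on (smul C) (smul C) (Hom Y Z) (Hom (S \<bullet> A) (S \<bullet> Z)) (\<lambda>g. hb_term Z e g S f)"
  unfolding hb_term_def
  by (rule linear_map_on_compose[OF linear_map_on_compose[OF tens_linear_left[OF Ident_in]
    cmp_linear_right[OF hb_inv_in[OF hb]]] cmp_linear_left[OF f]])

lemma hb_act_in:
  assumes f: "f \<in> tube_Hom C Irr A Y" and g: "g \<in> Hom Y Z"
  shows "hb_act Z e A f g \<in> Hom A Z"
  unfolding hb_act_def by (intro Hom_sum ptr_in hb_term_in[OF tube_HomD[OF f] g])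

lemma hb_act_linear:
  assumes f: "f \<in> tube_Hom C Irr A Y"
  shows "linear_map_on (smul C) (smul C) (Hom Y Z) (Hom A Z) (hb_act Z e A f)"
proof -
  have l: "linear_map_on (smul C) (smul C) (Hom Y Z) (Hom A Z) (\<lambda>g. ptr S A Z (hb_term Z e g S (f S)))" if "S \<in> Irr" for S
    by (rule linear_map_on_compose[OF hb_term_linear_left[OF tube_HomD[OF f that]] ptr_linear])
  show ?thesis
    unfolding linear_map_on_def
  proof (intro conjI ballI allI)
    fix g g' assume g: "g \<in> Hom Y Z" "g' \<in> Hom Y Z"
    show "hb_act Z e A f (g + g') = hb_act Z e A f g + hb_act Z e A f g'"
      unfolding hb_act_def sum.distrib[symmetric]
      by (rule sum.cong[OF refl]) (use l g in \<open>auto simp: linear_map_on_def\<close>)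
  next
    fix a g assume g: "g \<in> Hom Y Z"
    show "hb_act Z e A f (a \<star> g) = a \<star> hb_act Z e A f g"
      unfolding hb_act_def vs.scale_sum_right
      by (rule sum.cong[OF refl]) (use l g in \<open>auto simp: linear_map_on_def\<close>)
  qed (rule hb_act_in[OF f])
qed

lemma hb_act_linear_left:
  assumes g: "g \<in> Hom Y Z"
  shows "linear_map_on (tube_smul C) (smul C) (tube_Hom C Irr A Y) (Hom A Z) (\<lambda>f. hb_act Z e A f g)"
proof -
  have l: "linear_map_on (smul C) (smul C) (Hom (S \<bullet> A) (Y \<bullet> S)) (Hom A Z) (\<lambda>f. ptr S A Z (hb_term Z e g S f))" for S
    by (rule linear_map_on_compose[OF hb_term_linear_right[OF g] ptr_linear])
  show ?thesis
    unfolding linear_map_on_def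
  proof (intro conjI ballI allI)
    fix f f' assume f: "f \<in> tube_Hom C Irr A Y" "f' \<in> tube_Hom C Irr A Y"
    show "hb_act Z e A (f + f') g = hb_act Z e A f g + hb_act Z e A f' g"
      unfolding hb_act_def sum.distrib[symmetric]
      by (rule sum.cong[OF refl]) (use l tube_HomD[OF f(1)] tube_HomD[OF f(2)] in \<open>auto simp: linear_map_on_def\<close>)
  next
    fix a f assume f: "f \<in> tube_Hom C Irr A Y"
    show "hb_act Z e A (tube_smul C a f) g = a \<star> hb_act Z e A f g"
      unfolding hb_act_def vs.scale_sum_right tube_smul_def
      by (rule sum.cong[OF refl]) (use l tube_HomD[OF f] in \<open>auto simp: linear_map_on_def\<close>)
  qed (rule hb_act_in[OF _ g])
qed

lemma hb_act_Ident:
  assumes v: "v \<in> Hom A Z"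
  shows "hb_act Z e A (tube_Ident C A) v = v"
proof -
  have "hb_act Z e A (tube_Ident C A) v = (\<Sum>S\<in>Irr. if S = \<one> then v else 0)"
    unfolding hb_act_def
  proof (rule sum.cong[OF refl])
    fix S assume "S \<in> Irr"
    show "ptr S A Z (hb_term Z e v S (tube_Ident C A S)) = (if S = \<one> then v else 0)"
    proof (cases "S = \<one>")
      case True
      then show ?thesis
        using hb_inv_unit[OF hb] Ident_cmp[OF v] cmp_Ident[OF v] tens_unit[OF v] ptr_unit[OF v]
        by (simp add: hb_term_def tube_Ident_def)
    next
      case False
      have "hb_term Z e v S 0 = 0"
        unfolding hb_term_def by (rule cmp_zero_right[OF cmp_in[OF tens_in[OF v Ident_in] hb_inv_in[OF hb]]])
      moreover have "ptr S A Z 0 = 0" using ptr_sum[of "{}" "\<lambda>_. 0" S A Z] by simp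
      ultimately show ?thesis using False by (simp add: tube_Ident_def)
    qed
  qed
  then show ?thesis using finite_Irr unit_in_Irr by simp
qed

text \<open>Resolving the identity of \<open>S \<bullet> R\<close> turns the composition of the tube category into the closing
  of a strand \<open>S \<bullet> R\<close>, that is of two parallel strands.\<close>

lemma hb_act_cmp:
  assumes f: "f \<in> tube_Hom C Irr X Y" and g: "g \<in> tube_Hom C Irr Y W" and v: "v \<in> Hom W Z"
  shows "hb_act Z e X (tube_cmp C Irr X W g f) v = hb_act Z e X f (hb_act Z e Y g v)"
proof -
  define H where "H S R = hb_inv Z e (S \<bullet> R) \<cdot> (v \<otimes> Ident (S \<bullet> R)) \<cdot> ((g S \<otimes> Ident R) \<cdot> (Ident S \<otimes> f R))" for S R
  define k where "k S = hb_term Z e v S (g S)" for S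
  have k: "k S \<in> Hom (S \<bullet> Y) (S \<bullet> Z)" if "S \<in> Irr" for S
    unfolding k_def by (rule hb_term_in[OF tube_HomD[OF g that] v])
  have dv: "box v [W] [Z]" by (rule den_box) (simp add: v)
  have G: "(g S \<otimes> Ident R) \<cdot> (Ident S \<otimes> f R) \<in> Hom ((S \<bullet> R) \<bullet> X) (W \<bullet> (S \<bullet> R))" if S: "S \<in> Irr" and R: "R \<in> Irr" for S R
    using cmp_in[OF tens_in[OF Ident_in[of S] tube_HomD[OF f R]], of "g S \<otimes> Ident R"]
      tens_in[OF tube_HomD[OF g S] Ident_in[of R]] by simp
  have vSR: "hb_inv Z e S \<cdot> (v \<otimes> Ident S) \<in> Hom (W \<bullet> S) (S \<bullet> Z)" for S
    by (rule cmp_in[OF tens_in[OF v Ident_in] hb_inv_in[OF hb]])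
  have H: "H S R \<in> Hom ((S \<bullet> R) \<bullet> X) ((S \<bullet> R) \<bullet> Z)" if "S \<in> Irr" "R \<in> Irr" for S R
    unfolding H_def by (rule cmp_in[OF G[OF that] vSR])
  have summand: "ptr T X Z (hb_term Z e v T ((Ident W \<otimes> cobasis T (S \<bullet> R) b) \<cdot> (g S \<otimes> Ident R) \<cdot> (Ident S \<otimes> f R) \<cdot> (b \<otimes> Ident X)))
      = ptr (S \<bullet> R) X Z (H S R \<cdot> ((b \<cdot> cobasis T (S \<bullet> R) b) \<otimes> Ident X))"
    if T: "T \<in> Irr" and S: "S \<in> Irr" and R: "R \<in> Irr" and b: "b \<in> basis T (S \<bullet> R)" for T S R b
  proof -
    let ?c = "cobasis T (S \<bullet> R) b" and ?G = "(g S \<otimes> Ident R) \<cdot> (Ident S \<otimes> f R)"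
    note b' = basis_in[OF T b] and c = cobasis_in[OF T b]
    note bX = tens_in[OF b' Ident_in[of X]] and cX = tens_in[OF c Ident_in[of X]] and Hin = H[OF S R]
    have df: "box (f R) [R, X] [Y, R]" by (rule den_box) (use tube_HomD[OF f R] in simp)
    have dg: "box (g S) [S, Y] [W, S]" by (rule den_box) (use tube_HomD[OF g S] in simp)
    have dSR: "box (hb_inv Z e (S \<bullet> R)) [Z, S, R] [S, R, Z]"
      by (rule den_box) (use hb_inv_in[OF hb, of "S \<bullet> R"] in simp)
    note dens = df dg dv dSR den_basis[OF T b] den_cobasis[OF T b] den_hb_inv[OF hb] den_intros
    have slide [rule_format]: "\<forall>n s. fits n [Z, S, R] (fst s) \<longrightarrow> diagram s \<longrightarrow>
        layer n [Z, T] (hb_inv Z e T) [T, Z] (layer (Suc n) [S, R] ?c [T] s)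
        = layer n [S, R] ?c [T] (layer n [Z, S, R] (hb_inv Z e (S \<bullet> R)) [S, R, Z] s)"
      by (rule den_eqD[OF hb_inv_natural[OF hb c, symmetric]]; rule den_cong, (rule dens | simp)+)
    have "hb_term Z e v T ((Ident W \<otimes> ?c) \<cdot> (g S \<otimes> Ident R) \<cdot> (Ident S \<otimes> f R) \<cdot> (b \<otimes> Ident X))
        = (?c \<otimes> Ident Z) \<cdot> (H S R \<cdot> (b \<otimes> Ident X))"
      unfolding hb_term_def H_def
      by (rule den_eqI[where w="[T, X]" and v="[T, Z]"], (rule dens | simp)+)
        (use tube_HomD[OF f R] tube_HomD[OF g S] b' c v in \<open>simp add: diagram_simps layer_interchange slide\<close>)
    then have "ptr T X Z (hb_term Z e v T ((Ident W \<otimes> ?c) \<cdot> (g S \<otimes> Ident R) \<cdot> (Ident S \<otimes> f R) \<cdot> (b \<otimes> Ident X)))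
        = ptr T X Z ((?c \<otimes> Ident Z) \<cdot> (H S R \<cdot> (b \<otimes> Ident X)))" by simp
    also have "\<dots> = ptr (S \<bullet> R) X Z (H S R \<cdot> (b \<otimes> Ident X) \<cdot> (?c \<otimes> Ident X))"
      by (rule ptr_cyclic[OF c cmp_in[OF bX Hin]])
    also have "H S R \<cdot> (b \<otimes> Ident X) \<cdot> (?c \<otimes> Ident X) = H S R \<cdot> ((b \<cdot> ?c) \<otimes> Ident X)"
      using tens_cmp[OF c b' Ident_in[of X] Ident_in[of X]] cmp_Ident[OF Ident_in[of X]]
      by (simp add: cmp_assoc[OF cX bX Hin, symmetric])
    finally show ?thesis .
  qed
  have resolve: "(\<Sum>T\<in>Irr. \<Sum>b\<in>basis T (S \<bullet> R). ptr (S \<bullet> R) X Z (H S R \<cdot> ((b \<cdot> cobasis T (S \<bullet> R) b) \<otimes> Ident X)))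
      = ptr (S \<bullet> R) X Z (H S R)" if S: "S \<in> Irr" and R: "R \<in> Irr" for S R
  proof -
    let ?SR = "S \<bullet> R"
    have K: "linear_map_on (smul C) (smul C) (Hom ?SR ?SR) (Hom X Z) (\<lambda>x. ptr ?SR X Z (H S R \<cdot> (x \<otimes> Ident X)))"
      by (rule linear_map_on_compose[OF linear_map_on_compose[OF tens_linear_left[OF Ident_in] cmp_linear_right[OF H[OF S R]]] ptr_linear])
    have "ptr ?SR X Z (H S R) = ptr ?SR X Z (H S R \<cdot> (Ident ?SR \<otimes> Ident X))"
      unfolding tens_Ident cmp_Ident[OF H[OF S R]] ..
    also have "\<dots> = (\<Sum>T\<in>Irr. \<Sum>b\<in>basis T ?SR. ptr ?SR X Z (H S R \<cdot> ((b \<cdot> cobasis T ?SR b) \<otimes> Ident X)))"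
      by (rule linear_map_on_Ident[OF K])
    finally show ?thesis by simp
  qed
  \<comment> \<open>Closing \<open>S\<close> first applies \<open>g\<close> to \<open>v\<close>; closing \<open>R\<close> afterwards applies \<open>f\<close>.\<close>
  have nested: "ptr (S \<bullet> R) X Z (H S R) = ptr R X Z (hb_term Z e (ptr S Y Z (k S)) R (f R))"
    if S: "S \<in> Irr" and R: "R \<in> Irr" for S R
  proof -
    have df: "box (f R) [R, X] [Y, R]" by (rule den_box) (use tube_HomD[OF f R] in simp)
    have dg: "box (g S) [S, Y] [W, S]" by (rule den_box) (use tube_HomD[OF g S] in simp)
    have kR: "k S \<otimes> Ident R \<in> Hom (S \<bullet> (Y \<bullet> R)) (S \<bullet> (Z \<bullet> R))" using tens_in[OF k[OF S] Ident_in[of R]] by simp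
    have "H S R = (Ident S \<otimes> hb_inv Z e R) \<cdot> (k S \<otimes> Ident R) \<cdot> (Ident S \<otimes> f R)"
      unfolding H_def k_def hb_term_def hb_inv_tens[OF hb]
      by (rule den_eqI[where w="[S, R, X]" and v="[S, R, Z]"], (rule df dg dv den_hb_inv[OF hb] den_intros | simp)+)
    then have "ptr S (R \<bullet> X) (R \<bullet> Z) (H S R) = hb_inv Z e R \<cdot> ptr S (Y \<bullet> R) (Z \<bullet> R) (k S \<otimes> Ident R) \<cdot> f R"
      using ptr_natural[OF kR hb_inv_in[OF hb] tube_HomD[OF f R]] by simp
    then show ?thesis
      using ptr_tens[of "H S R" S R X Z] H[OF S R] ptr_tens_Ident[OF k[OF S], of R] by (simp add: hb_term_def)
  qed
  have "hb_act Z e X (tube_cmp C Irr X W g f) v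
      = (\<Sum>T\<in>Irr. \<Sum>S\<in>Irr. \<Sum>R\<in>Irr. \<Sum>b\<in>basis T (S \<bullet> R).
          ptr T X Z (hb_term Z e v T ((Ident W \<otimes> cobasis T (S \<bullet> R) b) \<cdot> (g S \<otimes> Ident R) \<cdot> (Ident S \<otimes> f R) \<cdot> (b \<otimes> Ident X))))"
    unfolding hb_act_def
  proof (rule sum.cong[OF refl])
    fix T assume T: "T \<in> Irr"
    let ?s = "\<lambda>S R b. (Ident W \<otimes> cobasis T (S \<bullet> R) b) \<cdot> (g S \<otimes> Ident R) \<cdot> (Ident S \<otimes> f R) \<cdot> (b \<otimes> Ident X)"
    have K: "linear_map_on (smul C) (smul C) (Hom (T \<bullet> X) (W \<bullet> T)) (Hom X Z) (\<lambda>x. ptr T X Z (hb_term Z e v T x))"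
      by (rule linear_map_on_compose[OF hb_term_linear_right[OF v] ptr_linear])
    have s1: "?s S R b \<in> Hom (T \<bullet> X) (W \<bullet> T)" if "S \<in> Irr" "R \<in> Irr" "b \<in> basis T (S \<bullet> R)" for S R b
      by (rule tube_cmp_summand_in[OF T that(3) tube_HomD[OF f that(2)] tube_HomD[OF g that(1)]])
    have s2: "(\<Sum>b\<in>basis T (S \<bullet> R). ?s S R b) \<in> Hom (T \<bullet> X) (W \<bullet> T)" if "S \<in> Irr" "R \<in> Irr" for S R
      by (rule Hom_sum) (rule s1[OF that])
    have s3: "(\<Sum>R\<in>Irr. \<Sum>b\<in>basis T (S \<bullet> R). ?s S R b) \<in> Hom (T \<bullet> X) (W \<bullet> T)" if "S \<in> Irr" for S
      by (rule Hom_sum) (rule s2[OF that])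
    show "ptr T X Z (hb_term Z e v T (tube_cmp C Irr X W g f T))
        = (\<Sum>S\<in>Irr. \<Sum>R\<in>Irr. \<Sum>b\<in>basis T (S \<bullet> R). ptr T X Z (hb_term Z e v T (?s S R b)))"
      using T by (simp add: tube_cmp_eq linear_map_on_sum[OF K s3] linear_map_on_sum[OF K s2] linear_map_on_sum[OF K s1])
  qed
  also have "\<dots> = (\<Sum>T\<in>Irr. \<Sum>S\<in>Irr. \<Sum>R\<in>Irr. \<Sum>b\<in>basis T (S \<bullet> R). ptr (S \<bullet> R) X Z (H S R \<cdot> ((b \<cdot> cobasis T (S \<bullet> R) b) \<otimes> Ident X)))"
    by (intro sum.cong refl summand)
  also have "\<dots> = (\<Sum>S\<in>Irr. \<Sum>R\<in>Irr. \<Sum>T\<in>Irr. \<Sum>b\<in>basis T (S \<bullet> R). ptr (S \<bullet> R) X Z (H S R \<cdot> ((b \<cdot> cobasis T (S \<bullet> R) b) \<otimes> Ident X)))"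
    by (subst sum.swap, rule sum.cong[OF refl], rule sum.swap)
  also have "\<dots> = (\<Sum>R\<in>Irr. \<Sum>S\<in>Irr. ptr R X Z (hb_term Z e (ptr S Y Z (k S)) R (f R)))"
    by (subst sum.swap) (simp add: resolve nested)
  also have "\<dots> = hb_act Z e X f (hb_act Z e Y g v)"
    unfolding hb_act_def[of Z e X f]
  proof (rule sum.cong[OF refl])
    fix R assume R: "R \<in> Irr"
    have K: "linear_map_on (smul C) (smul C) (Hom Y Z) (Hom X Z) (\<lambda>x. ptr R X Z (hb_term Z e x R (f R)))"
      by (rule linear_map_on_compose[OF hb_term_linear_left[OF tube_HomD[OF f R]] ptr_linear])
    show "(\<Sum>S\<in>Irr. ptr R X Z (hb_term Z e (ptr S Y Z (k S)) R (f R))) = ptr R X Z (hb_term Z e (hb_act Z e Y g v) R (f R))"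
      unfolding hb_act_def k_def[symmetric] by (rule linear_map_on_sum[OF K, symmetric]) (rule ptr_in[OF k])
  qed
  finally show ?thesis .
qed

lemma hb_lift_in:
  assumes "j \<in> Hom Z Y" "i \<in> Hom X Z"
  shows "hb_lift Z e j i S \<in> Hom (S \<bullet> X) (Y \<bullet> S)"
  unfolding hb_lift_def
  by (rule cmp_in[OF tens_in[OF Ident_in assms(2)] cmp_in[OF hb_in[OF hb] tens_in[OF assms(1) Ident_in]]])

text \<open>The composition in the tube category slides the strand of \<open>f\<close> over the strand \<open>S\<close> of the lift.
  With the weights \<open>d(S)\<close> the sum over all \<open>S\<close> is invariant under such slides.\<close>

lemma hb_lift_natural:
  assumes f: "f \<in> tube_Hom C Irr A X" and i: "i \<in> Hom X Z" and j: "j \<in> Hom Z Y"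
  shows "tube_cmp C Irr A Y (\<lambda>S. if S \<in> Irr then (a * dm C S) \<star> hb_lift Z e j i S else 0) f
    = (\<lambda>T. if T \<in> Irr then (a * dm C T) \<star> hb_lift Z e j (hb_act Z e A f i) T else 0)"
proof (rule ext)
  fix T
  show "tube_cmp C Irr A Y (\<lambda>S. if S \<in> Irr then (a * dm C S) \<star> hb_lift Z e j i S else 0) f T
    = (if T \<in> Irr then (a * dm C T) \<star> hb_lift Z e j (hb_act Z e A f i) T else 0)"
  proof (cases "T \<in> Irr")
    case False
    then show ?thesis by (simp add: tube_cmp_eq)
  next
    case T: True
    define h where "h R = hb_term Z e i R (f R)" for R
    have h: "h R \<in> Hom (R \<bullet> A) (R \<bullet> Z)" if "R \<in> Irr" for R
      unfolding h_def by (rule hb_term_in[OF tube_HomD[OF f that] i])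
    let ?P = "(j \<otimes> Ident T) \<cdot> e T"
    have P: "?P \<in> Hom (T \<bullet> Z) (Y \<bullet> T)" by (rule cmp_in[OF hb_in[OF hb] tens_in[OF j Ident_in]])
    let ?q = "\<lambda>S R b. (cobasis T (S \<bullet> R) b \<otimes> Ident Z) \<cdot> (Ident S \<otimes> h R) \<cdot> (b \<otimes> Ident A)"
    have q: "?q S R b \<in> Hom (T \<bullet> A) (T \<bullet> Z)"
      and summand: "(Ident Y \<otimes> cobasis T (S \<bullet> R) b) \<cdot> ((a * dm C S) \<star> hb_lift Z e j i S \<otimes> Ident R) \<cdot> (Ident S \<otimes> f R) \<cdot> (b \<otimes> Ident A)
        = a \<star> (?P \<cdot> (dm C S \<star> ?q S R b))"
      if S: "S \<in> Irr" and R: "R \<in> Irr" and b: "b \<in> basis T (S \<bullet> R)" for S R b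
    proof -
      let ?c = "cobasis T (S \<bullet> R) b"
      note c = cobasis_in[OF T b] and fR = tube_HomD[OF f R]
      note dbc = den_basis[OF T b] den_cobasis[OF T b]
      have di: "box i [X] [Z]" by (rule den_box) (simp add: i)
      have dj: "box j [Z] [Y]" by (rule den_box) (simp add: j)
      have df: "box (f R) [R, A] [X, R]" by (rule den_box) (use fR in simp)
      have dh: "box (h R) [R, A] [R, Z]" by (rule den_box) (use h[OF R] in simp)
      note dens = di dj df dh dbc den_hb[OF hb] den_hb_inv[OF hb] den_intros
      have dq: "den (?q S R b) [T, A] [T, Z] (\<lambda>n s. layer n [S, R] ?c [T] (layer (Suc n) [R, A] (h R) [R, Z] (layer n [T] b [S, R] s)))"
        by (rule den_cong, (rule dens | simp)+)
      show q: "?q S R b \<in> Hom (T \<bullet> A) (T \<bullet> Z)" using den_in[OF dq] by simp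
      have 1: "(i \<otimes> Ident R) \<cdot> f R = e R \<cdot> h R"
        unfolding h_def hb_term_def
        by (rule den_eqI[where w="[R, A]" and v="[Z, R]"], (rule dens | simp)+)
          (use i fR in \<open>simp add: diagram_simps layer_hb_inverse[OF hb] hb_simps[OF hb]\<close>)
      have 1 [rule_format]: "\<forall>n s. fits n [R, A] (fst s) \<longrightarrow> diagram s \<longrightarrow>
          layer n [X] i [Z] (layer n [R, A] (f R) [X, R] s) = layer n [R, Z] (e R) [Z, R] (layer n [R, A] (h R) [R, Z] s)"
        by (rule den_eqD[OF 1]; rule den_cong, (rule dens | simp)+)
      have 2: "(Ident Z \<otimes> ?c) \<cdot> e (S \<bullet> R) = e T \<cdot> (?c \<otimes> Ident Z)"
        using hb_natural[OF hb c] by simp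
      have 2 [rule_format]: "\<forall>n s. fits n [S, R, Z] (fst s) \<longrightarrow> diagram s \<longrightarrow>
          layer (Suc n) [S, R] ?c [T] (layer n [S, Z] (e S) [Z, S] (layer (Suc n) [R, Z] (e R) [Z, R] s))
          = layer n [T, Z] (e T) [Z, T] (layer n [S, R] ?c [T] s)"
        by (rule den_eqD[OF 2]; rule den_cong, (rule den_hb_tens[OF hb] dens | simp)+)
      have "(Ident Y \<otimes> ?c) \<cdot> (hb_lift Z e j i S \<otimes> Ident R) \<cdot> (Ident S \<otimes> f R) \<cdot> (b \<otimes> Ident A) = ?P \<cdot> ?q S R b"
        unfolding hb_lift_def
        by (rule den_eqI[where w="[T, A]" and v="[Y, T]"], (rule dens | simp)+)
          (use i j fR h[OF R] basis_in[OF T b] c in \<open>simp add: diagram_simps layer_interchange' hb_simps[OF hb] 1 2\<close>)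
      moreover have "(Ident Y \<otimes> ?c) \<cdot> ((a * dm C S) \<star> hb_lift Z e j i S \<otimes> Ident R) \<cdot> (Ident S \<otimes> f R) \<cdot> (b \<otimes> Ident A)
          = (a * dm C S) \<star> ((Ident Y \<otimes> ?c) \<cdot> (hb_lift Z e j i S \<otimes> Ident R) \<cdot> (Ident S \<otimes> f R) \<cdot> (b \<otimes> Ident A))"
      proof -
        have y: "Ident Y \<otimes> ?c \<in> Hom (Y \<bullet> (S \<bullet> R)) (Y \<bullet> T)" using tens_in[OF Ident_in c] .
        have l: "hb_lift Z e j i S \<otimes> Ident R \<in> Hom (S \<bullet> (X \<bullet> R)) (Y \<bullet> (S \<bullet> R))"
          using tens_in[OF hb_lift_in[OF j i, of S] Ident_in[of R]] by simp
        have f': "Ident S \<otimes> f R \<in> Hom (S \<bullet> (R \<bullet> A)) (S \<bullet> (X \<bullet> R))" using tens_in[OF Ident_in fR] .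
        have b': "b \<otimes> Ident A \<in> Hom (T \<bullet> A) (S \<bullet> (R \<bullet> A))" using tens_in[OF basis_in[OF T b] Ident_in[of A]] by simp
        show ?thesis
          by (simp add: tens_smul_left[OF hb_lift_in[OF j i] Ident_in] cmp_smul_right[OF y l]
            cmp_smul_left[OF f' cmp_in[OF l y]] cmp_smul_left[OF b' cmp_in[OF f' cmp_in[OF l y]]])
      qed
      ultimately show "(Ident Y \<otimes> ?c) \<cdot> ((a * dm C S) \<star> hb_lift Z e j i S \<otimes> Ident R) \<cdot> (Ident S \<otimes> f R) \<cdot> (b \<otimes> Ident A)
        = a \<star> (?P \<cdot> (dm C S \<star> ?q S R b))"
        by (simp add: cmp_smul_right[OF P q])
    qed
    have q1: "dm C S \<star> ?q S R b \<in> Hom (T \<bullet> A) (T \<bullet> Z)" if "S \<in> Irr" "R \<in> Irr" "b \<in> basis T (S \<bullet> R)" for S R b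
      by (rule Hom_smul[OF q[OF that]])
    have q2: "(\<Sum>b\<in>basis T (S \<bullet> R). dm C S \<star> ?q S R b) \<in> Hom (T \<bullet> A) (T \<bullet> Z)" if "S \<in> Irr" "R \<in> Irr" for S R
      by (rule Hom_sum) (rule q1[OF that])
    have q3: "Ident T \<otimes> ptr R A Z (h R) \<in> Hom (T \<bullet> A) (T \<bullet> Z)" if "R \<in> Irr" for R
      by (rule tens_in[OF Ident_in ptr_in[OF h[OF that]]])
    have "tube_cmp C Irr A Y (\<lambda>S. if S \<in> Irr then (a * dm C S) \<star> hb_lift Z e j i S else 0) f T
        = (\<Sum>S\<in>Irr. \<Sum>R\<in>Irr. \<Sum>b\<in>basis T (S \<bullet> R). a \<star> (?P \<cdot> (dm C S \<star> ?q S R b)))"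
      using T summand by (simp add: tube_cmp_eq)
    also have "\<dots> = (\<Sum>R\<in>Irr. a \<star> (?P \<cdot> (\<Sum>S\<in>Irr. \<Sum>b\<in>basis T (S \<bullet> R). dm C S \<star> ?q S R b)))"
      by (subst sum.swap) (simp add: cmp_sum_right[OF P q2] cmp_sum_right[OF P q1] vs.scale_sum_right)
    also have "\<dots> = (\<Sum>R\<in>Irr. (a * dm C T) \<star> (?P \<cdot> (Ident T \<otimes> ptr R A Z (h R))))"
      by (intro sum.cong refl) (simp add: handle_slide[OF T h] cmp_smul_right[OF P q3])
    also have "\<dots> = (a * dm C T) \<star> (?P \<cdot> (\<Sum>R\<in>Irr. Ident T \<otimes> ptr R A Z (h R)))"
      by (simp add: cmp_sum_right[OF P q3] vs.scale_sum_right)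
    also have "(\<Sum>R\<in>Irr. Ident T \<otimes> ptr R A Z (h R)) = Ident T \<otimes> hb_act Z e A f i"
      unfolding hb_act_def h_def[symmetric]
      by (rule linear_map_on_sum[OF tens_linear_right[OF Ident_in], symmetric]) (rule ptr_in[OF h])
    finally show ?thesis using T by (simp add: hb_lift_def)
  qed
qed

text \<open>The crossing of the lift and the inverse crossing of the action enclose \<open>k \<cdot> j\<close>, and \<open>i\<close> stays outside the
closed strand.\<close>

lemma hb_act_hb_lift:
  assumes i: "i \<in> Hom X Z" and j: "j \<in> Hom Z Y" and k: "k \<in> Hom Y Z"
  shows "hb_act Z e X (\<lambda>S. if S \<in> Irr then (a * dm C S) \<star> hb_lift Z e j i S else 0) k
    = a \<star> ((\<Sum>S\<in>Irr. dm C S \<star> ptr S Z Z (hb_term Z e (k \<cdot> j) S (e S))) \<cdot> i)"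
proof -
  have kj: "k \<cdot> j \<in> Hom Z Z" by (rule cmp_in[OF j k])
  have t: "hb_term Z e (k \<cdot> j) S (e S) \<in> Hom (S \<bullet> Z) (S \<bullet> Z)" for S by (rule hb_term_in[OF hb_in[OF hb] kj])
  have p: "dm C S \<star> ptr S Z Z (hb_term Z e (k \<cdot> j) S (e S)) \<in> Hom Z Z" for S by (rule Hom_smul[OF ptr_in[OF t]])
  have "ptr S X Z (hb_term Z e k S ((a * dm C S) \<star> hb_lift Z e j i S))
      = a \<star> (dm C S \<star> ptr S Z Z (hb_term Z e (k \<cdot> j) S (e S)) \<cdot> i)" for S
  proof -
    have di: "box i [X] [Z]" by (rule den_box) (simp add: i)
    have dj: "box j [Z] [Y]" by (rule den_box) (simp add: j)
    have dk: "box k [Y] [Z]" by (rule den_box) (simp add: k)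
    have "hb_term Z e k S (hb_lift Z e j i S) = (Ident S \<otimes> Ident Z) \<cdot> hb_term Z e (k \<cdot> j) S (e S) \<cdot> (Ident S \<otimes> i)"
      unfolding hb_term_def hb_lift_def
      by (rule den_eqI[where w="[S, X]" and v="[S, Z]"], (rule di dj dk den_hb[OF hb] den_hb_inv[OF hb] den_intros | simp)+)
    then have "ptr S X Z (hb_term Z e k S (hb_lift Z e j i S)) = ptr S Z Z (hb_term Z e (k \<cdot> j) S (e S)) \<cdot> i"
      using ptr_natural[OF t Ident_in i, of S] Ident_cmp[OF ptr_in[OF t]] by simp
    moreover have "ptr S X Z (hb_term Z e k S (c \<star> hb_lift Z e j i S)) = c \<star> ptr S X Z (hb_term Z e k S (hb_lift Z e j i S))" for c
      using linear_map_on_compose[OF hb_term_linear_right[OF k] ptr_linear, of S X] hb_lift_in[OF j i, of S]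
      unfolding linear_map_on_def by blast
    ultimately show ?thesis by (simp add: cmp_smul_left[OF i ptr_in[OF t]])
  qed
  then have "hb_act Z e X (\<lambda>S. if S \<in> Irr then (a * dm C S) \<star> hb_lift Z e j i S else 0) k
      = (\<Sum>S\<in>Irr. a \<star> (dm C S \<star> ptr S Z Z (hb_term Z e (k \<cdot> j) S (e S)) \<cdot> i))"
    by (simp add: hb_act_def)
  also have "\<dots> = a \<star> ((\<Sum>S\<in>Irr. dm C S \<star> ptr S Z Z (hb_term Z e (k \<cdot> j) S (e S))) \<cdot> i)"
    by (simp add: cmp_sum_left[OF i p] vs.scale_sum_right)
  finally show ?thesis .
qed

end

end

section \<open>The trace pairing\<close>

context modular_tensor_category
begin

lemma basis_expansion:
  assumes T: "T \<in> Irr" and m: "m \<in> Hom T B"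
  shows "m = (\<Sum>b\<in>basis T B. b \<cdot> (cobasis T B b \<cdot> m))"
proof -
  have "m = (\<Sum>U\<in>Irr. \<Sum>b\<in>basis U B. b \<cdot> cobasis U B b \<cdot> m)"
    using linear_map_on_Ident[OF cmp_linear_left[OF m]] Ident_cmp[OF m] by simp
  also have "\<dots> = (\<Sum>U\<in>Irr. if U = T then (\<Sum>b\<in>basis T B. b \<cdot> (cobasis T B b \<cdot> m)) else 0)"
  proof (rule sum.cong[OF refl])
    fix U assume U: "U \<in> Irr"
    have assoc: "b \<cdot> cobasis U B b \<cdot> m = b \<cdot> (cobasis U B b \<cdot> m)" if "b \<in> basis U B" for b
      by (rule cmp_assoc[OF m cobasis_in[OF U that] basis_in[OF U that], symmetric])
    show "(\<Sum>b\<in>basis U B. b \<cdot> cobasis U B b \<cdot> m) = (if U = T then (\<Sum>b\<in>basis T B. b \<cdot> (cobasis T B b \<cdot> m)) else 0)"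
    proof (cases "U = T")
      case True
      then show ?thesis using assoc by simp
    next
      case False
      have "b \<cdot> cobasis U B b \<cdot> m = 0" if b: "b \<in> basis U B" for b
      proof -
        have "cobasis U B b \<cdot> m = 0" using Hom_Irr_zero[OF T U] False cmp_in[OF m cobasis_in[OF U b]] by blast
        then show ?thesis using assoc[OF b] cmp_zero_right[OF basis_in[OF U b]] by simp
      qed
      then show ?thesis using False by simp
    qed
  qed
  also have "\<dots> = (\<Sum>b\<in>basis T B. b \<cdot> (cobasis T B b \<cdot> m))" using T finite_Irr by simp
  finally show ?thesis .
qed

text \<open>The morphisms \<open>b \<cdot> a*\<close> through simple objects span \<open>Hom A B\<close>, and their dual basis for the
  trace pairing consists of the \<open>a \<cdot> b*\<close> divided by dimensions.\<close>

lemma trace_expansion: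
  assumes m: "m \<in> Hom A B"
  shows "m = (\<Sum>T\<in>Irr. \<Sum>a\<in>basis T A. \<Sum>b\<in>basis T B.
    (tr C A ((a \<cdot> cobasis T B b) \<cdot> m) / dm C T) \<star> (b \<cdot> cobasis T A a))"
proof -
  have "m = (\<Sum>T\<in>Irr. \<Sum>a\<in>basis T A. m \<cdot> (a \<cdot> cobasis T A a))"
    using linear_map_on_Ident[OF cmp_linear_right[OF m]] cmp_Ident[OF m] by simp
  also have "\<dots> = (\<Sum>T\<in>Irr. \<Sum>a\<in>basis T A. \<Sum>b\<in>basis T B.
    (tr C A ((a \<cdot> cobasis T B b) \<cdot> m) / dm C T) \<star> (b \<cdot> cobasis T A a))"
  proof (intro sum.cong refl)
    fix T a assume T: "T \<in> Irr" and a: "a \<in> basis T A"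
    note a' = basis_in[OF T a] and ac = cobasis_in[OF T a]
    have ma: "m \<cdot> a \<in> Hom T B" by (rule cmp_in[OF a' m])
    have s: "b \<cdot> (cobasis T B b \<cdot> (m \<cdot> a)) = (tr C A ((a \<cdot> cobasis T B b) \<cdot> m) / dm C T) \<star> b" if b: "b \<in> basis T B" for b
    proof -
      note b' = basis_in[OF T b] and bc = cobasis_in[OF T b]
      obtain c where c: "cobasis T B b \<cdot> (m \<cdot> a) = c \<star> Ident T"
        using End_scalar[OF T cmp_in[OF ma bc]] by blast
      have "tr C A ((a \<cdot> cobasis T B b) \<cdot> m) = tr C A (a \<cdot> (cobasis T B b \<cdot> m))"
        by (simp only: cmp_assoc[OF m bc a'])
      also have "\<dots> = tr C T (cobasis T B b \<cdot> m \<cdot> a)"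
        by (rule tr_cyclic[OF a' cmp_in[OF m bc]])
      also have "\<dots> = c * dm C T"
        by (simp only: cmp_assoc[OF a' m bc, symmetric] c tr_smul_Ident)
      finally show ?thesis using c dm_nonzero[OF T] cmp_smul_Ident[OF b'] by simp
    qed
    have "m \<cdot> (a \<cdot> cobasis T A a) = (\<Sum>b\<in>basis T B. (tr C A ((a \<cdot> cobasis T B b) \<cdot> m) / dm C T) \<star> b) \<cdot> cobasis T A a"
      using basis_expansion[OF T ma] s cmp_assoc[OF ac a' m] by simp
    also have "\<dots> = (\<Sum>b\<in>basis T B. (tr C A ((a \<cdot> cobasis T B b) \<cdot> m) / dm C T) \<star> (b \<cdot> cobasis T A a))"
      by (subst cmp_sum_left[OF ac Hom_smul[OF basis_in[OF T]]])
        (simp_all add: cmp_smul_left[OF ac basis_in[OF T]])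
    finally show "m \<cdot> (a \<cdot> cobasis T A a) = (\<Sum>b\<in>basis T B. (tr C A ((a \<cdot> cobasis T B b) \<cdot> m) / dm C T) \<star> (b \<cdot> cobasis T A a))" .
  qed
  finally show ?thesis .
qed

lemma trace_pairing_nondegenerate:
  assumes j: "j \<in> Hom X Y" and zero: "\<And>k. k \<in> Hom Y X \<Longrightarrow> tr C X (k \<cdot> j) = 0"
  shows "j = 0"
proof -
  have "tr C X ((a \<cdot> cobasis T Y b) \<cdot> j) = 0" if "T \<in> Irr" "a \<in> basis T X" "b \<in> basis T Y" for T a b
    by (rule zero[OF cmp_in[OF cobasis_in[OF that(1,3)] basis_in[OF that(1,2)]]])
  then show ?thesis by (subst trace_expansion[OF j]) simp
qed

text \<open>By \<open>trace_expansion\<close> the coefficients of the representing morphism have to be the values of \<open>\<beta>\<close> on the dual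
basis.\<close>

lemma trace_pairing_representable:
  assumes \<beta>: "linear_map_on (smul C) (*) (Hom Y X) UNIV \<beta>"
  shows "\<exists>j\<in>Hom X Y. \<forall>k\<in>Hom Y X. tr C X (k \<cdot> j) = \<beta> k"
proof -
  define j where "j = (\<Sum>T\<in>Irr. \<Sum>b\<in>basis T Y. \<Sum>a\<in>basis T X.
    (\<beta> (a \<cdot> cobasis T Y b) / dm C T) \<star> (b \<cdot> cobasis T X a))"
  have ba: "b \<cdot> cobasis T X a \<in> Hom X Y" and ab: "a \<cdot> cobasis T Y b \<in> Hom Y X"
    if "T \<in> Irr" "a \<in> basis T X" "b \<in> basis T Y" for T a b
    using cmp_in[OF cobasis_in basis_in] that by simp_all
  have \<beta>_smul: "\<beta> (c \<star> x) = c * \<beta> x" if "x \<in> Hom Y X" for c x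
    using \<beta> that unfolding linear_map_on_def by blast
  have j: "j \<in> Hom X Y" unfolding j_def by (intro Hom_sum Hom_smul ba)
  have "tr C X (k \<cdot> j) = \<beta> k" if k: "k \<in> Hom Y X" for k
  proof -
    have lin: "linear_map_on (smul C) (*) (Hom X Y) UNIV (\<lambda>x. tr C X (k \<cdot> x))"
      using cmp_in[OF _ k] cmp_add_right[OF k] cmp_smul_right[OF k]
      by (simp add: linear_map_on_def tr_add tr_smul)
    have i3: "(\<beta> (a \<cdot> cobasis T Y b) / dm C T) \<star> (b \<cdot> cobasis T X a) \<in> Hom X Y"
      if "T \<in> Irr" "b \<in> basis T Y" "a \<in> basis T X" for T a b
      by (rule Hom_smul[OF ba[OF that(1,3,2)]])
    have k3: "(tr C Y ((b \<cdot> cobasis T X a) \<cdot> k) / dm C T) \<star> (a \<cdot> cobasis T Y b) \<in> Hom Y X"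
      if "T \<in> Irr" "b \<in> basis T Y" "a \<in> basis T X" for T a b
      by (rule Hom_smul[OF ab[OF that(1,3,2)]])
    have "tr C X (k \<cdot> j) = (\<Sum>T\<in>Irr. \<Sum>b\<in>basis T Y. \<Sum>a\<in>basis T X.
        tr C X (k \<cdot> ((\<beta> (a \<cdot> cobasis T Y b) / dm C T) \<star> (b \<cdot> cobasis T X a))))"
      unfolding j_def using i3 by (simp add: linear_map_on_sum[OF lin] Hom_sum)
    also have "\<dots> = (\<Sum>T\<in>Irr. \<Sum>b\<in>basis T Y. \<Sum>a\<in>basis T X.
        \<beta> ((tr C Y ((b \<cdot> cobasis T X a) \<cdot> k) / dm C T) \<star> (a \<cdot> cobasis T Y b)))"
      using ba ab tr_cyclic[OF k] cmp_in[OF ba k]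
      by (intro sum.cong refl) (simp add: \<beta>_smul cmp_smul_right[OF k ba] tr_smul)
    also have "\<dots> = \<beta> k"
      by (subst (2) trace_expansion[OF k]) (use k3 in \<open>simp add: linear_map_on_sum[OF \<beta>] Hom_sum\<close>)
    finally show ?thesis .
  qed
  with j show ?thesis by blast
qed

section \<open>The representations on \<open>I \<bullet> J\<close>\<close>

definition hb_IJ :: "'o \<Rightarrow> 'o \<Rightarrow> 'o \<Rightarrow> 'm" where
  "hb_IJ I J X = (Ident I \<otimes> inv_braid C J X) \<cdot> (braid X I \<otimes> Ident J)"

lemma half_braiding_IJ: "half_braiding (I \<bullet> J) (hb_IJ I J)"
  using half_braiding_tens[OF half_braiding_braid[of I] half_braiding_inv_braid[of J]]
  unfolding hb_IJ_def[abs_def] .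

lemma ptr_hb_term_eq:
  assumes hb: "half_braiding Z e" and f: "f \<in> Hom (S \<bullet> A) (Y \<bullet> S)" and g: "g \<in> Hom Y Z"
  shows "(Ident Z \<otimes> ev S) \<cdot> (e (dual S) \<otimes> Ident S) \<cdot> (Ident (dual S) \<otimes> g \<otimes> Ident S) \<cdot>
    (Ident (dual S) \<otimes> f) \<cdot> (coevt S \<otimes> Ident A) = ptr S A Z (hb_term Z e g S f)"
proof -
  have df: "box f [S, A] [Y, S]" by (rule den_box) (simp add: f)
  have dg: "box g [Y] [Z]" by (rule den_box) (simp add: g)
  note dens = df dg den_hb[OF hb] den_hb_inv[OF hb] den_duals den_intros
  have dt: "den (hb_term Z e g S f) [S, A] [S, Z]
      (\<lambda>n s. layer n [Z, S] (hb_inv Z e S) [S, Z] (layer n [Y] g [Z] (layer n [S, A] f [Y, S] s)))"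
    unfolding hb_term_def by (rule den_cong, (rule dens | simp)+)
  show ?thesis
    unfolding hb_ev[OF hb]
    by (rule den_eqI[where w="[A]" and v="[Z]"], (rule den_ptr dt dens | simp)+)
qed

text \<open>The crossing of \<open>dual S\<close> in the definition of \<open>F\<^sub>I\<^sub>J\<close> is moved by \<open>hb_ev\<close> to the other end of the cap, where
it becomes the inverse crossing of \<open>S\<close>.\<close>

lemma FIJ_ac:
  assumes f: "f \<in> tube_Hom C Irr A Y" and g: "g \<in> Hom Y (I \<bullet> J)"
  shows "ac (FIJ C Irr I J) A Y f g = hb_act (I \<bullet> J) (hb_IJ I J) A f g"
  unfolding FIJ_def hb_act_def presheaf.simps
proof (rule sum.cong[OF refl])
  fix S assume S: "S \<in> Irr"
  have "(Ident (I \<bullet> J) \<otimes> ev S) \<cdot> (Ident I \<otimes> inv_braid C J (dual S) \<otimes> Ident S) \<cdot> (braid (dual S) I \<otimes> Ident (J \<bullet> S))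
      = (Ident (I \<bullet> J) \<otimes> ev S) \<cdot> (hb_IJ I J (dual S) \<otimes> Ident S)"
    unfolding hb_IJ_def
    by (rule den_eqI[where w="[dual S, I, J, S]" and v="[I, J]"], (rule den_braids den_duals den_intros | simp)+)
  then show "(Ident (I \<bullet> J) \<otimes> ev S) \<cdot> (Ident I \<otimes> inv_braid C J (dual S) \<otimes> Ident S) \<cdot> (braid (dual S) I \<otimes> Ident (J \<bullet> S)) \<cdot>
      (Ident (dual S) \<otimes> g \<otimes> Ident S) \<cdot> (Ident (dual S) \<otimes> f S) \<cdot> (coevt S \<otimes> Ident A)
      = ptr S A (I \<bullet> J) (hb_term (I \<bullet> J) (hb_IJ I J) g S (f S))"
    using ptr_hb_term_eq[OF half_braiding_IJ tube_HomD[OF f S] g] by simp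
qed

lemma FIJ_ob_sc: "ob (FIJ C Irr I J) X = Hom X (I \<bullet> J)" "sc (FIJ C Irr I J) = smul C"
  by (simp_all add: FIJ_def)

lemma lambda_mor_eq:
  assumes j: "j \<in> Hom (I \<bullet> J) Y" and i: "i \<in> Hom X (I \<bullet> J)"
  shows "lambda_mor C Irr I J j i = (\<lambda>S. if S \<in> Irr then
    (dm C I * dm C J / global_dim C Irr * dm C S) \<star> hb_lift (I \<bullet> J) (hb_IJ I J) j i S else 0)"
proof -
  have di: "box i [X] [I, J]" by (rule den_box) (simp add: i)
  have dj: "box j [I, J] [Y]" by (rule den_box) (simp add: j)
  have eq: "(j \<otimes> Ident S) \<cdot> (Ident I \<otimes> inv_braid C J S) \<cdot> (braid S I \<otimes> Ident J) \<cdot> (Ident S \<otimes> i)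
      = hb_lift (I \<bullet> J) (hb_IJ I J) j i S" for S
    unfolding hb_lift_def hb_IJ_def
    by (rule den_eqI[where w="[S, X]" and v="[Y, S]"], (rule di dj den_braids den_intros | simp)+)
  show ?thesis by (rule ext) (simp only: lambda_mor_def eq)
qed

lemma is_tube_rep_FIJ: "is_tube_rep C Irr (FIJ C Irr I J)"
  unfolding is_tube_rep_def FIJ_ob_sc
proof (intro conjI allI ballI)
  let ?Z = "I \<bullet> J" and ?e = "hb_IJ I J"
  note hb = half_braiding_IJ[of I J]
  show "vector_space (smul C)" by (rule vector_space)
  show "finite_dim_subspace (smul C) (Hom X ?Z)" for X by (rule Hom_finite_dim)
  show "linear_map_on (smul C) (smul C) (Hom Y ?Z) (Hom A ?Z) (ac (FIJ C Irr I J) A Y f)"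
    if f: "f \<in> tube_Hom C Irr A Y" for A Y f
    using hb_act_linear[OF hb f] unfolding linear_map_on_def
    by (simp add: FIJ_ac[OF f] Hom_add Hom_smul)
  show "linear_map_on (tube_smul C) (smul C) (tube_Hom C Irr A Y) (Hom A ?Z) (\<lambda>f. ac (FIJ C Irr I J) A Y f v)"
    if v: "v \<in> Hom Y ?Z" for A Y v
  proof -
    have "f + f' \<in> tube_Hom C Irr A Y" "tube_smul C a f \<in> tube_Hom C Irr A Y"
      if "f \<in> tube_Hom C Irr A Y" "f' \<in> tube_Hom C Irr A Y" for f f' a
      using that by (simp_all add: tube_Hom_def tube_smul_def Hom_add Hom_smul)
    then show ?thesis
      using hb_act_linear_left[OF hb v] unfolding linear_map_on_def by (simp add: FIJ_ac[OF _ v])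
  qed
  show "ac (FIJ C Irr I J) X X (tube_Ident C X) v = v" if v: "v \<in> Hom X ?Z" for X v
    using FIJ_ac[OF tube_Ident_in v] hb_act_Ident[OF hb v] by simp
  show "ac (FIJ C Irr I J) X Z (tube_cmp C Irr X Z g f) v = ac (FIJ C Irr I J) X Y f (ac (FIJ C Irr I J) Y Z g v)"
    if f: "f \<in> tube_Hom C Irr X Y" and g: "g \<in> tube_Hom C Irr Y Z" and v: "v \<in> Hom Z ?Z" for X Y Z f g v
    using FIJ_ac[OF tube_cmp_in[OF f g] v] FIJ_ac[OF g v] FIJ_ac[OF f hb_act_in[OF hb g v]] hb_act_cmp[OF hb f g v]
    by simp
qed

lemma yoneda_Nat_trans:
  assumes F: "is_tube_rep C Irr F" and k: "k \<in> ob F Y"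
  shows "yoneda C Irr F Y k \<in> Nat_trans C Irr (sharp C Irr Y) F"
proof -
  have tube: "f + f' \<in> tube_Hom C Irr A Y" "tube_smul C a f \<in> tube_Hom C Irr A Y"
    if "f \<in> tube_Hom C Irr A Y" "f' \<in> tube_Hom C Irr A Y" for f f' a A
    using that by (simp_all add: tube_Hom_def tube_smul_def Hom_add Hom_smul)
  have "linear_map_on (tube_smul C) (sc F) (tube_Hom C Irr A Y) (ob F A) (yoneda C Irr F Y k A)" for A
  proof -
    have "linear_map_on (tube_smul C) (sc F) (tube_Hom C Irr A Y) (ob F A) (\<lambda>f. ac F A Y f k)"
      using F k by (simp add: is_tube_rep_def)
    then show ?thesis using tube unfolding linear_map_on_def yoneda_def by simp
  qed
  moreover have "yoneda C Irr F Y k A (tube_cmp C Irr A Y v f) = ac F A B f (yoneda C Irr F Y k B v)"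
    if f: "f \<in> tube_Hom C Irr A B" and v: "v \<in> tube_Hom C Irr B Y" for A B f v
    using F k f v tube_cmp_in[OF f v] by (simp add: is_tube_rep_def yoneda_def)
  moreover have "yoneda C Irr F Y k A v = 0" if "v \<notin> tube_Hom C Irr A Y" for A v
    using that by (simp add: yoneda_def)
  ultimately show ?thesis by (simp add: Nat_trans_def sharp_def)
qed

context
  fixes I J
  assumes I: "I \<in> Irr" and J: "J \<in> Irr"
begin

text \<open>Pulling the braiding of \<open>I \<bullet> J\<close> with \<open>S\<close> through \<open>f\<close> cancels the crossings of \<open>S\<close> with \<open>J\<close> and doubles
those with \<open>I\<close>.\<close>

lemma hb_term_IJ:
  assumes f: "f \<in> Hom (I \<bullet> J) (I \<bullet> J)"
  shows "hb_term (I \<bullet> J) (hb_IJ I J) f S (hb_IJ I J S)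
    = ((inv_braid C S I \<cdot> inv_braid C I S) \<otimes> Ident J) \<cdot> (Ident S \<otimes> f) \<cdot> (double_braid S I \<otimes> Ident J)"
proof -
  have df: "box f [I, J] [I, J]" by (rule den_box) (simp add: f)
  have de: "den (hb_IJ I J S) [S, I, J] [I, J, S]
      (\<lambda>n s. inv_braid_at (Suc n) J S (braid_at n S I s))"
    unfolding hb_IJ_def by (rule den_cong, (rule den_braids den_intros | simp)+)
  let ?g = "(inv_braid C S I \<otimes> Ident J) \<cdot> (Ident I \<otimes> braid J S)"
  have dg: "den ?g [I, J, S] [S, I, J]
      (\<lambda>n s. inv_braid_at n S I (braid_at (Suc n) J S s))"
    by (rule den_cong, (rule den_braids den_intros | simp)+)
  have inv: "hb_inv (I \<bullet> J) (hb_IJ I J) S = ?g"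
    unfolding hb_inv_def
  proof (rule iso_inv_eq)
    show "hb_IJ I J S \<in> Hom (S \<bullet> (I \<bullet> J)) (I \<bullet> J \<bullet> S)" "?g \<in> Hom (I \<bullet> J \<bullet> S) (S \<bullet> (I \<bullet> J))"
      using den_in[OF de] den_in[OF dg] by simp_all
    show "?g \<cdot> hb_IJ I J S = Ident (S \<bullet> (I \<bullet> J))"
      by (rule den_eqI[where w="[S, I, J]" and v="[S, I, J]"], (rule de dg den_intros | simp)+)
        (simp add: diagram_simps layer_inv_braid)
    show "hb_IJ I J S \<cdot> ?g = Ident (I \<bullet> J \<bullet> S)"
      by (rule den_eqI[where w="[I, J, S]" and v="[I, J, S]"], (rule de dg den_intros | simp)+)
        (simp add: diagram_simps layer_inv_braid)
  qed
  have nat [rule_format]: "\<forall>n s. fits n [I, J, S] (fst s) \<longrightarrow> diagram s \<longrightarrow>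
      braid_at n I S (braid_at (Suc n) J S (layer n [I, J] f [I, J] s))
      = layer (Suc n) [I, J] f [I, J] (braid_at n I S (braid_at (Suc n) J S s))"
    by (rule den_eqD[OF braid_natural[OF f Ident_in[of S]]]; rule den_cong,
      (rule den_braid_tens_left df den_intros | simp)+)
  have "hb_term (I \<bullet> J) (hb_IJ I J) f S (hb_IJ I J S)
      = ((inv_braid C S I \<cdot> inv_braid C I S) \<otimes> Ident J) \<cdot>
        ((braid I S \<otimes> Ident J) \<cdot> (Ident I \<otimes> braid J S) \<cdot> (f \<otimes> Ident S)) \<cdot> hb_IJ I J S"
    unfolding hb_term_def inv
    by (rule den_eqI[where w="[S, I, J]" and v="[S, I, J]"], (rule de dg df den_braids den_intros | simp)+)
      (simp add: diagram_simps layer_inv_braid f)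
  also have "\<dots> = ((inv_braid C S I \<cdot> inv_braid C I S) \<otimes> Ident J) \<cdot> (Ident S \<otimes> f) \<cdot> (double_braid S I \<otimes> Ident J)"
    by (rule den_eqI[where w="[S, I, J]" and v="[S, I, J]"], (rule de dg df den_braids den_double_braid_braids den_intros | simp)+)
      (simp add: diagram_simps layer_inv_braid nat f)
  finally show ?thesis .
qed

text \<open>Averaging an endomorphism of \<open>I \<bullet> J\<close> over all strands \<open>S\<close> gives a scalar.  On the strand \<open>J\<close>
  the crossings cancel by naturality of the braiding, and the loops around \<open>I\<close> close the \<open>I\<close> strand of
  \<open>f\<close>, which leaves an endomorphism of the simple object \<open>J\<close>.\<close>

lemma sum_ptr_hb_term_IJ:
  assumes f: "f \<in> Hom (I \<bullet> J) (I \<bullet> J)"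
  shows "(\<Sum>S\<in>Irr. dm C S \<star> ptr S (I \<bullet> J) (I \<bullet> J) (hb_term (I \<bullet> J) (hb_IJ I J) f S (hb_IJ I J S)))
    = (global_dim C Irr / (dm C I * dm C J) * tr C (I \<bullet> J) f) \<star> Ident (I \<bullet> J)"
proof -
  obtain a where a: "ptr I J J f = a \<star> Ident J" using End_scalar[OF J ptr_in[OF f]] by blast
  then have "a * dm C J = tr C (I \<bullet> J) f" using tr_tens[OF f] by (simp add: tr_smul_Ident)
  then have a': "a = tr C (I \<bullet> J) f / dm C J" using dm_nonzero[OF J] by (simp add: field_simps)
  show ?thesis
    unfolding hb_term_IJ[OF f] sum_ptr_double_braid_conjugate[OF I f]
    by (simp add: a a' tens_smul_right[OF Ident_in Ident_in] tens_Ident)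
qed

lemma lambda_mor_in:
  assumes j: "j \<in> Hom (I \<bullet> J) Y" and i: "i \<in> Hom X (I \<bullet> J)"
  shows "lambda_mor C Irr I J j i \<in> tube_Hom C Irr X Y"
  unfolding lambda_mor_eq[OF j i] using Hom_smul[OF hb_lift_in[OF half_braiding_IJ j i]]
  by (simp add: tube_Hom_def)

lemma FIJ_ac_lambda_mor:
  assumes j: "j \<in> Hom (I \<bullet> J) Y" and i: "i \<in> Hom X (I \<bullet> J)" and k: "k \<in> Hom Y (I \<bullet> J)"
  shows "ac (FIJ C Irr I J) X Y (lambda_mor C Irr I J j i) k = tr C (I \<bullet> J) (k \<cdot> j) \<star> i"
proof -
  have "ac (FIJ C Irr I J) X Y (lambda_mor C Irr I J j i) k
      = (dm C I * dm C J / global_dim C Irr) \<star>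
        ((global_dim C Irr / (dm C I * dm C J) * tr C (I \<bullet> J) (k \<cdot> j)) \<star> i)"
    using FIJ_ac[OF lambda_mor_in[OF j i] k] hb_act_hb_lift[OF half_braiding_IJ i j k]
      sum_ptr_hb_term_IJ[OF cmp_in[OF j k]]
    by (simp add: lambda_mor_eq[OF j i] smul_Ident_cmp[OF i])
  then show ?thesis using dm_nonzero[OF I] dm_nonzero[OF J] global_dim_nonzero by simp
qed

lemma hb_lift_linear_right:
  assumes j: "j \<in> Hom (I \<bullet> J) Y"
  shows "linear_map_on (smul C) (smul C) (Hom X (I \<bullet> J)) (Hom (S \<bullet> X) (Y \<bullet> S)) (\<lambda>i. hb_lift (I \<bullet> J) (hb_IJ I J) j i S)"
  unfolding hb_lift_def
  by (rule linear_map_on_compose[OF tens_linear_right[OF Ident_in]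
    cmp_linear_right[OF cmp_in[OF hb_in[OF half_braiding_IJ] tens_in[OF j Ident_in]]]])

lemma hb_lift_linear_left:
  assumes i: "i \<in> Hom X (I \<bullet> J)"
  shows "linear_map_on (smul C) (smul C) (Hom (I \<bullet> J) Y) (Hom (S \<bullet> X) (Y \<bullet> S)) (\<lambda>j. hb_lift (I \<bullet> J) (hb_IJ I J) j i S)"
  unfolding hb_lift_def
  by (rule linear_map_on_compose[OF linear_map_on_compose[OF tens_linear_left[OF Ident_in]
    cmp_linear_left[OF hb_in[OF half_braiding_IJ]]] cmp_linear_left[OF tens_in[OF Ident_in i]]])

lemma lambda_nat_in:
  assumes j: "j \<in> Hom (I \<bullet> J) Y"
  shows "lambda_nat C Irr I J j \<in> Nat_trans C Irr (FIJ C Irr I J) (sharp C Irr Y)"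
proof -
  note l = hb_lift_linear_right[OF j, unfolded linear_map_on_def]
  have "linear_map_on (smul C) (tube_smul C) (Hom X (I \<bullet> J)) (tube_Hom C Irr X Y) (lambda_nat C Irr I J j X)" for X
    unfolding linear_map_on_def
  proof (intro conjI ballI allI)
    fix i i' assume i: "i \<in> Hom X (I \<bullet> J)" and i': "i' \<in> Hom X (I \<bullet> J)"
    show "lambda_nat C Irr I J j X i \<in> tube_Hom C Irr X Y"
      using i lambda_mor_in[OF j i] by (simp add: lambda_nat_def)
    show "lambda_nat C Irr I J j X (i + i') = lambda_nat C Irr I J j X i + lambda_nat C Irr I J j X i'"
      using i i' l Hom_add[OF i i']
      by (auto simp: lambda_nat_def lambda_mor_eq[OF j] vs.scale_right_distrib)
    show "lambda_nat C Irr I J j X (a \<star> i) = tube_smul C a (lambda_nat C Irr I J j X i)" for a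
      using i l Hom_smul[OF i, of a]
      by (auto simp: lambda_nat_def lambda_mor_eq[OF j] tube_smul_def mult.commute)
  qed
  moreover have "lambda_nat C Irr I J j A (ac (FIJ C Irr I J) A X f i)
      = tube_cmp C Irr A Y (lambda_nat C Irr I J j X i) f"
    if f: "f \<in> tube_Hom C Irr A X" and i: "i \<in> Hom X (I \<bullet> J)" for A X f i
  proof -
    have Fi: "hb_act (I \<bullet> J) (hb_IJ I J) A f i \<in> Hom A (I \<bullet> J)" by (rule hb_act_in[OF half_braiding_IJ f i])
    show ?thesis
      using hb_lift_natural[OF half_braiding_IJ f i j, of "dm C I * dm C J / global_dim C Irr"] i Fi
      by (simp add: lambda_nat_def FIJ_ac[OF f i] lambda_mor_eq[OF j i] lambda_mor_eq[OF j Fi])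
  qed
  ultimately show ?thesis by (simp add: Nat_trans_def FIJ_ob_sc sharp_def lambda_nat_def)
qed

lemma yoneda_lambda_nat:
  assumes j: "j \<in> Hom (I \<bullet> J) Y" and k: "k \<in> Hom Y (I \<bullet> J)"
  shows "nat_cmp (yoneda C Irr (FIJ C Irr I J) Y k) (lambda_nat C Irr I J j)
    = nat_smul (FIJ C Irr I J) (tr C (I \<bullet> J) (k \<cdot> j)) (nat_Ident (FIJ C Irr I J))"
proof (intro ext)
  fix X v
  show "nat_cmp (yoneda C Irr (FIJ C Irr I J) Y k) (lambda_nat C Irr I J j) X v
    = nat_smul (FIJ C Irr I J) (tr C (I \<bullet> J) (k \<cdot> j)) (nat_Ident (FIJ C Irr I J)) X v"
  proof (cases "v \<in> Hom X (I \<bullet> J)")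
    case True
    then show ?thesis
      using lambda_mor_in[OF j True] FIJ_ac_lambda_mor[OF j True k]
      by (simp add: nat_cmp_def yoneda_def lambda_nat_def nat_smul_def nat_Ident_def FIJ_ob_sc)
  next
    case False
    have "linear_map_on (tube_smul C) (smul C) (tube_Hom C Irr X Y) (Hom X (I \<bullet> J)) (\<lambda>f. hb_act (I \<bullet> J) (hb_IJ I J) X f k)"
      by (rule hb_act_linear_left[OF half_braiding_IJ k])
    moreover have z: "0 \<in> tube_Hom C Irr X Y" by (simp add: tube_Hom_def)
    ultimately have "hb_act (I \<bullet> J) (hb_IJ I J) X (0 + 0) k = hb_act (I \<bullet> J) (hb_IJ I J) X 0 k + hb_act (I \<bullet> J) (hb_IJ I J) X 0 k"
      unfolding linear_map_on_def by blast
    then have "ac (FIJ C Irr I J) X Y 0 k = 0" using FIJ_ac[OF z k] by simp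
    then show ?thesis
      using False by (simp add: nat_cmp_def yoneda_def lambda_nat_def nat_smul_def nat_Ident_def FIJ_ob_sc)
  qed
qed

lemma trace_functional_linear:
  "linear_map_on (smul C) functional_smul (Hom (I \<bullet> J) Y) (dual_space (smul C) (Hom Y (I \<bullet> J))) (trace_functional C I J Y)"
  unfolding linear_map_on_def
proof (intro conjI ballI allI)
  fix j j' assume j: "j \<in> Hom (I \<bullet> J) Y" and j': "j' \<in> Hom (I \<bullet> J) Y"
  note jk = cmp_in[OF j] cmp_in[OF j']
  show "trace_functional C I J Y j \<in> dual_space (smul C) (Hom Y (I \<bullet> J))"
    using jk by (simp add: dual_space_def trace_functional_def linear_map_on_def Hom_add Hom_smul
      cmp_add_left[OF j] cmp_smul_left[OF j] tr_add tr_smul)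
  show "trace_functional C I J Y (j + j') = trace_functional C I J Y j + trace_functional C I J Y j'"
    using jk by (auto simp: trace_functional_def cmp_add_right[OF _ j j'] tr_add)
  show "trace_functional C I J Y (a \<star> j) = functional_smul a (trace_functional C I J Y j)" for a
    using jk by (auto simp: trace_functional_def functional_smul_def cmp_smul_right[OF _ j] tr_smul)
qed

lemma trace_functional_bij:
  "bij_betw (trace_functional C I J Y) (Hom (I \<bullet> J) Y) (dual_space (smul C) (Hom Y (I \<bullet> J)))"
proof (rule bij_betwI')
  let ?t = "trace_functional C I J Y"
  note lin = trace_functional_linear[of Y, unfolded linear_map_on_def]
  fix j j' assume j: "j \<in> Hom (I \<bullet> J) Y" and j': "j' \<in> Hom (I \<bullet> J) Y"
  show "?t j = ?t j' \<longleftrightarrow> j = j'"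
  proof
    assume eq: "?t j = ?t j'"
    have "?t j' + ?t (j - j') = ?t j"
      using lin j' Hom_diff[OF j j'] by (metis add.commute diff_add_cancel)
    then have zero: "?t (j - j') = 0" using eq by simp
    have "tr C (I \<bullet> J) (k \<cdot> (j - j')) = 0" if "k \<in> Hom Y (I \<bullet> J)" for k
    proof -
      have "?t (j - j') k = 0" by (simp only: zero zero_fun_apply)
      then show ?thesis using that by (simp add: trace_functional_def)
    qed
    then have "j - j' = 0" by (rule trace_pairing_nondegenerate[OF Hom_diff[OF j j']])
    then show "j = j'" by simp
  qed simp
next
  show "trace_functional C I J Y j \<in> dual_space (smul C) (Hom Y (I \<bullet> J))" if "j \<in> Hom (I \<bullet> J) Y" for j
    using trace_functional_linear[of Y] that unfolding linear_map_on_def by blast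
next
  fix \<beta> assume \<beta>: "\<beta> \<in> dual_space (smul C) (Hom Y (I \<bullet> J))"
  then obtain j where "j \<in> Hom (I \<bullet> J) Y" "\<forall>k\<in>Hom Y (I \<bullet> J). tr C (I \<bullet> J) (k \<cdot> j) = \<beta> k"
    using trace_pairing_representable[of Y "I \<bullet> J" \<beta>] unfolding dual_space_def by blast
  moreover from this have "\<beta> = trace_functional C I J Y j"
    using \<beta> by (auto simp: trace_functional_def dual_space_def)
  ultimately show "\<exists>j\<in>Hom (I \<bullet> J) Y. \<beta> = trace_functional C I J Y j" by blast
qed

lemma is_opposite_FIJ:
  "is_opposite C Irr (FIJ C Irr I J) Y (yoneda C Irr (FIJ C Irr I J) Y)
    (\<lambda>\<beta>. lambda_nat C Irr I J (inv_into (Hom (I \<bullet> J) Y) (trace_functional C I J Y) \<beta>))"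
proof -
  let ?H = "Hom (I \<bullet> J) Y" and ?D = "dual_space (smul C) (Hom Y (I \<bullet> J))" and ?t = "trace_functional C I J Y"
  let ?i = "inv_into ?H ?t"
  note bij = trace_functional_bij[of Y] and lin = trace_functional_linear[of Y, unfolded linear_map_on_def]
  have i: "?i \<beta> \<in> ?H" "?t (?i \<beta>) = \<beta>" if "\<beta> \<in> ?D" for \<beta>
    using that bij by (auto simp: bij_betw_def inv_into_into f_inv_into_f)
  have inv: "?i (?t j) = j" if "j \<in> ?H" for j
    using that bij by (simp add: bij_betw_def)
  have add: "?i (\<beta> + \<gamma>) = ?i \<beta> + ?i \<gamma>" if "\<beta> \<in> ?D" "\<gamma> \<in> ?D" for \<beta> \<gamma>
    using inv[OF Hom_add[OF i(1)[OF that(1)] i(1)[OF that(2)]]] lin i that by metis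
  have smul: "?i (functional_smul a \<beta>) = a \<star> ?i \<beta>" if "\<beta> \<in> ?D" for a \<beta>
    using inv[OF Hom_smul[OF i(1)[OF that]], of a] lin i that by metis
  have l_add: "lambda_nat C Irr I J (j + j') = lambda_nat C Irr I J j + lambda_nat C Irr I J j'"
    if j: "j \<in> ?H" "j' \<in> ?H" for j j'
  proof (intro ext)
    fix X v S
    show "lambda_nat C Irr I J (j + j') X v S = (lambda_nat C Irr I J j + lambda_nat C Irr I J j') X v S"
      using hb_lift_linear_left[of v X Y S] j
      by (auto simp: lambda_nat_def lambda_mor_eq[OF Hom_add[OF j]] lambda_mor_eq[OF j(1)] lambda_mor_eq[OF j(2)]
        linear_map_on_def vs.scale_right_distrib)
  qed
  have l_smul: "lambda_nat C Irr I J (a \<star> j) = nat_smul (sharp C Irr Y) a (lambda_nat C Irr I J j)"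
    if j: "j \<in> ?H" for j a
  proof (intro ext)
    fix X v S
    show "lambda_nat C Irr I J (a \<star> j) X v S = nat_smul (sharp C Irr Y) a (lambda_nat C Irr I J j) X v S"
      using hb_lift_linear_left[of v X Y S] j
      by (auto simp: lambda_nat_def lambda_mor_eq[OF Hom_smul[OF j]] lambda_mor_eq[OF j]
        linear_map_on_def nat_smul_def sharp_def tube_smul_def mult.commute)
  qed
  have "\<beta> \<alpha> = tr C (I \<bullet> J) (\<alpha> \<cdot> ?i \<beta>)" if "\<alpha> \<in> Hom Y (I \<bullet> J)" "\<beta> \<in> ?D" for \<alpha> \<beta>
    using fun_cong[OF i(2)[OF that(2)], of \<alpha>] that(1) by (simp add: trace_functional_def)
  then show ?thesis
    unfolding is_opposite_def FIJ_ob_sc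
    using i(1) by (simp add: linear_map_on_def lambda_nat_in add smul l_add l_smul yoneda_lambda_nat)
qed

end

end

theorem theorem5p6:
  fixes C :: "('o, 'm::ab_group_add, 'k::alg_closed_field) tensor_data" (structure)
    and Irr :: "'o set" and I J Y :: 'o
  assumes "modular_tensor_category C Irr"
    and "I \<in> Irr" and "J \<in> Irr"
  shows "is_tube_rep C Irr (FIJ C Irr I J) \<and>
    linear_map_on (smul C) functional_smul
      (Hom (I \<bullet> J) Y) (dual_space (smul C) (Hom Y (I \<bullet> J))) (trace_functional C I J Y) \<and>
    bij_betw (trace_functional C I J Y)
      (Hom (I \<bullet> J) Y) (dual_space (smul C) (Hom Y (I \<bullet> J))) \<and>
    is_opposite C Irr (FIJ C Irr I J) Y
      (yoneda C Irr (FIJ C Irr I J) Y)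
      (\<lambda>\<beta>. lambda_nat C Irr I J (inv_into (Hom (I \<bullet> J) Y) (trace_functional C I J Y) \<beta>)) \<and>
    (\<forall>j\<in>Hom (I \<bullet> J) Y. \<forall>k\<in>Hom Y (I \<bullet> J).
       lambda_nat C Irr I J j \<in> Nat_trans C Irr (FIJ C Irr I J) (sharp C Irr Y) \<and>
       yoneda C Irr (FIJ C Irr I J) Y k \<in> Nat_trans C Irr (sharp C Irr Y) (FIJ C Irr I J) \<and>
       nat_cmp (yoneda C Irr (FIJ C Irr I J) Y k) (lambda_nat C Irr I J j) =
         nat_smul (FIJ C Irr I J) (tr C (I \<bullet> J) (k \<cdot> j)) (nat_Ident (FIJ C Irr I J)))"
proof -
  interpret modular_tensor_category C Irr by (rule assms(1))
  have "yoneda C Irr (FIJ C Irr I J) Y k \<in> Nat_trans C Irr (sharp C Irr Y) (FIJ C Irr I J)"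
    if "k \<in> Hom Y (I \<bullet> J)" for k
    using yoneda_Nat_trans[OF is_tube_rep_FIJ] that by (simp add: FIJ_ob_sc)
  then show ?thesis
    using is_tube_rep_FIJ trace_functional_linear[OF assms(2,3)] trace_functional_bij[OF assms(2,3)]
      is_opposite_FIJ[OF assms(2,3)] lambda_nat_in[OF assms(2,3)] yoneda_lambda_nat[OF assms(2,3)]
    by blast
qed

end
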